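(* Suppose the regularity assumption and the $\delta$-oracle assumption stated in the context hold. Run the HPGD algorithm described in the context for $T$ iterations with step size $\alpha\le 1/(2S_f)$, and let $\hat x_T$ be its output. Then $$\mathbb{E}\left\|\frac{dF(\hat x_T)}{dx}\right\|^2=\mathcal{O}\left(\frac{1}{\alpha T}+\delta+\alpha\right).$$ In particular, for $\alpha=\Theta(1/\sqrt T)$ and $\delta=\mathcal{O}(1/\sqrt T)$, HPGD converges to a stationary point at rate $\mathcal{O}(1/\sqrt T)$, i.e. $\mathbb{E}\left\|\frac{dF(\hat x_T)}{dx}\right\|^2=\mathcal{O}(1/\sqrt T)$.
   Context: Setting. $X=\mathbb{R}^d$ and $\xi$ is a random context with distribution $\mathbb{P}_\xi$. For every $x\in X$ and every context $\xi$ there is a Markov decision process $\mathcal M_{x,\xi}=(\mathcal S,\mathcal A,r_{x,\xi},P_{x,\xi},\mu_{x,\xi},\gamma)$ with finite state space $\mathcal S$, finite action space $\mathcal A$, reward $r_{x,\xi}:\mathcal S\times\mathcal A\to\mathbb{R}$, transition kernel $P_{x,\xi}(s';s,a)$, initial distribution $\mu_{x,\xi}$ and discount factor $\gamma\in(0,1)$. A policy $\pi$ assigns to each state $s$ a distribution $\pi(\cdot;s)$ on $\mathcal A$ and is viewed as a vector in $\mathbb{R}^{\mathcal S\times\mathcal A}$. Fix $\lambda>0$ and let $H(\pi;s)=-\sum_a\pi(a;s)\log\pi(a;s)$. Define $V^\pi_{\lambda,x,\xi}(s)=\mathbb{E}[\sum_{t\ge0}\gamma^t(r_{x,\xi}(s_t,a_t)+\lambda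 H(\pi;s_t))\mid s_0=s]$ with $a_t\sim\pi(\cdot;s_t)$, $s_{t+1}\sim P_{x,\xi}(\cdot;s_t,a_t)$. The follower's optimal policy $\pi^*_{x,\xi}$ is the unique optimal entropy-regularized policy, the maximizer of $\mathbb{E}_{s_0\sim\mu_{x,\xi}}[V^\pi_{\lambda,x,\xi}(s_0)]$ given by $\pi^*_{x,\xi}(a;s)\propto\exp(Q^*_{\lambda,x,\xi}(s,a)/\lambda)$ with $Q^*_{\lambda,x,\xi}$ the optimal regularized Q-function. The leader's loss is $f(x,\pi,\xi)\in\mathbb{R}$, and $F(x)=\mathbb{E}_\xi[f(x,\pi^*_{x,\xi},\xi)]$; the leader's problem is $\min_xF(x)$, whose minimum is assumed to exist. Regularity assumption. $f$ is differentiable in $(x,\pi)$ and there are constants $L_f,S_f$ such that for all $\xi$, $x_1,x_2$, $\pi_1,\pi_2$: $|f(x_1,\pi_1,\xi)-f(x_2,\pi_2,\xi)|\le L_f(\|x_1-x_2\|_\infty+\|\pi_1-\pi_2\|_\infty)$, $\|\partial_xf(x_1,\pi_1,\xi)-\partial_xf(x_2,\pi_2,\xi)\|_\infty\le S_f(\|x_1-x_2\|_\infty+\|\pi_1-\pi_2\|_\infty)$, and $\|\partial_\pi f(x_1,\pi_1,\xi)-\partial_\pi f(x_2,\pi_2,\xi)\|_\infty\le S_f(\|x_1-x_2\|_\infty+\|\pi_1-\pi_2\|_\infty)$. Moreover $r_{x,\xi}$ and $P_{x,\xi}$ are differentiable in $x$ and there are constants $\overline R,K_1,K_2$ such that for all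 $x,\xi,s,a,s'$: $|r_{x,\xi}(s,a)|<\overline R$, $\|\partial_x\log P_{x,\xi}(s';s,a)\|_\infty<K_1$ (where $P_{x,\xi}(s';s,a)>0$), $\|\partial_xr_{x,\xi}(s,a)\|_\infty<K_2$. $\delta$-oracle assumption. For any $\mathcal M_{x,\xi}$ there is an oracle $o$ returning trajectories sampled from a (possibly random) policy $\pi^o_{x,\xi}$ with $\mathbb{E}_o[\|\pi^*_{x,\xi}-\pi^o_{x,\xi}\|_\infty^2]\le\delta^2$ for all $x,\xi$. GradientEstimator$(\xi,x,s,a,o)$, with $\pi=\pi^o_{x,\xi}$. $\mathrm{Geo}(1-q)$ denotes the law on $\{0,1,2,\dots\}$ with mass $(1-q)q^k$ at $k$. Draw independently $T_Q,T_V\sim\mathrm{Geo}(1-\gamma)$ and $T'_Q,T'_V\sim\mathrm{Geo}(1-\gamma^{1/2})$. Sample a trajectory $(s_t,a_t)_{0\le t\le T_Q+T'_Q+1}$ of $\mathcal M_{x,\xi}$ under $\pi$ with $(s_0,a_0)=(s,a)$ and set $$\widehat{\partial_xQ}(s,a)=\sum_{t=0}^{T_Q}\partial_xr_{x,\xi}(s_t,a_t)+\frac{\gamma}{1-\gamma}\,\partial_x\log P_{x,\xi}(s_{T_Q+1};s_{T_Q},a_{T_Q})\sum_{t=T_Q+1}^{T_Q+T'_Q+1}\gamma^{(t-T_Q-1)/2}\bigl(r_{x,\xi}(s_t,a_t)+\lambda H(\pi;s_t)\bigr).$$ Define $\widehat{\partial_xV}(s)$ by the same formula with $T_V,T'_V$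 in place of $T_Q,T'_Q$ and an independent trajectory under $\pi$ with $s_0=s$, $a_0\sim\pi(\cdot;s)$. Output $\widehat{\partial_xA}(s,a)=\widehat{\partial_xQ}(s,a)-\widehat{\partial_xV}(s)$. HPGD. Fix a distribution $\nu$ on $\mathcal S$ with full support and an initial point $x_0$. For $t=0,\dots,T-1$: sample $\xi\sim\mathbb{P}_\xi$, $s\sim\nu$, $a\sim\pi^o_{x_t,\xi}(\cdot;s)$; let $\widehat{\partial_xA}(s,a)$ be the output of GradientEstimator$(\xi,x_t,s,a,o)$; set $$\widehat{\tfrac{dF}{dx}}=\frac{\partial_1f(x_t,\pi^o_{x_t,\xi},\xi)}{\partial x}+\frac{1}{\lambda\nu(s)}\,\frac{\partial_2f(x_t,\pi^o_{x_t,\xi},\xi)}{\partial\pi(a;s)}\,\widehat{\partial_xA}(s,a),\qquad x_{t+1}=x_t-\alpha\,\widehat{\tfrac{dF}{dx}}.$$ Here $\partial_1f/\partial x$ and $\partial_2 f/\partial\pi(a;s)$ are partial derivatives in the first and second argument. Output $\hat x_T$ drawn uniformly from $\{x_0,\dots,x_{T-1}\}$. Conventions. $\|\cdot\|$ is the sup norm on $\mathbb{R}^d$ (any other norm changes only constants). $\mathcal{O}(\cdot)$ hides constants independent of $T,\alpha,\delta$.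
   Formalization: The formal theorem additionally assumes that the x-gradients of the reward and of log P (where P>0) are Lipschitz in x, uniformly in context, states and actions; without this F need not have a Lipschitz gradient and the stated rate fails. *)

theory Defs
  imports "HOL-Probability.Probability"
begin

text \<open>The gradient exists uniquely wherever the function is differentiable.\<close>

definition gradient :: "('v::real_inner \<Rightarrow> real) \<Rightarrow> 'v \<Rightarrow> 'v" where
  "gradient g x = (THE D. GDERIV g x :> D)"

text \<open>The discount factor is common to all processes and is passed separately. The kernel value
  \<open>P(s'; s, a)\<close> is \<open>pmf (trans m s a) s'\<close>.\<close>

record ('s, 'a) mdp =
  reward :: "'s \<Rightarrow> 'a \<Rightarrow> real"
  trans :: "'s \<Rightarrow> 'a \<Rightarrow> 's pmf"
  init_dist :: "'s pmf"

type_synonym ('s, 'a) policy = "(real, 's \<times> 'a) vec"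

definition is_policy :: "('s::finite, 'a::finite) policy \<Rightarrow> bool" where
  "is_policy \<pi> \<longleftrightarrow> (\<forall>s. (\<forall>a. 0 \<le> \<pi> $ (s, a)) \<and> (\<Sum>a\<in>UNIV. \<pi> $ (s, a)) = 1)"

definition action_pmf :: "('s::finite, 'a::finite) policy \<Rightarrow> 's \<Rightarrow> 'a pmf" where
  "action_pmf \<pi> s = embed_pmf (\<lambda>a. \<pi> $ (s, a))"

text \<open>Since \<open>ln 0 = 0\<close>, actions of probability zero contribute nothing to the entropy.\<close>

definition policy_entropy :: "('s::finite, 'a::finite) policy \<Rightarrow> 's \<Rightarrow> real" where
  "policy_entropy \<pi> s = - (\<Sum>a\<in>UNIV. \<pi> $ (s, a) * ln (\<pi> $ (s, a)))"

definition start_pmf :: "('s::finite, 'a::finite) policy \<Rightarrow> 's \<Rightarrow> ('s \<times> 'a) pmf" where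
  "start_pmf \<pi> s = map_pmf (Pair s) (action_pmf \<pi> s)"

definition step_pmf ::
  "('s::finite, 'a::finite) mdp \<Rightarrow> ('s, 'a) policy \<Rightarrow> 's \<times> 'a \<Rightarrow> ('s \<times> 'a) pmf" where
  "step_pmf m \<pi> z = bind_pmf (trans m (fst z) (snd z)) (start_pmf \<pi>)"

text \<open>The law of the infinite trajectory \<open>(s\<^sub>t, a\<^sub>t)\<close>, \<open>t \<ge> 0\<close>, under \<open>\<pi>\<close> with
  \<open>s\<^sub>0 = s\<close>, given by the Ionescu-Tulcea theorem.\<close>

definition trajectory_kernel ::
  "('s::finite, 'a::finite) mdp \<Rightarrow> ('s, 'a) policy \<Rightarrow> 's \<Rightarrow> nat \<Rightarrow> (nat \<Rightarrow> 's \<times> 'a) \<Rightarrow> ('s \<times> 'a) measure"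
  where
  "trajectory_kernel m \<pi> s i \<omega> =
     measure_pmf (if i = 0 then start_pmf \<pi> s else step_pmf m \<pi> (\<omega> (i - 1)))"

lemma Ionescu_Tulcea_trajectory_kernel:
  "Ionescu_Tulcea (trajectory_kernel m \<pi> s) (\<lambda>_. count_space UNIV)"
proof (rule Ionescu_Tulcea.intro)
  show "trajectory_kernel m \<pi> s i
      \<in> measurable (PiM {0..<i} (\<lambda>_. count_space UNIV)) (subprob_algebra (count_space UNIV))" for i
  proof (cases "i = 0")
    case True
    then show ?thesis
      by (simp add: trajectory_kernel_def[abs_def] space_subprob_algebra subprob_space_measure_pmf)
  next
    case False
    have "(\<lambda>\<omega>. measure_pmf (step_pmf m \<pi> (\<omega> (i - 1))))
        \<in> measurable (PiM {0..<i} (\<lambda>_. count_space UNIV)) (subprob_algebra (count_space UNIV))"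
    proof (rule measurable_compose[where f = "\<lambda>\<omega>. \<omega> (i - 1)" and N = "count_space UNIV"])
      show "(\<lambda>\<omega>. \<omega> (i - 1)) \<in> measurable (PiM {0..<i} (\<lambda>_. count_space UNIV)) (count_space UNIV)"
        using False by (intro measurable_component_singleton) simp
      show "(\<lambda>z. measure_pmf (step_pmf m \<pi> z))
          \<in> measurable (count_space UNIV) (subprob_algebra (count_space UNIV))"
        by (simp add: space_subprob_algebra subprob_space_measure_pmf)
    qed
    with False show ?thesis
      by (simp add: trajectory_kernel_def[abs_def])
  qed
  show "prob_space (trajectory_kernel m \<pi> s i \<omega>)" for i \<omega>
    by (simp add: trajectory_kernel_def measure_pmf.prob_space_axioms)
qed

definition trajectory_measure ::
  "('s::finite, 'a::finite) mdp \<Rightarrow> ('s, 'a) policy \<Rightarrow> 's \<Rightarrow> (nat \<Rightarrow> 's \<times> 'a) measure" where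
  "trajectory_measure m \<pi> s =
     projective_family.lim UNIV
       (Ionescu_Tulcea.CI (trajectory_kernel m \<pi> s) (\<lambda>_. count_space UNIV)) (\<lambda>_. count_space UNIV)"

text \<open>From here on \<open>\<kappa>\<close> is the weight of the entropy regularization.\<close>

definition value_fn ::
  "real \<Rightarrow> real \<Rightarrow> ('s::finite, 'a::finite) mdp \<Rightarrow> ('s, 'a) policy \<Rightarrow> 's \<Rightarrow> real" where
  "value_fn \<gamma> \<kappa> m \<pi> s =
     (\<integral>\<omega>. (\<Sum>t. \<gamma> ^ t * (reward m (fst (\<omega> t)) (snd (\<omega> t)) + \<kappa> * policy_entropy \<pi> (fst (\<omega> t))))
        \<partial>trajectory_measure m \<pi> s)"

definition q_fn ::
  "real \<Rightarrow> real \<Rightarrow> ('s::finite, 'a::finite) mdp \<Rightarrow> ('s, 'a) policy \<Rightarrow> 's \<Rightarrow> 'a \<Rightarrow> real" where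
  "q_fn \<gamma> \<kappa> m \<pi> s a =
     reward m s a + \<gamma> * measure_pmf.expectation (trans m s a) (value_fn \<gamma> \<kappa> m \<pi>)"

definition optimal_q ::
  "real \<Rightarrow> real \<Rightarrow> ('s::finite, 'a::finite) mdp \<Rightarrow> 's \<Rightarrow> 'a \<Rightarrow> real" where
  "optimal_q \<gamma> \<kappa> m s a = (SUP \<pi>\<in>{\<pi>. is_policy \<pi>}. q_fn \<gamma> \<kappa> m \<pi> s a)"

text \<open>If the initial distribution does not reach every state, its expected value alone does not
  determine the maximizer; the softmax form does.\<close>

definition is_follower_policy ::
  "real \<Rightarrow> real \<Rightarrow> ('s::finite, 'a::finite) mdp \<Rightarrow> ('s, 'a) policy \<Rightarrow> bool" where
  "is_follower_policy \<gamma> \<kappa> m \<pi> \<longleftrightarrow>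
     is_policy \<pi> \<and>
     (\<forall>\<pi>'. is_policy \<pi>' \<longrightarrow>
        measure_pmf.expectation (init_dist m) (value_fn \<gamma> \<kappa> m \<pi>')
        \<le> measure_pmf.expectation (init_dist m) (value_fn \<gamma> \<kappa> m \<pi>)) \<and>
     (\<forall>s a. \<pi> $ (s, a) =
        exp (optimal_q \<gamma> \<kappa> m s a / \<kappa>) / (\<Sum>b\<in>UNIV. exp (optimal_q \<gamma> \<kappa> m s b / \<kappa>)))"

definition follower_policy ::
  "real \<Rightarrow> real \<Rightarrow> ('s::finite, 'a::finite) mdp \<Rightarrow> ('s, 'a) policy" where
  "follower_policy \<gamma> \<kappa> m = (THE \<pi>. is_follower_policy \<gamma> \<kappa> m \<pi>)"

definition leader_objective ::
  "'c measure \<Rightarrow> real \<Rightarrow> real \<Rightarrow> (real ^ 'd \<Rightarrow> 'c \<Rightarrow> ('s::finite, 'a::finite) mdp) \<Rightarrow>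
   (real ^ 'd \<Rightarrow> ('s, 'a) policy \<Rightarrow> 'c \<Rightarrow> real) \<Rightarrow> real ^ 'd \<Rightarrow> real" where
  "leader_objective \<Xi> \<gamma> \<kappa> M f x = (\<integral>\<xi>. f x (follower_policy \<gamma> \<kappa> (M x \<xi>)) \<xi> \<partial>\<Xi>)"

text \<open>The partial derivatives of the loss with respect to single policy entries make sense only on an
  open set of vectors. The domain of the loss in its policy argument is therefore an open set
  \<open>U\<close> containing all policies, possibly the whole space.\<close>

definition regular_loss ::
  "'c measure \<Rightarrow> real \<Rightarrow> real \<Rightarrow>
   (real ^ 'd::finite \<Rightarrow> ('s::finite, 'a::finite) policy \<Rightarrow> 'c \<Rightarrow> real) \<Rightarrow> bool" where
  "regular_loss \<Xi> L S f \<longleftrightarrow>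
     (\<exists>U. open U \<and> {\<pi>. is_policy \<pi>} \<subseteq> U \<and>
       (\<forall>x. \<forall>\<pi>\<in>U. f x \<pi> \<in> borel_measurable \<Xi>) \<and>
       (\<forall>\<xi>\<in>space \<Xi>. \<forall>x. \<forall>\<pi>\<in>U. (\<lambda>(y, p). f y p \<xi>) differentiable (at (x, \<pi>))) \<and>
       (\<forall>\<xi>\<in>space \<Xi>. \<forall>x1 x2. \<forall>\<pi>1\<in>U. \<forall>\<pi>2\<in>U.
          \<bar>f x1 \<pi>1 \<xi> - f x2 \<pi>2 \<xi>\<bar> \<le> L * (infnorm (x1 - x2) + infnorm (\<pi>1 - \<pi>2)) \<and>
          infnorm (gradient (\<lambda>y. f y \<pi>1 \<xi>) x1 - gradient (\<lambda>y. f y \<pi>2 \<xi>) x2)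
            \<le> S * (infnorm (x1 - x2) + infnorm (\<pi>1 - \<pi>2)) \<and>
          infnorm (gradient (\<lambda>p. f x1 p \<xi>) \<pi>1 - gradient (\<lambda>p. f x2 p \<xi>) \<pi>2)
            \<le> S * (infnorm (x1 - x2) + infnorm (\<pi>1 - \<pi>2))))"

definition grad_reward ::
  "(real ^ 'd \<Rightarrow> 'c \<Rightarrow> ('s, 'a) mdp) \<Rightarrow> real ^ 'd \<Rightarrow> 'c \<Rightarrow> 's \<Rightarrow> 'a \<Rightarrow> real ^ 'd" where
  "grad_reward M x \<xi> s a = gradient (\<lambda>y. reward (M y \<xi>) s a) x"

definition grad_log_trans ::
  "(real ^ 'd \<Rightarrow> 'c \<Rightarrow> ('s, 'a) mdp) \<Rightarrow> real ^ 'd \<Rightarrow> 'c \<Rightarrow> 's \<Rightarrow> 'a \<Rightarrow> 's \<Rightarrow> real ^ 'd" where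
  "grad_log_trans M x \<xi> s a s' = gradient (\<lambda>y. ln (pmf (trans (M y \<xi>) s a) s')) x"

definition regular_mdps ::
  "'c measure \<Rightarrow> real \<Rightarrow> real \<Rightarrow> real \<Rightarrow>
   (real ^ 'd::finite \<Rightarrow> 'c \<Rightarrow> ('s::finite, 'a::finite) mdp) \<Rightarrow> bool" where
  "regular_mdps \<Xi> R K1 K2 M \<longleftrightarrow>
     (\<forall>x s a. (\<lambda>\<xi>. reward (M x \<xi>) s a) \<in> borel_measurable \<Xi>) \<and>
     (\<forall>x s a s'. (\<lambda>\<xi>. pmf (trans (M x \<xi>) s a) s') \<in> borel_measurable \<Xi>) \<and>
     (\<forall>\<xi>\<in>space \<Xi>. \<forall>x s a.
        (\<lambda>y. reward (M y \<xi>) s a) differentiable (at x) \<and>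
        \<bar>reward (M x \<xi>) s a\<bar> < R \<and>
        infnorm (grad_reward M x \<xi> s a) < K2 \<and>
        (\<forall>s'. (\<lambda>y. pmf (trans (M y \<xi>) s a) s') differentiable (at x) \<and>
           (0 < pmf (trans (M x \<xi>) s a) s' \<longrightarrow> infnorm (grad_log_trans M x \<xi> s a s') < K1)))"

text \<open>Without Lipschitz derivatives of rewards and transition probabilities the leader's objective
  need not have a Lipschitz gradient, and stochastic gradient descent then does not in general
  attain the rate claimed for smooth objectives.\<close>

definition smooth_mdps ::
  "'c measure \<Rightarrow> real \<Rightarrow> (real ^ 'd::finite \<Rightarrow> 'c \<Rightarrow> ('s::finite, 'a::finite) mdp) \<Rightarrow> bool" where
  "smooth_mdps \<Xi> K M \<longleftrightarrow>
     (\<forall>\<xi>\<in>space \<Xi>. \<forall>x1 x2 s a.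
        infnorm (grad_reward M x1 \<xi> s a - grad_reward M x2 \<xi> s a) \<le> K * infnorm (x1 - x2) \<and>
        (\<forall>s'. 0 < pmf (trans (M x1 \<xi>) s a) s' \<longrightarrow> 0 < pmf (trans (M x2 \<xi>) s a) s' \<longrightarrow>
           infnorm (grad_log_trans M x1 \<xi> s a s' - grad_log_trans M x2 \<xi> s a s')
             \<le> K * infnorm (x1 - x2)))"

text \<open>An oracle maps a decision and a context to the law of the policy it plays, a probability
  measure on the set of policies.\<close>

definition policy_algebra :: "('s::finite, 'a::finite) policy measure" where
  "policy_algebra = restrict_space borel {\<pi>. is_policy \<pi>}"

type_synonym ('d, 'c, 's, 'a) oracle_kernel = "real ^ 'd \<Rightarrow> 'c \<Rightarrow> ('s, 'a) policy measure"

definition delta_oracle ::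
  "'c measure \<Rightarrow> real \<Rightarrow> real \<Rightarrow> (real ^ 'd::finite \<Rightarrow> 'c \<Rightarrow> ('s::finite, 'a::finite) mdp) \<Rightarrow>
   real \<Rightarrow> ('d, 'c, 's, 'a) oracle_kernel \<Rightarrow> bool" where
  "delta_oracle \<Xi> \<gamma> \<kappa> M \<delta> orc \<longleftrightarrow>
     0 \<le> \<delta> \<and>
     (\<lambda>(x, \<xi>). orc x \<xi>) \<in> measurable (borel \<Otimes>\<^sub>M \<Xi>) (prob_algebra policy_algebra) \<and>
     (\<forall>x. \<forall>\<xi>\<in>space \<Xi>.
        (\<integral>\<pi>. (infnorm (follower_policy \<gamma> \<kappa> (M x \<xi>) - \<pi>))\<^sup>2 \<partial>orc x \<xi>) \<le> \<delta>\<^sup>2)"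

text \<open>A finite trajectory of \<open>n + 1\<close> state-action pairs, as a list.\<close>

primrec trajectory_pmf ::
  "('s::finite, 'a::finite) mdp \<Rightarrow> ('s, 'a) policy \<Rightarrow> nat \<Rightarrow> 's \<times> 'a \<Rightarrow> ('s \<times> 'a) list pmf" where
  "trajectory_pmf m \<pi> 0 z = return_pmf [z]"
| "trajectory_pmf m \<pi> (Suc n) z =
     bind_pmf (step_pmf m \<pi> z) (\<lambda>z'. map_pmf (Cons z) (trajectory_pmf m \<pi> n z'))"

text \<open>\<open>geometric_pmf p\<close> has mass \<open>(1 - p) ^ k * p\<close> at \<open>k\<close>, so \<open>Geo(1 - q)\<close> is
  \<open>geometric_pmf (1 - q)\<close>.\<close>

definition return_gradient_estimator ::
  "real \<Rightarrow> real \<Rightarrow> (real ^ 'd \<Rightarrow> 'c \<Rightarrow> ('s::finite, 'a::finite) mdp) \<Rightarrow> real ^ 'd \<Rightarrow> 'c \<Rightarrow>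
   ('s, 'a) policy \<Rightarrow> ('s \<times> 'a) pmf \<Rightarrow> (real ^ 'd) pmf" where
  "return_gradient_estimator \<gamma> \<kappa> M x \<xi> \<pi> start = do {
     T \<leftarrow> geometric_pmf (1 - \<gamma>);
     T' \<leftarrow> geometric_pmf (1 - \<gamma> powr (1 / 2));
     z \<leftarrow> start;
     \<tau> \<leftarrow> trajectory_pmf (M x \<xi>) \<pi> (T + T' + 1) z;
     return_pmf
       ((\<Sum>t = 0..T. grad_reward M x \<xi> (fst (\<tau> ! t)) (snd (\<tau> ! t)))
        + (\<gamma> / (1 - \<gamma>) *
            (\<Sum>t = T + 1..T + T' + 1. \<gamma> powr (real (t - T - 1) / 2) *
               (reward (M x \<xi>) (fst (\<tau> ! t)) (snd (\<tau> ! t)) + \<kappa> * policy_entropy \<pi> (fst (\<tau> ! t)))))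
          *\<^sub>R grad_log_trans M x \<xi> (fst (\<tau> ! T)) (snd (\<tau> ! T)) (fst (\<tau> ! (T + 1)))) }"

definition gradient_estimator ::
  "real \<Rightarrow> real \<Rightarrow> (real ^ 'd \<Rightarrow> 'c \<Rightarrow> ('s::finite, 'a::finite) mdp) \<Rightarrow> real ^ 'd \<Rightarrow> 'c \<Rightarrow>
   ('s, 'a) policy \<Rightarrow> 's \<Rightarrow> 'a \<Rightarrow> (real ^ 'd) pmf" where
  "gradient_estimator \<gamma> \<kappa> M x \<xi> \<pi> s a = do {
     gQ \<leftarrow> return_gradient_estimator \<gamma> \<kappa> M x \<xi> \<pi> (return_pmf (s, a));
     gV \<leftarrow> return_gradient_estimator \<gamma> \<kappa> M x \<xi> \<pi> (start_pmf \<pi> s);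
     return_pmf (gQ - gV) }"

definition hypergradient_estimator ::
  "real \<Rightarrow> real \<Rightarrow> (real ^ 'd::finite \<Rightarrow> 'c \<Rightarrow> ('s::finite, 'a::finite) mdp) \<Rightarrow>
   (real ^ 'd \<Rightarrow> ('s, 'a) policy \<Rightarrow> 'c \<Rightarrow> real) \<Rightarrow> 's pmf \<Rightarrow> real ^ 'd \<Rightarrow> 'c \<Rightarrow>
   ('s, 'a) policy \<Rightarrow> (real ^ 'd) pmf" where
  "hypergradient_estimator \<gamma> \<kappa> M f \<nu> x \<xi> \<pi> = do {
     s \<leftarrow> \<nu>;
     a \<leftarrow> action_pmf \<pi> s;
     gA \<leftarrow> gradient_estimator \<gamma> \<kappa> M x \<xi> \<pi> s a;
     return_pmf
       (gradient (\<lambda>y. f y \<pi> \<xi>) x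
        + (1 / (\<kappa> * pmf \<nu> s) * gradient (\<lambda>p. f x p \<xi>) \<pi> $ (s, a)) *\<^sub>R gA) }"

text \<open>Each iteration draws a fresh context and then one policy from the oracle, which is used
  throughout that iteration. \<open>hpgd_iterate t\<close> is the law of the \<open>t\<close>-th iterate.\<close>

definition hpgd_step ::
  "'c measure \<Rightarrow> real \<Rightarrow> real \<Rightarrow> (real ^ 'd::finite \<Rightarrow> 'c \<Rightarrow> ('s::finite, 'a::finite) mdp) \<Rightarrow>
   (real ^ 'd \<Rightarrow> ('s, 'a) policy \<Rightarrow> 'c \<Rightarrow> real) \<Rightarrow> 's pmf \<Rightarrow> ('d, 'c, 's, 'a) oracle_kernel \<Rightarrow>
   real \<Rightarrow> real ^ 'd \<Rightarrow> (real ^ 'd) measure" where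
  "hpgd_step \<Xi> \<gamma> \<kappa> M f \<nu> orc \<alpha> x = do {
     \<xi> \<leftarrow> \<Xi>;
     \<pi> \<leftarrow> orc x \<xi>;
     distr (measure_pmf (hypergradient_estimator \<gamma> \<kappa> M f \<nu> x \<xi> \<pi>)) borel (\<lambda>g. x - \<alpha> *\<^sub>R g) }"

primrec hpgd_iterate ::
  "'c measure \<Rightarrow> real \<Rightarrow> real \<Rightarrow> (real ^ 'd::finite \<Rightarrow> 'c \<Rightarrow> ('s::finite, 'a::finite) mdp) \<Rightarrow>
   (real ^ 'd \<Rightarrow> ('s, 'a) policy \<Rightarrow> 'c \<Rightarrow> real) \<Rightarrow> 's pmf \<Rightarrow> ('d, 'c, 's, 'a) oracle_kernel \<Rightarrow>
   real ^ 'd \<Rightarrow> real \<Rightarrow> nat \<Rightarrow> (real ^ 'd) measure" where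
  "hpgd_iterate \<Xi> \<gamma> \<kappa> M f \<nu> orc x0 \<alpha> 0 = return borel x0"
| "hpgd_iterate \<Xi> \<gamma> \<kappa> M f \<nu> orc x0 \<alpha> (Suc t) =
     hpgd_iterate \<Xi> \<gamma> \<kappa> M f \<nu> orc x0 \<alpha> t \<bind> hpgd_step \<Xi> \<gamma> \<kappa> M f \<nu> orc \<alpha>"

text \<open>The output index is uniform on \<open>{..<T}\<close> and independent of the run, so the law of the output is
  the mixture of the laws of the first \<open>T\<close> iterates.\<close>

definition hpgd_output ::
  "'c measure \<Rightarrow> real \<Rightarrow> real \<Rightarrow> (real ^ 'd::finite \<Rightarrow> 'c \<Rightarrow> ('s::finite, 'a::finite) mdp) \<Rightarrow>
   (real ^ 'd \<Rightarrow> ('s, 'a) policy \<Rightarrow> 'c \<Rightarrow> real) \<Rightarrow> 's pmf \<Rightarrow> ('d, 'c, 's, 'a) oracle_kernel \<Rightarrow>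
   real ^ 'd \<Rightarrow> real \<Rightarrow> nat \<Rightarrow> (real ^ 'd) measure" where
  "hpgd_output \<Xi> \<gamma> \<kappa> M f \<nu> orc x0 \<alpha> T =
     measure_pmf (pmf_of_set {..<T}) \<bind> hpgd_iterate \<Xi> \<gamma> \<kappa> M f \<nu> orc x0 \<alpha>"

end

theory Submission
  imports Defs
begin

text \<open>
  The theorem is the analysis of stochastic gradient descent on a smooth nonconvex function \<open>F\<close> with an
  estimator of bounded second moment and small bias. The work lies in showing that \<open>F\<close> and the
  estimator have these properties with constants that are uniform in the context.

  \<open>F\<close> is smooth. By the Gibbs variational inequality the follower's policy is the softmax of the fixed
  point \<open>Q\<close> of the soft Bellman operator (\<open>follower_policy_eq_soft_policy\<close>). This operator is a
  contraction whose data have Lipschitz gradients in the decision, so \<open>Q y - Q x\<close> is linear in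
  \<open>y - x\<close> up to \<open>C * (norm (y - x))\<^sup>2\<close>, and the linear part \<open>grad_q\<close> solves the differentiated
  Bellman equation (\<open>soft_q_quadratic\<close>). Log-sum-exp, softmax and the loss have quadratic
  remainders that hold globally; hence they compose, and integration over the contexts preserves them
  (\<open>composed_loss_quadratic\<close>, \<open>F_quadratic\<close>). Such a remainder yields both that \<open>F\<close> is
  differentiable and the descent inequality.

  The estimator is unbiased at the follower's policy. Under a fixed policy, memorylessness of the two
  geometric horizons turns its expectation into a solution of the equation that defines \<open>grad_q\<close>: the
  outer horizon reaches step \<open>t\<close> with probability \<open>\<gamma> ^ t\<close>, and the inner one, which reaches step \<open>t\<close>
  with probability \<open>\<gamma> powr (t / 2)\<close>, supplies together with the explicit weight \<open>\<gamma> powr (t / 2)\<close> the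
  discounting of the value (\<open>return_gradient_mean\<close>). The weight \<open>1 / \<nu> s\<close> cancels the sampling of the
  state, so that the mean is the chain rule formula \<open>hypergradient\<close> (\<open>hypergradient_estimator_mean\<close>).
  The contribution of a sampled path grows at most linearly with its outer horizon, whose second
  moment is finite.

  The bias under the oracle's policy is at most a constant times the distance to the follower's policy
  (\<open>hypergradient_Lipschitz_at_follower\<close>). Among the ingredients only the entropy is not Lipschitz on
  the simplex; but one of the two policies compared is the follower's, whose entries stay above a
  positive constant. By the variance inequality the mean distance is at most \<open>\<delta>\<close>.

  Together these give, for constants \<open>b\<close> and \<open>c\<close>, that one iteration lowers the expectation of \<open>F\<close> by
  at least \<open>\<alpha>\<close> times the mean squared gradient norm, up to \<open>\<alpha> * b * \<delta> + \<alpha>\<^sup>2 * c\<close>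
  (\<open>hpgd_step_descent\<close>). Summation over the iterations and division by \<open>\<alpha> * T\<close> prove the bound. That
  the laws of the iterates are well defined rests on the measurability of functions that are continuous
  in one argument and measurable in the other (\<open>borel_measurable_Caratheodory\<close>).
\<close>

section \<open>Contractions on functions over a finite set\<close>

text \<open>Over a finite set the supremum is attained, so a bound of every value by an affine function
  of the supremum can be solved for the supremum. All bounds and all uniqueness statements for
  equations of Bellman type are instances, the latter with \<open>a = 0\<close>.\<close>

lemma sup_self_bound:
  fixes e :: "'z::finite \<Rightarrow> real"
  assumes "\<gamma> < 1" and step: "\<And>c z. (\<And>z'. e z' \<le> c) \<Longrightarrow> e z \<le> a + \<gamma> * c"
  shows "e z \<le> a / (1 - \<gamma>)"
proof -
  define c where "c = Max (range e)"
  have le: "e z' \<le> c" for z'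
    unfolding c_def by (intro Max_ge) auto
  have "c \<in> range e"
    unfolding c_def by (intro Max_in) auto
  then obtain z0 where "c = e z0"
    by auto
  with step[OF le, of z0] have "c \<le> a + \<gamma> * c"
    by simp
  with \<open>\<gamma> < 1\<close> have "c \<le> a / (1 - \<gamma>)"
    by (simp add: field_simps)
  with le[of z] show ?thesis
    by simp
qed

text \<open>Contraction in the supremum norm, expressed through arbitrary uniform bounds \<open>c\<close>. The iterates
  started at zero have increments dominated by a geometric series.\<close>

lemma contraction_fixpoint:
  fixes B :: "('z::finite \<Rightarrow> 'v::banach) \<Rightarrow> 'z \<Rightarrow> 'v"
  assumes "0 \<le> \<gamma>" "\<gamma> < 1"
    and contr: "\<And>g h c z. (\<And>z'. norm (g z' - h z') \<le> c) \<Longrightarrow> norm (B g z - B h z) \<le> \<gamma> * c"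
  shows "\<exists>g. \<forall>z. B g z = g z"
proof -
  define X where "X n = (B ^^ n) (\<lambda>_. 0)" for n
  have X_Suc: "X (Suc n) = B (X n)" for n
    by (simp add: X_def)
  define c where "c = Max (range (\<lambda>z. norm (X 1 z)))"
  have c: "norm (X 1 z) \<le> c" for z
    unfolding c_def by (intro Max_ge) auto
  have step: "norm (X (Suc n) z - X n z) \<le> \<gamma> ^ n * c" for n z
  proof (induction n arbitrary: z)
    case 0
    then show ?case using c by (simp add: X_def)
  next
    case (Suc n)
    have "norm (B (X (Suc n)) z - B (X n) z) \<le> \<gamma> * (\<gamma> ^ n * c)"
      by (rule contr) (rule Suc)
    then show ?case
      unfolding X_Suc[symmetric] by (simp add: mult_ac)
  qed
  have conv: "\<exists>l. (\<lambda>n. X n z) \<longlonglongrightarrow> l" for z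
  proof -
    have "summable (\<lambda>n. X (Suc n) z - X n z)"
    proof (rule summable_comparison_test')
      show "summable (\<lambda>n. \<gamma> ^ n * c)"
        using assms by (intro summable_mult2 summable_geometric) auto
      show "norm (X (Suc n) z - X n z) \<le> \<gamma> ^ n * c" for n
        by (rule step)
    qed
    then have "(\<lambda>n. \<Sum>k<n. X (Suc k) z - X k z) \<longlonglongrightarrow> (\<Sum>k. X (Suc k) z - X k z)"
      by (rule summable_LIMSEQ)
    moreover have "(\<Sum>k<n. X (Suc k) z - X k z) = X n z" for n
      by (subst sum_lessThan_telescope) (simp add: X_def)
    ultimately show ?thesis by auto
  qed
  then obtain l where l: "(\<lambda>n. X n z) \<longlonglongrightarrow> l z" for z
    by metis
  have "B l z = l z" for z
  proof -
    have *: "norm (X (Suc n) z - B l z) \<le> \<gamma> * (\<Sum>z'\<in>UNIV. norm (X n z' - l z'))" for n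
      unfolding X_Suc by (rule contr) (rule member_le_sum, auto)
    have "(\<lambda>n. \<gamma> * (\<Sum>z'\<in>UNIV. norm (X n z' - l z'))) \<longlonglongrightarrow> \<gamma> * (\<Sum>z'\<in>(UNIV::'z set). norm (l z' - l z'))"
      by (intro tendsto_intros l)
    then have "(\<lambda>n. X (Suc n) z - B l z) \<longlonglongrightarrow> 0"
      by (intro Lim_null_comparison[OF always_eventually[OF allI[OF *]]]) simp
    then have "(\<lambda>n. X (Suc n) z) \<longlonglongrightarrow> B l z"
      by (simp add: LIM_zero_iff)
    with LIMSEQ_Suc[OF l[of z]] show ?thesis
      using LIMSEQ_unique by blast
  qed
  then show ?thesis by blast
qed

section \<open>Gradients\<close>

lemma gradient_eqI:
  assumes "GDERIV g x :> D"
  shows "gradient g x = D"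
  unfolding gradient_def
proof (rule the_equality)
  show "GDERIV g x :> D" by (rule assms)
  fix D' assume "GDERIV g x :> D'"
  with assms have "(\<lambda>h. inner h D') = (\<lambda>h. inner h D)"
    unfolding gderiv_def by (rule has_derivative_unique[rotated])
  then have "inner (D' - D) D' = inner (D' - D) D"
    by (rule fun_cong)
  then have "inner (D' - D) (D' - D) = 0"
    by (simp add: inner_diff_right)
  then show "D' = D" by simp
qed

lemma GDERIV_gradient:
  fixes g :: "'v::euclidean_space \<Rightarrow> real"
  assumes "g differentiable (at x)"
  shows "GDERIV g x :> gradient g x"
proof -
  from assms obtain g' where g': "(g has_derivative g') (at x)"
    by (auto simp: differentiable_def)
  then interpret bounded_linear g'
    by (rule has_derivative_bounded_linear)
  have "g' = (\<lambda>h. inner h (\<Sum>b\<in>Basis. g' b *\<^sub>R b))"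
  proof
    fix h
    have "g' h = g' (\<Sum>b\<in>Basis. inner h b *\<^sub>R b)"
      by (simp add: euclidean_representation)
    also have "\<dots> = (\<Sum>b\<in>Basis. inner h b * g' b)"
      by (simp add: sum scaleR)
    finally show "g' h = inner h (\<Sum>b\<in>Basis. g' b *\<^sub>R b)"
      by (simp add: inner_sum_right mult.commute)
  qed
  with g' have "GDERIV g x :> (\<Sum>b\<in>Basis. g' b *\<^sub>R b)"
    by (simp add: gderiv_def)
  with gradient_eqI[OF this] show ?thesis
    by simp
qed

lemma GDERIV_continuous: "GDERIV g x :> D \<Longrightarrow> isCont g x"
  unfolding gderiv_def by (rule has_derivative_continuous)

text \<open>The mean value inequality for \<open>g\<close> minus its linearization at \<open>x\<close>.\<close>

lemma gradient_quadratic_remainder: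
  fixes g :: "'v::euclidean_space \<Rightarrow> real"
  assumes deriv: "\<And>z. z \<in> closed_segment x y \<Longrightarrow> GDERIV g z :> G z"
    and lip: "\<And>z. z \<in> closed_segment x y \<Longrightarrow> norm (G z - G x) \<le> C * norm (z - x)" and "0 \<le> C"
  shows "\<bar>g y - g x - inner (y - x) (G x)\<bar> \<le> C * (norm (y - x))\<^sup>2"
proof -
  have "norm (g y - g x - (\<lambda>h. inner h (G x)) (y - x)) \<le> norm (y - x) * (C * norm (y - x))"
  proof (rule differentiable_bound_linearization[where S = "closed_segment x y" and f' = "\<lambda>z h. inner h (G z)"])
    show "x + t *\<^sub>R (y - x) \<in> closed_segment x y" if "t \<in> {0..1}" for t :: real
      using that by (auto simp: closed_segment_def algebra_simps intro!: exI[of _ t])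
    show "(g has_derivative (\<lambda>h. inner h (G z))) (at z within closed_segment x y)"
      if "z \<in> closed_segment x y" for z
      using deriv[OF that] unfolding gderiv_def by (rule has_derivative_at_withinI)
    show "onorm ((\<lambda>h. inner h (G z)) - (\<lambda>h. inner h (G x))) \<le> C * norm (y - x)"
      if z: "z \<in> closed_segment x y" for z
    proof (rule onorm_le)
      fix h
      have "norm (inner h (G z - G x)) \<le> norm h * norm (G z - G x)"
        by (rule Cauchy_Schwarz_ineq2[unfolded real_norm_def[symmetric]])
      also have "\<dots> \<le> norm h * (C * norm (y - x))"
        using order_trans[OF lip[OF z] mult_left_mono[OF segment_bound(1)[OF z] \<open>0 \<le> C\<close>]]
        by (intro mult_left_mono) auto
      finally show "norm (((\<lambda>h. inner h (G z)) - (\<lambda>h. inner h (G x))) h) \<le> C * norm (y - x) * norm h"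
        by (simp add: inner_diff_right mult_ac)
    qed
  qed simp
  then show ?thesis
    by (simp add: power2_eq_square mult_ac)
qed

lemma gradient_bounded_imp_Lipschitz:
  fixes g :: "'v::euclidean_space \<Rightarrow> real"
  assumes deriv: "\<And>z. GDERIV g z :> G z" and bd: "\<And>z. norm (G z) \<le> B"
  shows "\<bar>g y - g x\<bar> \<le> B * norm (y - x)"
proof -
  have "norm (g y - g x) \<le> B * norm (y - x)"
  proof (rule differentiable_bound[where S = UNIV and f' = "\<lambda>z h. inner h (G z)"])
    show "(g has_derivative (\<lambda>h. inner h (G z))) (at z within UNIV)" for z
      using deriv[of z] unfolding gderiv_def by simp
    show "onorm (\<lambda>h. inner h (G z)) \<le> B" for z
    proof (rule onorm_le)
      fix h
      have "norm (inner h (G z)) \<le> norm h * norm (G z)"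
        by (rule Cauchy_Schwarz_ineq2[unfolded real_norm_def[symmetric]])
      also have "\<dots> \<le> norm h * B"
        using bd by (intro mult_left_mono) auto
      finally show "norm (inner h (G z)) \<le> B * norm h"
        by (simp add: mult_ac)
    qed
  qed auto
  then show ?thesis by simp
qed

lemma GDERIV_quotient_LIMSEQ:
  assumes "GDERIV g x :> D"
  shows "(\<lambda>n. real (Suc n) * (g (x + (1 / real (Suc n)) *\<^sub>R v) - g x)) \<longlonglongrightarrow> inner v D"
proof -
  have "((\<lambda>t. g (x + t *\<^sub>R v)) has_derivative (\<lambda>t. inner (t *\<^sub>R v) D)) (at 0)"
    using assms unfolding gderiv_def
    by (intro has_derivative_compose[where g = g and f = "\<lambda>t. x + t *\<^sub>R v"])
      (auto intro!: derivative_eq_intros)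
  then have "((\<lambda>t. g (x + t *\<^sub>R v)) has_real_derivative inner v D) (at 0)"
    by (simp add: has_field_derivative_def mult_commute_abs)
  then have "((\<lambda>h. (g (x + h *\<^sub>R v) - g x) / h) \<longlongrightarrow> inner v D) (at 0)"
    by (simp add: DERIV_def)
  moreover have "filterlim (\<lambda>n. 1 / real (Suc n)) (at 0) sequentially"
    unfolding filterlim_at using LIMSEQ_inverse_real_of_nat by (auto simp: divide_inverse)
  ultimately have "(\<lambda>n. (g (x + (1 / real (Suc n)) *\<^sub>R v) - g x) / (1 / real (Suc n))) \<longlonglongrightarrow> inner v D"
    by (rule filterlim_compose)
  then show ?thesis
    by (simp add: mult.commute)
qed

text \<open>Gronwall's argument: along the segment from \<open>x\<close> to \<open>y\<close> the function times
  \<open>exp (K * norm h * t)\<close> is nondecreasing.\<close>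

lemma positive_of_gradient_le:
  fixes P :: "'v::euclidean_space \<Rightarrow> real"
  assumes deriv: "\<And>z. GDERIV P z :> G z" and le: "\<And>z. norm (G z) \<le> K * P z" and "0 < P x"
  shows "0 < P y"
proof -
  define h where "h = y - x"
  define \<phi> where "\<phi> t = P (x + t *\<^sub>R h) * exp (K * norm h * t)" for t
  have dP: "((\<lambda>t. P (x + t *\<^sub>R h)) has_real_derivative inner h (G (x + t *\<^sub>R h))) (at t)" for t
  proof -
    have "((\<lambda>t. P (x + t *\<^sub>R h)) has_derivative (\<lambda>s. inner (s *\<^sub>R h) (G (x + t *\<^sub>R h)))) (at t)"
      using deriv[of "x + t *\<^sub>R h"] unfolding gderiv_def
      by (intro has_derivative_compose[where g = P and f = "\<lambda>t. x + t *\<^sub>R h"])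
        (auto intro!: derivative_eq_intros)
    then show ?thesis
      by (simp add: has_field_derivative_def mult_commute_abs)
  qed
  have "\<phi> 0 \<le> \<phi> 1"
  proof (rule DERIV_nonneg_imp_nondecreasing[where f = \<phi>])
    fix t :: real
    let ?z = "x + t *\<^sub>R h"
    have "(\<phi> has_real_derivative
        (inner h (G ?z) + K * norm h * P ?z) * exp (K * norm h * t)) (at t)"
      unfolding \<phi>_def by (auto intro!: derivative_eq_intros dP simp: algebra_simps)
    moreover have "\<bar>inner h (G ?z)\<bar> \<le> norm h * (K * P ?z)"
      by (rule order_trans[OF Cauchy_Schwarz_ineq2]) (intro mult_left_mono le norm_ge_zero)
    then have "0 \<le> (inner h (G ?z) + K * norm h * P ?z) * exp (K * norm h * t)"
      by (intro mult_nonneg_nonneg) (auto simp: mult_ac)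
    ultimately show "\<exists>d. (\<phi> has_real_derivative d) (at t) \<and> 0 \<le> d"
      by blast
  qed simp
  with \<open>0 < P x\<close> have "0 < \<phi> 1"
    by (simp add: \<phi>_def)
  then show ?thesis
    by (simp add: \<phi>_def h_def zero_less_mult_iff)
qed

section \<open>Integrals over composed distributions\<close>

text \<open>Total expectation for integrands that need not be bounded; the outputs of the estimator are unbounded
  because the length of its paths is.\<close>

lemma bind_pmf_integrable_nonneg:
  fixes h :: "'b \<Rightarrow> real"
  assumes int: "integrable (bind_pmf p q) h" and nn: "\<And>y. 0 \<le> h y"
  shows "x \<in> set_pmf p \<Longrightarrow> integrable (q x) h"
    and "integrable p (\<lambda>x. \<integral>y. h y \<partial>q x)"
    and "(\<integral>y. h y \<partial>bind_pmf p q) = (\<integral>x. (\<integral>y. h y \<partial>q x) \<partial>p)"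
proof -
  have eq: "(\<integral>\<^sup>+y. h y \<partial>bind_pmf p q) = (\<integral>\<^sup>+x. \<integral>\<^sup>+y. h y \<partial>q x \<partial>p)"
    by simp
  have fin: "(\<integral>\<^sup>+y. h y \<partial>bind_pmf p q) < \<infinity>"
    using int nn by (simp add: integrable_iff_bounded del: nn_integral_bind_pmf)
  have inner: "integrable (q x) h" if "x \<in> set_pmf p" for x
  proof -
    have "AE x in p. (\<integral>\<^sup>+y. h y \<partial>q x) \<noteq> \<infinity>"
      using fin unfolding eq by (intro nn_integral_PInf_AE) auto
    with that nn show ?thesis
      by (auto simp: AE_measure_pmf_iff integrable_iff_bounded top.not_eq_extremum)
  qed
  show "x \<in> set_pmf p \<Longrightarrow> integrable (q x) h"
    by (rule inner)
  have eq2: "(\<integral>\<^sup>+x. \<integral>\<^sup>+y. h y \<partial>q x \<partial>p) = (\<integral>\<^sup>+x. ennreal (\<integral>y. h y \<partial>q x) \<partial>p)"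
    using inner nn by (intro nn_integral_cong_AE) (auto simp: AE_measure_pmf_iff nn_integral_eq_integral)
  have nn2: "0 \<le> (\<integral>y. h y \<partial>q x)" for x
    using nn by (intro Bochner_Integration.integral_nonneg) auto
  show int2: "integrable p (\<lambda>x. \<integral>y. h y \<partial>q x)"
    using fin nn2 unfolding eq eq2 by (intro integrableI_nonneg) auto
  have "ennreal (\<integral>y. h y \<partial>bind_pmf p q) = ennreal (\<integral>x. (\<integral>y. h y \<partial>q x) \<partial>p)"
    using eq eq2 int int2 nn nn2 by (simp add: nn_integral_eq_integral del: nn_integral_bind_pmf)
  moreover have "0 \<le> (\<integral>y. h y \<partial>bind_pmf p q)" "0 \<le> (\<integral>x. (\<integral>y. h y \<partial>q x) \<partial>p)"
    using nn nn2 by (auto intro!: Bochner_Integration.integral_nonneg)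
  ultimately show "(\<integral>y. h y \<partial>bind_pmf p q) = (\<integral>x. (\<integral>y. h y \<partial>q x) \<partial>p)"
    by simp
qed

lemma bind_pmf_integrable:
  fixes h :: "'b \<Rightarrow> real"
  assumes int: "integrable (bind_pmf p q) h"
  shows "x \<in> set_pmf p \<Longrightarrow> integrable (q x) h"
    and "integrable p (\<lambda>x. \<integral>y. h y \<partial>q x)"
    and "(\<integral>y. h y \<partial>bind_pmf p q) = (\<integral>x. (\<integral>y. h y \<partial>q x) \<partial>p)"
proof -
  let ?p = "\<lambda>y. max 0 (h y)" and ?n = "\<lambda>y. max 0 (- h y)"
  have h: "h = (\<lambda>y. ?p y - ?n y)"
    by auto
  have p: "integrable (bind_pmf p q) ?p" and n: "integrable (bind_pmf p q) ?n"
    using int by auto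
  note P = bind_pmf_integrable_nonneg[OF p, simplified] and N = bind_pmf_integrable_nonneg[OF n, simplified]
  show inner: "integrable (q x) h" if "x \<in> set_pmf p" for x
    by (subst h) (intro Bochner_Integration.integrable_diff P(1) N(1) that)
  have split: "AE x in p. (\<integral>y. h y \<partial>q x) = (\<integral>y. ?p y \<partial>q x) - (\<integral>y. ?n y \<partial>q x)"
    unfolding AE_measure_pmf_iff
  proof
    fix x assume "x \<in> set_pmf p"
    then show "(\<integral>y. h y \<partial>q x) = (\<integral>y. ?p y \<partial>q x) - (\<integral>y. ?n y \<partial>q x)"
      by (subst (1) h) (intro Bochner_Integration.integral_diff P(1) N(1))
  qed
  have "integrable p (\<lambda>x. (\<integral>y. ?p y \<partial>q x) - (\<integral>y. ?n y \<partial>q x))"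
    by (intro Bochner_Integration.integrable_diff P(2) N(2))
  then show "integrable p (\<lambda>x. \<integral>y. h y \<partial>q x)"
    using split by (subst integrable_cong_AE) auto
  have "(\<integral>y. h y \<partial>bind_pmf p q) = (\<integral>y. ?p y \<partial>bind_pmf p q) - (\<integral>y. ?n y \<partial>bind_pmf p q)"
    by (subst (1) h) (intro Bochner_Integration.integral_diff p n)
  also have "\<dots> = (\<integral>x. (\<integral>y. ?p y \<partial>q x) - (\<integral>y. ?n y \<partial>q x) \<partial>p)"
    unfolding P(3) N(3) by (intro Bochner_Integration.integral_diff[symmetric] P(2) N(2))
  also have "\<dots> = (\<integral>x. (\<integral>y. h y \<partial>q x) \<partial>p)"
    using split by (intro integral_cong_AE) auto
  finally show "(\<integral>y. h y \<partial>bind_pmf p q) = (\<integral>x. (\<integral>y. h y \<partial>q x) \<partial>p)" .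
qed

text \<open>Memorylessness of the geometric law.\<close>

lemma geometric_pmf_integral_Suc:
  fixes h :: "nat \<Rightarrow> real"
  assumes p: "0 < p" "p \<le> 1" and int: "integrable (geometric_pmf p) h"
  shows "(\<integral>n. h n \<partial>geometric_pmf p) = p * h 0 + (1 - p) * (\<integral>n. h (Suc n) \<partial>geometric_pmf p)"
proof -
  have unfold: "geometric_pmf p =
      bernoulli_pmf p \<bind> (\<lambda>b. if b then return_pmf 0 else map_pmf Suc (geometric_pmf p))"
    using p by (intro geometric_bind_pmf_unfold) auto
  have "(\<integral>n. h n \<partial>geometric_pmf p) =
      (\<integral>b. (\<integral>n. h n \<partial>(if b then return_pmf 0 else map_pmf Suc (geometric_pmf p))) \<partial>bernoulli_pmf p)"
    using int by (subst (1) unfold, subst (asm) unfold) (rule bind_pmf_integrable(3))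
  also have "\<dots> = p * h 0 + (1 - p) * (\<integral>n. h (Suc n) \<partial>geometric_pmf p)"
    using p by (simp add: mult.commute)
  finally show ?thesis .
qed

section \<open>Joint measurability\<close>

text \<open>The function is the limit of functions that first round \<open>x\<close> to the first point within
  \<open>1 / (n + 1)\<close> in an enumeration of a countable dense subset of \<open>S\<close>; the rounded argument takes
  countably many values.\<close>

lemma borel_measurable_Caratheodory:
  fixes f :: "'b::euclidean_space \<Rightarrow> 'w \<Rightarrow> real"
  assumes cont: "\<And>w. w \<in> space N \<Longrightarrow> continuous_on S (\<lambda>x. f x w)"
    and meas: "\<And>x. x \<in> S \<Longrightarrow> f x \<in> borel_measurable N"
  shows "(\<lambda>(x, w). f x w) \<in> borel_measurable (restrict_space borel S \<Otimes>\<^sub>M N)"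
proof (cases "S = {}")
  case True
  then have "space (restrict_space borel S \<Otimes>\<^sub>M N) = {}"
    by (simp add: space_pair_measure space_restrict_space)
  then show ?thesis by (simp add: measurable_def)
next
  case False
  obtain T where T: "countable T" "T \<subseteq> S" "S \<subseteq> closure T"
    using separable by metis
  with False have "T \<noteq> {}" by auto
  define t where "t = from_nat_into T"
  have tS: "t k \<in> S" for k
    using from_nat_into[OF \<open>T \<noteq> {}\<close>] T(2) by (auto simp: t_def)
  define k where "k n x = (LEAST k. dist x (t k) < 1 / real (Suc n))" for n x
  have ex: "\<exists>k. dist x (t k) < 1 / real (Suc n)" if "x \<in> S" for x n
  proof -
    have "x \<in> closure T" using T that by auto
    then obtain y where "y \<in> T" "dist y x < 1 / real (Suc n)"
      unfolding closure_approachable by (meson of_nat_0_less_iff zero_less_Suc zero_less_divide_1_iff)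
    then show ?thesis
      using from_nat_into_surj[OF T(1)] by (metis dist_commute t_def)
  qed
  have near: "dist x (t (k n x)) < 1 / real (Suc n)" if "x \<in> S" for x n
    unfolding k_def by (rule LeastI_ex) (rule ex[OF that])
  have k_meas: "k n \<in> measurable (restrict_space borel S) (count_space UNIV)" for n
    unfolding k_def[abs_def]
  proof (rule measurable_Least)
    fix i
    have "Measurable.pred borel (\<lambda>x. dist x (t i) < 1 / real (Suc n))"
      by measurable
    then show "Measurable.pred (restrict_space borel S) (\<lambda>x. dist x (t i) < 1 / real (Suc n))"
      by (rule measurable_restrict_space1)
  qed
  show ?thesis
  proof (rule borel_measurable_LIMSEQ_real[where u = "\<lambda>n (x, w). f (t (k n x)) w"])
    show "(\<lambda>(x, w). f (t (k n x)) w) \<in> borel_measurable (restrict_space borel S \<Otimes>\<^sub>M N)" for n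
      unfolding split_beta'
    proof (rule measurable_compose_countable[where f = "\<lambda>i z. f (t i) (snd z)"])
      show "(\<lambda>z. f (t i) (snd z)) \<in> borel_measurable (restrict_space borel S \<Otimes>\<^sub>M N)" for i
        using meas[OF tS] by measurable
      show "(\<lambda>z. k n (fst z)) \<in> measurable (restrict_space borel S \<Otimes>\<^sub>M N) (count_space UNIV)"
        by (rule measurable_compose[OF measurable_fst k_meas])
    qed
    fix z assume "z \<in> space (restrict_space borel S \<Otimes>\<^sub>M N)"
    then obtain x w where z: "z = (x, w)" "x \<in> S" "w \<in> space N"
      by (auto simp: space_pair_measure space_restrict_space)
    have "(\<lambda>n. dist (t (k n x)) x) \<longlonglongrightarrow> 0"
    proof (rule Lim_null_comparison[OF always_eventually[OF allI] LIMSEQ_inverse_real_of_nat])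
      show "norm (dist (t (k n x)) x) \<le> inverse (real (Suc n))" for n
        using near[OF z(2), of n] by (simp add: dist_commute divide_inverse)
    qed
    then have "(\<lambda>n. t (k n x)) \<longlonglongrightarrow> x"
      by (rule tendsto_dist_iff[THEN iffD2])
    then have "(\<lambda>n. f (t (k n x)) w) \<longlonglongrightarrow> f x w"
      using cont[OF z(3)] tS z(2) by (auto intro: continuous_on_tendsto_compose)
    then show "(\<lambda>n. case z of (x, w) \<Rightarrow> f (t (k n x)) w) \<longlonglongrightarrow> (case z of (x, w) \<Rightarrow> f x w)"
      using z by simp
  qed
qed

section \<open>Values of policies\<close>

lemma expectation_finite_type:
  fixes h :: "'z::finite \<Rightarrow> 'v::{banach, second_countable_topology}"
  shows "measure_pmf.expectation p h = (\<Sum>z\<in>UNIV. pmf p z *\<^sub>R h z)"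
  by (rule integral_measure_pmf) auto

lemma sum_pmf_UNIV: "(\<Sum>z\<in>UNIV. pmf p (z::'z::finite)) = 1"
  by (rule sum_pmf_eq_1) auto

lemma norm_convex_combination_le:
  fixes h :: "'z \<Rightarrow> 'v::real_normed_vector"
  assumes "\<And>z. z \<in> A \<Longrightarrow> 0 \<le> w z" "sum w A = 1" and "\<And>z. z \<in> A \<Longrightarrow> norm (h z) \<le> c"
  shows "norm (\<Sum>z\<in>A. w z *\<^sub>R h z) \<le> c"
proof -
  have "norm (\<Sum>z\<in>A. w z *\<^sub>R h z) \<le> (\<Sum>z\<in>A. w z * c)"
    using assms by (intro sum_norm_le) (auto intro!: mult_left_mono)
  also have "\<dots> = c"
    using assms by (simp add: sum_distrib_right[symmetric])
  finally show ?thesis .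
qed

definition policy_avg :: "('s::finite, 'a::finite) policy \<Rightarrow> ('s \<times> 'a \<Rightarrow> 'v::real_vector) \<Rightarrow> 's \<Rightarrow> 'v" where
  "policy_avg \<pi> h s = (\<Sum>a\<in>UNIV. \<pi> $ (s, a) *\<^sub>R h (s, a))"

definition trans_avg :: "('s::finite, 'a) mdp \<Rightarrow> ('s \<Rightarrow> 'v::real_vector) \<Rightarrow> 's \<times> 'a \<Rightarrow> 'v" where
  "trans_avg m h z = (\<Sum>s'\<in>UNIV. pmf (trans m (fst z) (snd z)) s' *\<^sub>R h s')"

lemma norm_policy_avg_le:
  fixes h :: "'s::finite \<times> 'a::finite \<Rightarrow> 'v::real_normed_vector"
  assumes "is_policy \<pi>" "\<And>z. norm (h z) \<le> c"
  shows "norm (policy_avg \<pi> h s) \<le> c"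
  unfolding policy_avg_def
  using assms by (intro norm_convex_combination_le) (auto simp: is_policy_def)

lemma norm_trans_avg_le:
  fixes h :: "'s::finite \<Rightarrow> 'v::real_normed_vector"
  assumes "\<And>s. norm (h s) \<le> c"
  shows "norm (trans_avg m h z) \<le> c"
  unfolding trans_avg_def
  using assms by (intro norm_convex_combination_le) (auto simp: sum_pmf_UNIV)

lemma policy_avg_mono:
  fixes h g :: "'s::finite \<times> 'a::finite \<Rightarrow> real"
  assumes "is_policy \<pi>" "\<And>z. h z \<le> g z"
  shows "policy_avg \<pi> h s \<le> policy_avg \<pi> g s"
  unfolding policy_avg_def
  using assms by (intro sum_mono) (auto simp: is_policy_def intro!: mult_left_mono)

lemma trans_avg_mono:
  fixes h g :: "'s::finite \<Rightarrow> real"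
  assumes "\<And>z. h z \<le> g z"
  shows "trans_avg m h z \<le> trans_avg m g z"
  unfolding trans_avg_def
  using assms by (intro sum_mono) (auto intro!: mult_left_mono)

lemma policy_avg_const: "is_policy \<pi> \<Longrightarrow> policy_avg \<pi> (\<lambda>_. c) s = c"
  by (simp add: policy_avg_def scaleR_left.sum[symmetric] is_policy_def)

lemma policy_avg_state: "is_policy \<pi> \<Longrightarrow> policy_avg \<pi> (\<lambda>z. g (fst z)) s = g s"
  by (simp add: policy_avg_def scaleR_left.sum[symmetric] is_policy_def)

lemma trans_avg_const: "trans_avg m (\<lambda>_. c) z = c"
  by (simp add: trans_avg_def scaleR_left.sum[symmetric] sum_pmf_UNIV)

lemma policy_avg_add: "policy_avg \<pi> (\<lambda>z. h z + g z) s = policy_avg \<pi> h s + policy_avg \<pi> g s"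
  by (simp add: policy_avg_def scaleR_add_right sum.distrib)

lemma policy_avg_diff: "policy_avg \<pi> (\<lambda>z. h z - g z) s = policy_avg \<pi> h s - policy_avg \<pi> g s"
  by (simp add: policy_avg_def scaleR_diff_right sum_subtractf)

lemma policy_avg_scaleR: "policy_avg \<pi> (\<lambda>z. c *\<^sub>R h z) s = c *\<^sub>R policy_avg \<pi> h s"
  by (simp add: policy_avg_def scaleR_sum_right mult.commute)

lemma policy_avg_mult: "policy_avg \<pi> (\<lambda>z. c * h z :: real) s = c * policy_avg \<pi> h s"
  using policy_avg_scaleR[of \<pi> c h s] by simp

lemma trans_avg_add: "trans_avg m (\<lambda>s. h s + g s) z = trans_avg m h z + trans_avg m g z"
  by (simp add: trans_avg_def scaleR_add_right sum.distrib)

lemma trans_avg_diff: "trans_avg m (\<lambda>s. h s - g s) z = trans_avg m h z - trans_avg m g z"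
  by (simp add: trans_avg_def scaleR_diff_right sum_subtractf)

lemma pmf_action_pmf:
  assumes "is_policy \<pi>"
  shows "pmf (action_pmf \<pi> s) a = \<pi> $ (s, a)"
  unfolding action_pmf_def
proof (rule pmf_embed_pmf)
  show "0 \<le> \<pi> $ (s, a)" for a
    using assms by (auto simp: is_policy_def)
  have "(\<integral>\<^sup>+a. ennreal (\<pi> $ (s, a)) \<partial>count_space UNIV) = ennreal (\<Sum>a\<in>UNIV. \<pi> $ (s, a))"
    using assms by (simp add: nn_integral_count_space_finite is_policy_def sum_ennreal)
  then show "(\<integral>\<^sup>+a. ennreal (\<pi> $ (s, a)) \<partial>count_space UNIV) = 1"
    using assms by (simp add: is_policy_def)
qed

lemma expectation_start_pmf:
  fixes h :: "'s::finite \<times> 'a::finite \<Rightarrow> 'v::{banach, second_countable_topology}"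
  assumes "is_policy \<pi>"
  shows "measure_pmf.expectation (start_pmf \<pi> s) h = policy_avg \<pi> h s"
  unfolding start_pmf_def integral_map_pmf
  using assms by (simp add: policy_avg_def expectation_finite_type pmf_action_pmf)

lemma expectation_bind_finite_type:
  fixes h :: "'b::finite \<Rightarrow> 'v::{banach, second_countable_topology}" and p :: "'a::finite pmf"
  shows "measure_pmf.expectation (bind_pmf p f) h =
    measure_pmf.expectation p (\<lambda>x. measure_pmf.expectation (f x) h)"
  by (subst pmf_expectation_bind[of UNIV]) (simp_all add: expectation_finite_type)

lemma expectation_step_pmf:
  fixes h :: "'s::finite \<times> 'a::finite \<Rightarrow> 'v::{banach, second_countable_topology}"
  assumes "is_policy \<pi>"
  shows "measure_pmf.expectation (step_pmf m \<pi> z) h = trans_avg m (policy_avg \<pi> h) z"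
  using assms
  by (simp add: step_pmf_def expectation_bind_finite_type expectation_start_pmf)
     (simp add: trans_avg_def expectation_finite_type)

definition reg_reward :: "real \<Rightarrow> ('s::finite, 'a::finite) mdp \<Rightarrow> ('s, 'a) policy \<Rightarrow> 's \<times> 'a \<Rightarrow> real" where
  "reg_reward \<kappa> m \<pi> z = reward m (fst z) (snd z) + \<kappa> * policy_entropy \<pi> (fst z)"

subsection \<open>Marginal laws of the trajectory\<close>

definition state_action_law ::
  "('s::finite, 'a::finite) mdp \<Rightarrow> ('s, 'a) policy \<Rightarrow> ('s \<times> 'a) pmf \<Rightarrow> nat \<Rightarrow> ('s \<times> 'a) pmf" where
  "state_action_law m \<pi> p t = ((\<lambda>q. bind_pmf q (step_pmf m \<pi>)) ^^ t) p"

lemma state_action_law_0: "state_action_law m \<pi> p 0 = p"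
  by (simp add: state_action_law_def)

lemma state_action_law_Suc: "state_action_law m \<pi> p (Suc t) = bind_pmf (state_action_law m \<pi> p t) (step_pmf m \<pi>)"
  by (simp add: state_action_law_def)

lemma state_action_law_bind:
  "state_action_law m \<pi> (bind_pmf p f) t = bind_pmf p (\<lambda>x. state_action_law m \<pi> (f x) t)"
  by (induction t) (simp_all add: state_action_law_0 state_action_law_Suc bind_assoc_pmf)

text \<open>The Bellman equation splits off the first step, whereas the recursion for the laws splits off the
  last one.\<close>

lemma state_action_law_Suc_start:
  "state_action_law m \<pi> (start_pmf \<pi> s) (Suc t) =
     bind_pmf (start_pmf \<pi> s)
       (\<lambda>z. bind_pmf (trans m (fst z) (snd z)) (\<lambda>s'. state_action_law m \<pi> (start_pmf \<pi> s') t))"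
proof -
  have "state_action_law m \<pi> (start_pmf \<pi> s) (Suc t) =
      state_action_law m \<pi> (bind_pmf (start_pmf \<pi> s) (step_pmf m \<pi>)) t"
    by (simp only: state_action_law_def funpow_Suc_right comp_apply)
  also have "\<dots> = bind_pmf (start_pmf \<pi> s) (\<lambda>z. state_action_law m \<pi> (step_pmf m \<pi> z) t)"
    by (rule state_action_law_bind)
  finally show ?thesis
    by (simp add: step_pmf_def state_action_law_bind)
qed

text \<open>The value is a sum of functions of single coordinates, so of the trajectory measure only its
  one-dimensional marginals matter. They follow from the construction of its finite-dimensional
  marginals by successive kernels.\<close>

lemma nn_integral_trajectory_coordinate:
  fixes h :: "'s::finite \<times> 'a::finite \<Rightarrow> ennreal"
  shows "(\<integral>\<^sup>+\<omega>. h (\<omega> t) \<partial>trajectory_measure m \<pi> s) =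
    (\<integral>\<^sup>+z. h z \<partial>state_action_law m \<pi> (start_pmf \<pi> s) t)"
proof -
  interpret IT: Ionescu_Tulcea "trajectory_kernel m \<pi> s" "\<lambda>_. count_space UNIV"
    by (rule Ionescu_Tulcea_trajectory_kernel)
  let ?u = "\<lambda>_::nat. undefined :: 's \<times> 'a"
  have u: "?u \<in> space (PiM {0..<0} (\<lambda>_. count_space UNIV))"
    by (simp add: space_PiM)
  have coord: "(\<lambda>x. h (x t)) \<in> borel_measurable (PiM J (\<lambda>_. count_space UNIV))"
    if "t \<in> J" for J t and h :: "'s \<times> 'a \<Rightarrow> ennreal"
    by (rule measurable_compose[OF measurable_component_singleton[OF that]]) simp
  have bind: "(\<integral>\<^sup>+x. g (x k) \<partial>IT.C 0 (Suc k) ?u) =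
      (\<integral>\<^sup>+\<omega>. \<integral>\<^sup>+z. g z \<partial>trajectory_kernel m \<pi> s k \<omega> \<partial>IT.C 0 k ?u)" for k and g :: "'s \<times> 'a \<Rightarrow> ennreal"
  proof -
    have "(\<integral>\<^sup>+x. g (x k) \<partial>IT.C 0 (Suc k) ?u) = (\<integral>\<^sup>+\<omega>. \<integral>\<^sup>+x. g (x k) \<partial>IT.eP k \<omega> \<partial>IT.C 0 k ?u)"
      unfolding IT.C.simps
    proof (subst nn_integral_bind[where B = "PiM {0..<Suc k} (\<lambda>_. count_space UNIV)"])
      show "(\<lambda>x. g (x k)) \<in> borel_measurable (PiM {0..<Suc k} (\<lambda>_. count_space UNIV))"
        by (rule coord) simp
      show "IT.eP (0 + k) \<in> measurable (IT.C 0 k ?u) (subprob_algebra (PiM {0..<Suc k} (\<lambda>_. count_space UNIV)))"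
        unfolding measurable_cong_sets[OF IT.sets_C[OF u, of k] refl] using IT.measurable_eP[of k] by simp
    qed simp
    also have "\<dots> = (\<integral>\<^sup>+\<omega>. \<integral>\<^sup>+z. g z \<partial>trajectory_kernel m \<pi> s k \<omega> \<partial>IT.C 0 k ?u)"
    proof (rule nn_integral_cong)
      fix \<omega> assume "\<omega> \<in> space (IT.C 0 k ?u)"
      then have "\<omega> \<in> space (PiM {0..<k} (\<lambda>_. count_space UNIV))"
        using IT.space_C[OF u, of k] by simp
      then show "(\<integral>\<^sup>+x. g (x k) \<partial>IT.eP k \<omega>) = (\<integral>\<^sup>+z. g z \<partial>trajectory_kernel m \<pi> s k \<omega>)"
        by (subst IT.nn_integral_eP) (auto intro!: coord)
    qed
    finally show ?thesis .
  qed
  have C: "(\<integral>\<^sup>+x. h (x t) \<partial>IT.C 0 (Suc t) ?u) = (\<integral>\<^sup>+z. h z \<partial>state_action_law m \<pi> (start_pmf \<pi> s) t)"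
    for t and h :: "'s \<times> 'a \<Rightarrow> ennreal"
  proof (induction t arbitrary: h)
    case 0
    have "(\<integral>\<^sup>+x. h (x 0) \<partial>IT.C 0 (Suc 0) ?u) =
        (\<integral>\<^sup>+\<omega>. \<integral>\<^sup>+z. h z \<partial>start_pmf \<pi> s \<partial>return (PiM {0..<0} (\<lambda>_. count_space UNIV)) ?u)"
      unfolding bind by (simp add: trajectory_kernel_def)
    also have "\<dots> = (\<integral>\<^sup>+z. h z \<partial>start_pmf \<pi> s)"
      by (rule nn_integral_return[OF u]) simp
    finally show ?case
      by (simp add: state_action_law_0)
  next
    case (Suc t)
    have kernel: "trajectory_kernel m \<pi> s (Suc t) \<omega> = measure_pmf (step_pmf m \<pi> (\<omega> t))" for \<omega>
      by (simp add: trajectory_kernel_def)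
    show ?case
      unfolding bind[of "Suc t"] kernel Suc[of "\<lambda>z. \<integral>\<^sup>+z'. h z' \<partial>step_pmf m \<pi> z"]
      by (simp add: state_action_law_Suc)
  qed
  have lim_meas: "measurable (trajectory_measure m \<pi> s) N = measurable (PiM UNIV (\<lambda>_. count_space UNIV)) N"
    for N :: "'x measure"
    unfolding trajectory_measure_def by (rule measurable_cong_sets[OF IT.PF.sets_lim refl])
  have "(\<integral>\<^sup>+\<omega>. h (\<omega> t) \<partial>trajectory_measure m \<pi> s) =
      (\<integral>\<^sup>+x. h (x t) \<partial>distr (trajectory_measure m \<pi> s) (PiM {t} (\<lambda>_. count_space UNIV)) (\<lambda>x. restrict x {t}))"
    by (subst nn_integral_distr)
       (auto simp: lim_meas intro!: coord measurable_restrict measurable_component_singleton)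
  also have "\<dots> = (\<integral>\<^sup>+x. h (x t) \<partial>IT.CI {t})"
    using IT.distr_lim[of "{t}"] by (simp add: trajectory_measure_def)
  also have "\<dots> = (\<integral>\<^sup>+x. h (x t) \<partial>IT.C 0 (IT.up_to {t}) ?u)"
  proof -
    have "(\<lambda>f. restrict f {t}) \<in> measurable (IT.C 0 (IT.up_to {t}) ?u) (PiM {t} (\<lambda>_. count_space UNIV))"
      unfolding measurable_cong_sets[OF IT.sets_C[OF u] refl]
      using IT.up_to[of "{t}"] by (intro measurable_restrict measurable_component_singleton) auto
    then show ?thesis
      unfolding IT.CI_def by (subst nn_integral_distr) (auto intro!: coord)
  qed
  also have "IT.up_to {t} = Suc t"
    unfolding IT.up_to_def by (rule Least_equality) (auto simp: Suc_le_eq not_le[symmetric])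
  finally show ?thesis
    by (simp only: C)
qed

lemma prob_space_trajectory_measure: "prob_space (trajectory_measure m \<pi> s)"
proof
  have "emeasure (trajectory_measure m \<pi> s) (space (trajectory_measure m \<pi> s)) =
      (\<integral>\<^sup>+\<omega>. (\<lambda>_. 1) (\<omega> 0) \<partial>trajectory_measure m \<pi> s)"
    by simp
  also have "\<dots> = 1"
    by (subst nn_integral_trajectory_coordinate) simp
  finally show "emeasure (trajectory_measure m \<pi> s) (space (trajectory_measure m \<pi> s)) = 1" .
qed

lemma measurable_trajectory_coordinate:
  "(\<lambda>\<omega>. \<omega> t) \<in> measurable (trajectory_measure m \<pi> s) (count_space UNIV)"
proof -
  interpret IT: Ionescu_Tulcea "trajectory_kernel m \<pi> s" "\<lambda>_. count_space UNIV"
    by (rule Ionescu_Tulcea_trajectory_kernel)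
  show ?thesis
    unfolding trajectory_measure_def measurable_cong_sets[OF IT.PF.sets_lim refl]
    by (rule measurable_component_singleton) simp
qed

lemma distr_trajectory_coordinate:
  "distr (trajectory_measure m \<pi> s) (count_space UNIV) (\<lambda>\<omega>. \<omega> t) =
     measure_pmf (state_action_law m \<pi> (start_pmf \<pi> s) t)"
proof (rule measure_eqI)
  fix A
  have "emeasure (distr (trajectory_measure m \<pi> s) (count_space UNIV) (\<lambda>\<omega>. \<omega> t)) A =
      (\<integral>\<^sup>+z. indicator A z \<partial>distr (trajectory_measure m \<pi> s) (count_space UNIV) (\<lambda>\<omega>. \<omega> t))"
    by simp
  also have "\<dots> = (\<integral>\<^sup>+\<omega>. indicator A (\<omega> t) \<partial>trajectory_measure m \<pi> s)"
    by (subst nn_integral_distr[OF measurable_trajectory_coordinate]) simp_all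
  also have "\<dots> = emeasure (state_action_law m \<pi> (start_pmf \<pi> s) t) A"
    by (subst nn_integral_trajectory_coordinate) simp
  finally show "emeasure (distr (trajectory_measure m \<pi> s) (count_space UNIV) (\<lambda>\<omega>. \<omega> t)) A =
      emeasure (state_action_law m \<pi> (start_pmf \<pi> s) t) A" .
qed simp

lemma integral_trajectory_coordinate:
  fixes h :: "'s::finite \<times> 'a::finite \<Rightarrow> real"
  shows "(\<integral>\<omega>. h (\<omega> t) \<partial>trajectory_measure m \<pi> s) =
    measure_pmf.expectation (state_action_law m \<pi> (start_pmf \<pi> s) t) h"
  unfolding distr_trajectory_coordinate[symmetric]
  by (subst integral_distr[OF measurable_trajectory_coordinate]) simp_all

text \<open>Rewards are bounded on the finite set of state-action pairs, which allows termwise integration.\<close>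

lemma value_fn_series:
  fixes m :: "('s::finite, 'a::finite) mdp"
  assumes "0 \<le> \<gamma>" "\<gamma> < 1"
  shows "(\<lambda>t. \<gamma> ^ t * measure_pmf.expectation (state_action_law m \<pi> (start_pmf \<pi> s) t) (reg_reward \<kappa> m \<pi>))
    sums value_fn \<gamma> \<kappa> m \<pi> s"
proof -
  let ?h = "reg_reward \<kappa> m \<pi>" and ?M = "trajectory_measure m \<pi> s"
  interpret prob_space ?M by (rule prob_space_trajectory_measure)
  define b where "b = Max (range (\<lambda>z. \<bar>?h z\<bar>))"
  have b: "\<bar>?h z\<bar> \<le> b" for z
    unfolding b_def by (intro Max_ge) auto
  have meas: "(\<lambda>\<omega>. ?h (\<omega> t)) \<in> borel_measurable ?M" for t
    by (rule measurable_compose[OF measurable_trajectory_coordinate]) simp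
  have summ: "summable (\<lambda>t. \<gamma> ^ t * b)"
    using assms by (intro summable_mult2 summable_geometric) auto
  have bt: "\<bar>\<gamma> ^ t * ?h z\<bar> \<le> \<gamma> ^ t * b" for t z
    using assms b by (simp add: abs_mult mult_left_mono)
  have int: "integrable ?M (\<lambda>\<omega>. \<gamma> ^ t * ?h (\<omega> t))" for t
    using bt by (intro integrable_const_bound[where B = "\<gamma> ^ t * b"] borel_measurable_times meas) auto
  have "(\<lambda>t. \<integral>\<omega>. \<gamma> ^ t * ?h (\<omega> t) \<partial>?M) sums (\<integral>\<omega>. (\<Sum>t. \<gamma> ^ t * ?h (\<omega> t)) \<partial>?M)"
  proof (rule sums_integral[OF int])
    show "AE \<omega> in ?M. summable (\<lambda>t. norm (\<gamma> ^ t * ?h (\<omega> t)))"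
      using bt by (intro AE_I2 summable_comparison_test'[OF summ]) auto
    show "summable (\<lambda>t. \<integral>\<omega>. norm (\<gamma> ^ t * ?h (\<omega> t)) \<partial>?M)"
    proof (rule summable_comparison_test'[OF summ])
      show "norm (\<integral>\<omega>. norm (\<gamma> ^ t * ?h (\<omega> t)) \<partial>?M) \<le> \<gamma> ^ t * b" for t
        using bt int[of t] by (simp add: integral_le_const)
    qed
  qed
  then show ?thesis
    by (simp add: integral_trajectory_coordinate[where h = "reg_reward \<kappa> m \<pi>", symmetric])
       (simp add: value_fn_def reg_reward_def)
qed

lemma value_fn_Bellman:
  fixes m :: "('s::finite, 'a::finite) mdp"
  assumes \<gamma>: "0 \<le> \<gamma>" "\<gamma> < 1" and \<pi>: "is_policy \<pi>"
  shows "value_fn \<gamma> \<kappa> m \<pi> s =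
    policy_avg \<pi> (\<lambda>z. reg_reward \<kappa> m \<pi> z + \<gamma> * trans_avg m (value_fn \<gamma> \<kappa> m \<pi>) z) s"
proof -
  let ?E = "\<lambda>s t. measure_pmf.expectation (state_action_law m \<pi> (start_pmf \<pi> s) t) (reg_reward \<kappa> m \<pi>)"
  let ?V = "value_fn \<gamma> \<kappa> m \<pi>"
  have sums: "(\<lambda>t. \<gamma> ^ t * ?E s t) sums ?V s" for s
    by (rule value_fn_series[OF \<gamma>])
  have E0: "?E s 0 = policy_avg \<pi> (reg_reward \<kappa> m \<pi>) s"
    by (simp add: state_action_law_0 expectation_start_pmf[OF \<pi>])
  have ESuc: "?E s (Suc t) = policy_avg \<pi> (trans_avg m (\<lambda>s'. ?E s' t)) s" for t
    unfolding state_action_law_Suc_start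
    unfolding expectation_bind_finite_type expectation_start_pmf[OF \<pi>]
    by (simp add: policy_avg_def trans_avg_def expectation_finite_type[of "trans m _ _"])
  have "(\<lambda>t. \<gamma> ^ Suc t * ?E s (Suc t)) sums (?V s - ?E s 0)"
    using sums[of s] by (subst sums_Suc_iff) simp
  moreover have "(\<lambda>t. \<gamma> ^ Suc t * ?E s (Suc t)) sums (\<gamma> * policy_avg \<pi> (trans_avg m ?V) s)"
  proof -
    have "(\<lambda>t. \<gamma> * (\<Sum>a\<in>UNIV. \<pi> $ (s, a) * (\<Sum>s'\<in>UNIV. pmf (trans m s a) s' * (\<gamma> ^ t * ?E s' t))))
        sums (\<gamma> * (\<Sum>a\<in>UNIV. \<pi> $ (s, a) * (\<Sum>s'\<in>UNIV. pmf (trans m s a) s' * ?V s')))"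
      by (intro sums_mult sums_sum sums)
    then show ?thesis
      by (simp add: ESuc policy_avg_def trans_avg_def sum_distrib_left mult_ac)
  qed
  ultimately have "?V s - ?E s 0 = \<gamma> * policy_avg \<pi> (trans_avg m ?V) s"
    by (rule sums_unique2)
  then show ?thesis
    by (simp add: E0 policy_avg_add policy_avg_mult)
qed

section \<open>Log-sum-exp and softmax\<close>

definition log_sum_exp :: "real \<Rightarrow> ('a::finite \<Rightarrow> real) \<Rightarrow> real" where
  "log_sum_exp \<kappa> q = \<kappa> * ln (\<Sum>a\<in>UNIV. exp (q a / \<kappa>))"

definition softmax :: "real \<Rightarrow> ('a::finite \<Rightarrow> real) \<Rightarrow> 'a \<Rightarrow> real" where
  "softmax \<kappa> q a = exp (q a / \<kappa>) / (\<Sum>b\<in>UNIV. exp (q b / \<kappa>))"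

lemma sum_exp_pos: "0 < (\<Sum>a\<in>UNIV. exp (q (a::'a::finite)) :: real)"
  by (intro sum_pos) auto

lemma softmax_pos: "0 < softmax \<kappa> q a"
  unfolding softmax_def by (intro divide_pos_pos sum_exp_pos) simp

lemma sum_softmax: "(\<Sum>a\<in>UNIV. softmax \<kappa> q a) = 1"
  unfolding softmax_def sum_divide_distrib[symmetric] using sum_exp_pos[of "\<lambda>a. q a / \<kappa>"] by simp

lemma softmax_le_1: "softmax \<kappa> q a \<le> 1"
  using member_le_sum[of a UNIV "softmax \<kappa> q"] softmax_pos[of \<kappa> q] by (simp add: sum_softmax less_imp_le)

lemma ln_softmax: "0 < \<kappa> \<Longrightarrow> \<kappa> * ln (softmax \<kappa> q a) = q a - log_sum_exp \<kappa> q"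
  using sum_exp_pos[of "\<lambda>a. q a / \<kappa>"]
  by (simp add: softmax_def log_sum_exp_def ln_div algebra_simps)

text \<open>Nonnegativity of the relative entropy of \<open>p\<close> with respect to the softmax, from
  \<open>ln t \<le> t - 1\<close>.\<close>

lemma Gibbs_variational:
  assumes "0 < \<kappa>" "\<And>a. 0 \<le> p a" "(\<Sum>a\<in>UNIV. p a) = 1"
  shows "(\<Sum>a\<in>UNIV. p a * q a) - \<kappa> * (\<Sum>a\<in>UNIV. p a * ln (p a)) \<le> log_sum_exp \<kappa> q"
proof -
  have "p a * (ln (softmax \<kappa> q a) - ln (p a)) \<le> softmax \<kappa> q a - p a" for a
  proof (cases "p a = 0")
    case True
    then show ?thesis using softmax_pos[of \<kappa> q a] by simp
  next
    case False
    with assms have "0 < p a" by (simp add: less_le)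
    then have "ln (softmax \<kappa> q a / p a) \<le> softmax \<kappa> q a / p a - 1"
      by (intro ln_le_minus_one divide_pos_pos softmax_pos)
    then have "p a * ln (softmax \<kappa> q a / p a) \<le> p a * (softmax \<kappa> q a / p a - 1)"
      using \<open>0 < p a\<close> by (intro mult_left_mono) auto
    also have "\<dots> = softmax \<kappa> q a - p a"
      using \<open>0 < p a\<close> by (simp add: field_simps)
    finally show ?thesis
      using \<open>0 < p a\<close> softmax_pos[of \<kappa> q a] by (simp add: ln_div)
  qed
  then have "(\<Sum>a\<in>UNIV. p a * (ln (softmax \<kappa> q a) - ln (p a))) \<le> (\<Sum>a\<in>UNIV. softmax \<kappa> q a - p a)"
    by (rule sum_mono)
  also have "\<dots> = 0"
    using assms by (simp add: sum_subtractf sum_softmax)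
  finally have "\<kappa> * (\<Sum>a\<in>UNIV. p a * (ln (softmax \<kappa> q a) - ln (p a))) \<le> 0"
    using \<open>0 < \<kappa>\<close> by (simp add: mult_le_0_iff)
  moreover have "\<kappa> * (\<Sum>a\<in>UNIV. p a * (ln (softmax \<kappa> q a) - ln (p a))) =
      (\<Sum>a\<in>UNIV. p a * (\<kappa> * ln (softmax \<kappa> q a))) - \<kappa> * (\<Sum>a\<in>UNIV. p a * ln (p a))"
    by (simp add: sum_distrib_left sum_subtractf algebra_simps)
  moreover have "(\<Sum>a\<in>UNIV. p a * (\<kappa> * ln (softmax \<kappa> q a))) = (\<Sum>a\<in>UNIV. p a * q a) - log_sum_exp \<kappa> q"
    using assms
    by (simp add: ln_softmax right_diff_distrib sum_subtractf sum_distrib_right[symmetric])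
  ultimately show ?thesis by linarith
qed

lemma Gibbs_softmax:
  assumes "0 < \<kappa>"
  shows "(\<Sum>a\<in>UNIV. softmax \<kappa> q a * q a) - \<kappa> * (\<Sum>a\<in>UNIV. softmax \<kappa> q a * ln (softmax \<kappa> q a))
    = log_sum_exp \<kappa> q"
proof -
  have "\<kappa> * (\<Sum>a\<in>UNIV. softmax \<kappa> q a * ln (softmax \<kappa> q a)) =
      (\<Sum>a\<in>UNIV. softmax \<kappa> q a * (\<kappa> * ln (softmax \<kappa> q a)))"
    by (simp add: sum_distrib_left mult_ac)
  also have "\<dots> = (\<Sum>a\<in>UNIV. softmax \<kappa> q a * q a) - log_sum_exp \<kappa> q"
    using assms
    by (simp add: ln_softmax right_diff_distrib sum_subtractf sum_distrib_right[symmetric] sum_softmax)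
  finally show ?thesis by simp
qed

text \<open>Convexity of log-sum-exp: the variational inequality with \<open>p\<close> the softmax of \<open>q\<close>.\<close>

lemma log_sum_exp_tangent:
  assumes "0 < \<kappa>"
  shows "log_sum_exp \<kappa> q + (\<Sum>a\<in>UNIV. softmax \<kappa> q a * (q' a - q a)) \<le> log_sum_exp \<kappa> q'"
  using Gibbs_variational[OF assms less_imp_le[OF softmax_pos] sum_softmax, of \<kappa> q q']
    Gibbs_softmax[OF assms, of q]
  by (simp add: right_diff_distrib sum_subtractf)

lemma log_sum_exp_le_shift:
  assumes "0 < \<kappa>" "\<forall>a. q a \<le> q' a + c"
  shows "log_sum_exp \<kappa> q \<le> log_sum_exp \<kappa> q' + c"
proof -
  have "(\<Sum>a\<in>UNIV. softmax \<kappa> q a * (q a - q' a)) \<le> (\<Sum>a\<in>UNIV. softmax \<kappa> q a * c)"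
  proof (rule sum_mono)
    fix a show "softmax \<kappa> q a * (q a - q' a) \<le> softmax \<kappa> q a * c"
      using assms(2)[rule_format, of a] softmax_pos[of \<kappa> q a] by (intro mult_left_mono) auto
  qed
  also have "\<dots> = c"
    by (simp add: sum_distrib_right[symmetric] sum_softmax)
  finally have "(\<Sum>a\<in>UNIV. softmax \<kappa> q a * (q a - q' a)) \<le> c" .
  moreover have "(\<Sum>a\<in>UNIV. softmax \<kappa> q a * (q' a - q a)) = - (\<Sum>a\<in>UNIV. softmax \<kappa> q a * (q a - q' a))"
    by (simp add: sum_negf[symmetric] algebra_simps)
  ultimately show ?thesis
    using log_sum_exp_tangent[OF assms(1), of q q'] by linarith
qed

lemma log_sum_exp_nonexpansive:
  assumes "0 < \<kappa>" "\<forall>a. \<bar>q' a - q a\<bar> \<le> c"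
  shows "\<bar>log_sum_exp \<kappa> q' - log_sum_exp \<kappa> q\<bar> \<le> c"
proof -
  have "\<forall>a. q a \<le> q' a + c" "\<forall>a. q' a \<le> q a + c"
    using assms(2) by (auto simp: abs_le_iff algebra_simps)
  from log_sum_exp_le_shift[OF assms(1) this(1)] log_sum_exp_le_shift[OF assms(1) this(2)]
  show ?thesis by simp
qed

lemma log_sum_exp_bound:
  fixes q :: "'a::finite \<Rightarrow> real"
  assumes "0 < \<kappa>" "\<forall>a. \<bar>q a\<bar> \<le> c"
  shows "\<bar>log_sum_exp \<kappa> q\<bar> \<le> c + \<kappa> * ln (real CARD('a))"
proof -
  have "\<bar>log_sum_exp \<kappa> q - log_sum_exp \<kappa> (\<lambda>_::'a. 0)\<bar> \<le> c"
    using assms by (intro log_sum_exp_nonexpansive) auto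
  moreover have "log_sum_exp \<kappa> (\<lambda>_::'a. 0) = \<kappa> * ln (real CARD('a))"
    by (simp add: log_sum_exp_def)
  moreover have "0 \<le> \<kappa> * ln (real CARD('a))"
    using assms(1) by (intro mult_nonneg_nonneg) (auto simp: Suc_le_eq)
  ultimately show ?thesis by linarith
qed

lemma softmax_ge:
  fixes q :: "'a::finite \<Rightarrow> real"
  assumes "0 < \<kappa>" "\<forall>a. \<bar>q a\<bar> \<le> c"
  shows "exp (- (2 * c + \<kappa> * ln (real CARD('a))) / \<kappa>) \<le> softmax \<kappa> q a"
proof -
  have "- (2 * c + \<kappa> * ln (real CARD('a))) \<le> \<kappa> * ln (softmax \<kappa> q a)"
    using log_sum_exp_bound[OF assms] assms(2)[rule_format, of a] unfolding ln_softmax[OF assms(1)] by linarith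
  then have "- (2 * c + \<kappa> * ln (real CARD('a))) / \<kappa> \<le> ln (softmax \<kappa> q a)"
    using assms(1) by (simp add: field_simps)
  then show ?thesis
    using softmax_pos[of \<kappa> q a] by (metis exp_le_cancel_iff exp_ln)
qed

text \<open>The number \<open>w a\<close> is the logarithm of the ratio of the two softmax weights. Applying \<open>ln t \<le> t - 1\<close>
  to the ratio and to its inverse encloses the difference of the weights without any smallness
  condition on \<open>d\<close>, which makes the quadratic remainders below global.\<close>

lemma softmax_ratio_bounds:
  assumes "0 < \<kappa>" "\<forall>a. \<bar>q' a - q a\<bar> \<le> d"
  defines "w \<equiv> \<lambda>a. ((q' a - q a) - (log_sum_exp \<kappa> q' - log_sum_exp \<kappa> q)) / \<kappa>"
  shows "\<bar>w a\<bar> \<le> 2 * d / \<kappa>"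
    and "softmax \<kappa> q a * w a \<le> softmax \<kappa> q' a - softmax \<kappa> q a"
    and "softmax \<kappa> q' a - softmax \<kappa> q a \<le> softmax \<kappa> q' a * w a"
proof -
  have "\<bar>(q' a - q a) - (log_sum_exp \<kappa> q' - log_sum_exp \<kappa> q)\<bar> \<le> 2 * d"
    using assms(2)[rule_format, of a] log_sum_exp_nonexpansive[OF assms(1,2)] by linarith
  then show "\<bar>w a\<bar> \<le> 2 * d / \<kappa>"
    using assms(1) by (simp add: w_def divide_right_mono)
  have "\<kappa> * w a = \<kappa> * (ln (softmax \<kappa> q' a) - ln (softmax \<kappa> q a))"
    unfolding right_diff_distrib[of \<kappa> "ln (softmax \<kappa> q' a)"] ln_softmax[OF assms(1)]
    using assms(1) by (simp add: w_def)
  with assms(1) have w: "w a = ln (softmax \<kappa> q' a) - ln (softmax \<kappa> q a)"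
    by simp
  let ?s = "softmax \<kappa> q a" and ?s' = "softmax \<kappa> q' a"
  note pos = softmax_pos[of \<kappa> q a] softmax_pos[of \<kappa> q' a]
  have "ln (?s' / ?s) \<le> ?s' / ?s - 1" "ln (?s / ?s') \<le> ?s / ?s' - 1"
    using pos by (intro ln_le_minus_one divide_pos_pos; simp)+
  then have le: "w a \<le> ?s' / ?s - 1" "- w a \<le> ?s / ?s' - 1"
    using pos by (simp_all add: w ln_div)
  show "?s * w a \<le> ?s' - ?s"
    using mult_left_mono[OF le(1), of ?s] pos by (simp add: right_diff_distrib)
  show "?s' - ?s \<le> ?s' * w a"
    using mult_left_mono[OF le(2), of ?s'] pos by (simp add: right_diff_distrib)
qed

lemma softmax_Lipschitz:
  assumes "0 < \<kappa>" "\<forall>a. \<bar>q' a - q a\<bar> \<le> d"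
  shows "\<bar>softmax \<kappa> q' a - softmax \<kappa> q a\<bar> \<le> (softmax \<kappa> q a + softmax \<kappa> q' a) * (2 * d / \<kappa>)"
proof -
  define w where "w = ((q' a - q a) - (log_sum_exp \<kappa> q' - log_sum_exp \<kappa> q)) / \<kappa>"
  note b = softmax_ratio_bounds[OF assms, of a, folded w_def]
  note pos = softmax_pos[of \<kappa> q a] softmax_pos[of \<kappa> q' a]
  have "\<bar>softmax \<kappa> q a * w\<bar> \<le> softmax \<kappa> q a * (2 * d / \<kappa>)" "\<bar>softmax \<kappa> q' a * w\<bar> \<le> softmax \<kappa> q' a * (2 * d / \<kappa>)"
    using b(1) pos by (simp_all only: abs_mult abs_of_pos) (intro mult_left_mono; simp)+
  with b(2,3) show ?thesis
    unfolding distrib_right by (smt (verit) abs_ge_zero pos mult_nonneg_nonneg b(1))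
qed

text \<open>The tangent inequality at \<open>q\<close> bounds the remainder from below, the one at \<open>q'\<close> from above, the latter
  with an error that the Lipschitz bound for softmax controls.\<close>

lemma log_sum_exp_quadratic:
  fixes q :: "'a::finite \<Rightarrow> real"
  assumes "0 < \<kappa>" "\<forall>a. \<bar>q' a - q a\<bar> \<le> d"
  shows "\<bar>log_sum_exp \<kappa> q' - log_sum_exp \<kappa> q - (\<Sum>a\<in>UNIV. softmax \<kappa> q a * (q' a - q a))\<bar> \<le> 4 / \<kappa> * d\<^sup>2"
proof -
  have d: "0 \<le> d" using assms(2)[rule_format, of undefined] by linarith
  have rev: "log_sum_exp \<kappa> q' + (\<Sum>a\<in>UNIV. softmax \<kappa> q' a * (q a - q' a)) \<le> log_sum_exp \<kappa> q"
    by (rule log_sum_exp_tangent[OF assms(1)])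
  have "(\<Sum>a\<in>UNIV. softmax \<kappa> q' a * (q' a - q a)) - (\<Sum>a\<in>UNIV. softmax \<kappa> q a * (q' a - q a))
      = (\<Sum>a\<in>UNIV. (softmax \<kappa> q' a - softmax \<kappa> q a) * (q' a - q a))"
    by (simp add: sum_subtractf[symmetric] left_diff_distrib)
  also have "\<dots> \<le> (\<Sum>a\<in>UNIV. (softmax \<kappa> q a + softmax \<kappa> q' a) * (2 * d / \<kappa>) * d)"
  proof (rule sum_mono)
    fix a
    have "(softmax \<kappa> q' a - softmax \<kappa> q a) * (q' a - q a) \<le> \<bar>softmax \<kappa> q' a - softmax \<kappa> q a\<bar> * \<bar>q' a - q a\<bar>"
      using abs_ge_self[of "(softmax \<kappa> q' a - softmax \<kappa> q a) * (q' a - q a)"] by (simp add: abs_mult)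
    also have "\<dots> \<le> (softmax \<kappa> q a + softmax \<kappa> q' a) * (2 * d / \<kappa>) * d"
      using d assms(1) softmax_pos[of \<kappa> q a] softmax_pos[of \<kappa> q' a]
      by (intro mult_mono softmax_Lipschitz[OF assms(1,2)] assms(2)[rule_format]) auto
    finally show "(softmax \<kappa> q' a - softmax \<kappa> q a) * (q' a - q a) \<le>
        (softmax \<kappa> q a + softmax \<kappa> q' a) * (2 * d / \<kappa>) * d" .
  qed
  also have "\<dots> = 4 / \<kappa> * d\<^sup>2"
    unfolding sum_distrib_right[symmetric] sum.distrib sum_softmax by (simp add: power2_eq_square)
  finally have up: "(\<Sum>a\<in>UNIV. softmax \<kappa> q' a * (q' a - q a)) - (\<Sum>a\<in>UNIV. softmax \<kappa> q a * (q' a - q a))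
      \<le> 4 / \<kappa> * d\<^sup>2" .
  have "(\<Sum>a\<in>UNIV. softmax \<kappa> q' a * (q a - q' a)) = - (\<Sum>a\<in>UNIV. softmax \<kappa> q' a * (q' a - q a))"
    by (simp add: sum_negf[symmetric] algebra_simps)
  with rev up log_sum_exp_tangent[OF assms(1), of q q'] show ?thesis
    by linarith
qed

lemma softmax_quadratic:
  fixes q :: "'a::finite \<Rightarrow> real"
  assumes "0 < \<kappa>" "\<forall>a. \<bar>q' a - q a\<bar> \<le> d"
  shows "\<bar>softmax \<kappa> q' a - softmax \<kappa> q a
      - softmax \<kappa> q a / \<kappa> * ((q' a - q a) - (\<Sum>b\<in>UNIV. softmax \<kappa> q b * (q' b - q b)))\<bar> \<le> 12 / \<kappa>\<^sup>2 * d\<^sup>2"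
proof -
  define w where "w = ((q' a - q a) - (log_sum_exp \<kappa> q' - log_sum_exp \<kappa> q)) / \<kappa>"
  define u where "u = (\<Sum>b\<in>UNIV. softmax \<kappa> q b * (q' b - q b))"
  note b = softmax_ratio_bounds[OF assms, of a, folded w_def]
  let ?s = "softmax \<kappa> q a" and ?s' = "softmax \<kappa> q' a"
  note pos = softmax_pos[of \<kappa> q a] softmax_pos[of \<kappa> q' a] softmax_le_1[of \<kappa> q a] softmax_le_1[of \<kappa> q' a]
  have d: "0 \<le> d" using assms(2)[rule_format, of undefined] by linarith
  have dk: "0 \<le> 2 * d / \<kappa>" using d assms(1) by simp
  have "\<bar>?s' - ?s - ?s * w\<bar> \<le> (?s' - ?s) * w"
    using b(2,3) by (simp add: left_diff_distrib)
  also have "\<dots> \<le> \<bar>?s' - ?s\<bar> * \<bar>w\<bar>"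
    using abs_ge_self[of "(?s' - ?s) * w"] by (simp add: abs_mult)
  also have "\<dots> \<le> (2 * (2 * d / \<kappa>)) * (2 * d / \<kappa>)"
  proof (intro mult_mono b(1))
    have "\<bar>?s' - ?s\<bar> \<le> (?s + ?s') * (2 * d / \<kappa>)"
      by (rule softmax_Lipschitz[OF assms])
    also have "\<dots> \<le> 2 * (2 * d / \<kappa>)"
      using dk pos by (intro mult_right_mono) auto
    finally show "\<bar>?s' - ?s\<bar> \<le> 2 * (2 * d / \<kappa>)" .
  qed (use dk in auto)
  finally have 1: "\<bar>?s' - ?s - ?s * w\<bar> \<le> 8 / \<kappa>\<^sup>2 * d\<^sup>2"
    by (simp add: power2_eq_square)
  have "?s * w - ?s / \<kappa> * ((q' a - q a) - u) = - (?s / \<kappa> * (log_sum_exp \<kappa> q' - log_sum_exp \<kappa> q - u))"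
    using assms(1) by (simp add: w_def field_simps)
  then have "\<bar>?s * w - ?s / \<kappa> * ((q' a - q a) - u)\<bar> = ?s / \<kappa> * \<bar>log_sum_exp \<kappa> q' - log_sum_exp \<kappa> q - u\<bar>"
    using pos assms(1) by (simp add: abs_mult)
  also have "\<dots> \<le> 1 / \<kappa> * (4 / \<kappa> * d\<^sup>2)"
    using pos assms(1) log_sum_exp_quadratic[OF assms] unfolding u_def
    by (intro mult_mono divide_right_mono) auto
  finally have "\<bar>?s * w - ?s / \<kappa> * ((q' a - q a) - u)\<bar> \<le> 4 / \<kappa>\<^sup>2 * d\<^sup>2"
    by (simp add: power2_eq_square)
  with 1 have "\<bar>?s' - ?s - ?s / \<kappa> * ((q' a - q a) - u)\<bar> \<le> 8 / \<kappa>\<^sup>2 * d\<^sup>2 + 4 / \<kappa>\<^sup>2 * d\<^sup>2"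
    by linarith
  also have "\<dots> = 12 / \<kappa>\<^sup>2 * d\<^sup>2"
    by (simp add: add_divide_distrib[symmetric])
  finally show ?thesis unfolding u_def .
qed

text \<open>The slope of \<open>x ln x\<close> is unbounded near zero, but its difference quotients are bounded when one
  of the two points stays above \<open>c\<close>.\<close>

lemma xlogx_Lipschitz_at_interior:
  fixes p p' c :: real
  assumes "0 < c" "c \<le> p" "p \<le> 1" "0 \<le> p'" "p' \<le> 1"
  shows "\<bar>p' * ln p' - p * ln p\<bar> \<le> (1 + 1 / c + \<bar>ln c\<bar>) * \<bar>p' - p\<bar>"
proof -
  have p: "0 < p" using assms by linarith
  have lnp: "\<bar>ln p\<bar> \<le> \<bar>ln c\<bar>"
    using assms ln_mono[of c p] by (simp add: abs_if)
  have up: "p' * ln p' - p * ln p \<le> (p' - p) * (p' / p + ln p)"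
  proof (cases "p' = 0")
    case False
    with assms have "0 < p'" by simp
    then have "ln (p' / p) \<le> p' / p - 1"
      using p by (intro ln_le_minus_one) simp
    then have "p' * (ln p' - ln p) \<le> p' * (p' / p - 1)"
      using p \<open>0 < p'\<close> by (intro mult_left_mono) (auto simp: ln_div)
    also have "\<dots> = (p' - p) * (p' / p)"
      using p by (simp add: field_simps)
    finally show ?thesis
      by (simp add: algebra_simps)
  qed simp
  have lo: "(p' - p) * (1 + ln p) \<le> p' * ln p' - p * ln p"
  proof (cases "p' = 0")
    case True then show ?thesis using p by (simp add: algebra_simps)
  next
    case False
    with assms have "0 < p'" by simp
    then have "ln (p / p') \<le> p / p' - 1"
      using p by (intro ln_le_minus_one) simp
    then have "p' * (ln p - ln p') \<le> p' * (p / p' - 1)"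
      using p \<open>0 < p'\<close> by (intro mult_left_mono) (auto simp: ln_div)
    also have "\<dots> = p - p'"
      using \<open>0 < p'\<close> by (simp add: field_simps)
    finally show ?thesis by (simp add: algebra_simps)
  qed
  have "p' / p \<le> 1 / c"
    using assms p by (intro frac_le) auto
  have c1: "\<bar>p' / p + ln p\<bar> \<le> 1 + 1 / c + \<bar>ln c\<bar>"
  proof -
    have "\<bar>p' / p + ln p\<bar> \<le> p' / p + \<bar>ln p\<bar>"
      using assms p by (intro order_trans[OF abs_triangle_ineq]) simp
    with \<open>p' / p \<le> 1 / c\<close> lnp show ?thesis by linarith
  qed
  have c2: "\<bar>1 + ln p\<bar> \<le> 1 + 1 / c + \<bar>ln c\<bar>"
  proof -
    have "0 \<le> 1 / c" using assms by simp
    then show ?thesis using lnp by linarith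
  qed
  have "\<bar>(p' - p) * (p' / p + ln p)\<bar> \<le> (1 + 1 / c + \<bar>ln c\<bar>) * \<bar>p' - p\<bar>"
    unfolding abs_mult by (subst mult.commute) (rule mult_right_mono[OF c1], simp)
  moreover have "\<bar>(p' - p) * (1 + ln p)\<bar> \<le> (1 + 1 / c + \<bar>ln c\<bar>) * \<bar>p' - p\<bar>"
    unfolding abs_mult by (subst mult.commute) (rule mult_right_mono[OF c2], simp)
  ultimately show ?thesis using up lo by linarith
qed

section \<open>The optimal regularized policy\<close>

definition soft_Bellman ::
  "real \<Rightarrow> real \<Rightarrow> ('s::finite, 'a::finite) mdp \<Rightarrow> ('s \<times> 'a \<Rightarrow> real) \<Rightarrow> 's \<times> 'a \<Rightarrow> real" where
  "soft_Bellman \<gamma> \<kappa> m q z =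
     reward m (fst z) (snd z) + \<gamma> * trans_avg m (\<lambda>s. log_sum_exp \<kappa> (\<lambda>a. q (s, a))) z"

definition soft_q :: "real \<Rightarrow> real \<Rightarrow> ('s::finite, 'a::finite) mdp \<Rightarrow> 's \<times> 'a \<Rightarrow> real" where
  "soft_q \<gamma> \<kappa> m = (SOME q. \<forall>z. soft_Bellman \<gamma> \<kappa> m q z = q z)"

definition soft_v :: "real \<Rightarrow> real \<Rightarrow> ('s::finite, 'a::finite) mdp \<Rightarrow> 's \<Rightarrow> real" where
  "soft_v \<gamma> \<kappa> m s = log_sum_exp \<kappa> (\<lambda>a. soft_q \<gamma> \<kappa> m (s, a))"

definition soft_policy :: "real \<Rightarrow> real \<Rightarrow> ('s::finite, 'a::finite) mdp \<Rightarrow> ('s, 'a) policy" where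
  "soft_policy \<gamma> \<kappa> m = (\<chi> z. softmax \<kappa> (\<lambda>a. soft_q \<gamma> \<kappa> m (fst z, a)) (snd z))"

lemma soft_policy_nth: "soft_policy \<gamma> \<kappa> m $ (s, a) = softmax \<kappa> (\<lambda>a. soft_q \<gamma> \<kappa> m (s, a)) a"
  by (simp add: soft_policy_def)

lemma is_policy_soft_policy: "is_policy (soft_policy \<gamma> \<kappa> m)"
  by (simp add: is_policy_def soft_policy_nth sum_softmax less_imp_le[OF softmax_pos])

lemma soft_q_fixpoint:
  assumes \<gamma>: "0 \<le> \<gamma>" "\<gamma> < 1" and "0 < \<kappa>"
  shows "soft_q \<gamma> \<kappa> m z = reward m (fst z) (snd z) + \<gamma> * trans_avg m (soft_v \<gamma> \<kappa> m) z"
proof -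
  have "\<exists>q. \<forall>z. soft_Bellman \<gamma> \<kappa> m q z = q z"
  proof (rule contraction_fixpoint[OF \<gamma>])
    fix g h :: "'a \<times> 'b \<Rightarrow> real" and c z
    assume le: "\<And>z'. norm (g z' - h z') \<le> c"
    have "norm (trans_avg m (\<lambda>s. log_sum_exp \<kappa> (\<lambda>a. g (s, a)) - log_sum_exp \<kappa> (\<lambda>a. h (s, a))) z) \<le> c"
      using le assms(3) by (intro norm_trans_avg_le) (auto intro!: log_sum_exp_nonexpansive)
    then have "\<gamma> * \<bar>trans_avg m (\<lambda>s. log_sum_exp \<kappa> (\<lambda>a. g (s, a)) - log_sum_exp \<kappa> (\<lambda>a. h (s, a))) z\<bar> \<le> \<gamma> * c"
      using \<gamma> by (intro mult_left_mono) auto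
    then show "norm (soft_Bellman \<gamma> \<kappa> m g z - soft_Bellman \<gamma> \<kappa> m h z) \<le> \<gamma> * c"
      using \<gamma> by (simp add: soft_Bellman_def trans_avg_diff right_diff_distrib[symmetric] abs_mult)
  qed
  then have "\<forall>z. soft_Bellman \<gamma> \<kappa> m (soft_q \<gamma> \<kappa> m) z = soft_q \<gamma> \<kappa> m z"
    unfolding soft_q_def by (rule someI_ex)
  then have "soft_Bellman \<gamma> \<kappa> m (soft_q \<gamma> \<kappa> m) z = soft_q \<gamma> \<kappa> m z" ..
  then show ?thesis
    by (simp add: soft_Bellman_def soft_v_def[abs_def])
qed

text \<open>By the Gibbs inequality the excess of the value of \<open>\<pi>\<close> over \<open>soft_v\<close> is at most \<open>\<gamma>\<close> times
  its own supremum.\<close>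

lemma value_fn_le_soft_v:
  assumes \<gamma>: "0 \<le> \<gamma>" "\<gamma> < 1" and \<kappa>: "0 < \<kappa>" and \<pi>: "is_policy \<pi>"
  shows "value_fn \<gamma> \<kappa> m \<pi> s \<le> soft_v \<gamma> \<kappa> m s"
proof -
  let ?V = "value_fn \<gamma> \<kappa> m \<pi>" and ?v = "soft_v \<gamma> \<kappa> m"
  have "?V s - ?v s \<le> 0 / (1 - \<gamma>)"
  proof (rule sup_self_bound[where e = "\<lambda>s. ?V s - ?v s", OF \<gamma>(2)])
    fix c s assume c: "\<And>s. ?V s - ?v s \<le> c"
    have "reg_reward \<kappa> m \<pi> z + \<gamma> * trans_avg m ?V z \<le> soft_q \<gamma> \<kappa> m z + \<kappa> * policy_entropy \<pi> (fst z) + \<gamma> * c" for z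
    proof -
      have "trans_avg m ?V z \<le> trans_avg m (\<lambda>s. ?v s + c) z"
        using c by (intro trans_avg_mono) (simp add: algebra_simps)
      then have "\<gamma> * trans_avg m ?V z \<le> \<gamma> * (trans_avg m ?v z + c)"
        using \<gamma> by (intro mult_left_mono) (auto simp: trans_avg_add trans_avg_const)
      then show ?thesis
        using soft_q_fixpoint[OF \<gamma> \<kappa>, of m z] by (simp add: reg_reward_def algebra_simps)
    qed
    then have "?V s \<le> policy_avg \<pi> (\<lambda>z. soft_q \<gamma> \<kappa> m z + \<kappa> * policy_entropy \<pi> (fst z) + \<gamma> * c) s"
      using value_fn_Bellman[OF \<gamma> \<pi>, of \<kappa> m s] policy_avg_mono[OF \<pi>] by fastforce
    also have "\<dots> = policy_avg \<pi> (soft_q \<gamma> \<kappa> m) s + \<kappa> * policy_entropy \<pi> s + \<gamma> * c"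
      by (simp add: policy_avg_add policy_avg_const[OF \<pi>]
          policy_avg_state[OF \<pi>, where g = "\<lambda>s. \<kappa> * policy_entropy \<pi> s"])
    also have "policy_avg \<pi> (soft_q \<gamma> \<kappa> m) s + \<kappa> * policy_entropy \<pi> s \<le> ?v s"
      using Gibbs_variational[OF \<kappa>, of "\<lambda>a. \<pi> $ (s, a)" "\<lambda>a. soft_q \<gamma> \<kappa> m (s, a)"] \<pi>
      by (simp add: is_policy_def policy_avg_def policy_entropy_def soft_v_def)
    finally show "?V s - ?v s \<le> 0 + \<gamma> * c" by simp
  qed
  then show ?thesis by simp
qed

text \<open>For the softmax policy the Gibbs inequality is an equality, and the argument for the upper bound runs
  in the other direction too.\<close>

lemma value_fn_soft_policy:
  assumes \<gamma>: "0 \<le> \<gamma>" "\<gamma> < 1" and \<kappa>: "0 < \<kappa>"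
  shows "value_fn \<gamma> \<kappa> m (soft_policy \<gamma> \<kappa> m) s = soft_v \<gamma> \<kappa> m s"
proof -
  let ?\<pi> = "soft_policy \<gamma> \<kappa> m"
  let ?V = "value_fn \<gamma> \<kappa> m ?\<pi>" and ?v = "soft_v \<gamma> \<kappa> m"
  note \<pi> = is_policy_soft_policy[of \<gamma> \<kappa> m]
  have "?v s - ?V s \<le> 0 / (1 - \<gamma>)"
  proof (rule sup_self_bound[where e = "\<lambda>s. ?v s - ?V s", OF \<gamma>(2)])
    fix c s assume c: "\<And>s. ?v s - ?V s \<le> c"
    have *: "soft_q \<gamma> \<kappa> m z + \<kappa> * policy_entropy ?\<pi> (fst z) - \<gamma> * c \<le> reg_reward \<kappa> m ?\<pi> z + \<gamma> * trans_avg m ?V z" for z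
    proof -
      have "trans_avg m (\<lambda>s. ?v s - c) z \<le> trans_avg m ?V z"
        using c by (intro trans_avg_mono) (simp add: algebra_simps)
      then have "\<gamma> * (trans_avg m ?v z - c) \<le> \<gamma> * trans_avg m ?V z"
        using \<gamma> by (intro mult_left_mono) (auto simp: trans_avg_diff trans_avg_const)
      then show ?thesis
        using soft_q_fixpoint[OF \<gamma> \<kappa>, of m z] by (simp add: reg_reward_def algebra_simps)
    qed
    have "policy_avg ?\<pi> (soft_q \<gamma> \<kappa> m) s + \<kappa> * policy_entropy ?\<pi> s = ?v s"
      using Gibbs_softmax[OF \<kappa>, of "\<lambda>a. soft_q \<gamma> \<kappa> m (s, a)"]
      by (simp add: policy_avg_def policy_entropy_def soft_policy_nth soft_v_def)
    then have "?v s - \<gamma> * c = policy_avg ?\<pi> (\<lambda>z. soft_q \<gamma> \<kappa> m z + \<kappa> * policy_entropy ?\<pi> (fst z) - \<gamma> * c) s"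
      by (simp add: policy_avg_add policy_avg_diff policy_avg_const[OF \<pi>]
          policy_avg_state[OF \<pi>, where g = "\<lambda>s. \<kappa> * policy_entropy ?\<pi> s"])
    also have "\<dots> \<le> ?V s"
      unfolding value_fn_Bellman[OF \<gamma> \<pi>, of \<kappa> m s] by (rule policy_avg_mono[OF \<pi> *])
    finally show "?v s - ?V s \<le> 0 + \<gamma> * c" by simp
  qed
  with value_fn_le_soft_v[OF \<gamma> \<kappa> \<pi>, of m s] show ?thesis by simp
qed

text \<open>The softmax policy attains the supremum in every state at once.\<close>

lemma optimal_q_eq_soft_q:
  assumes \<gamma>: "0 \<le> \<gamma>" "\<gamma> < 1" and \<kappa>: "0 < \<kappa>"
  shows "optimal_q \<gamma> \<kappa> m s a = soft_q \<gamma> \<kappa> m (s, a)"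
proof -
  have q_fn: "q_fn \<gamma> \<kappa> m \<pi> s a = reward m s a + \<gamma> * trans_avg m (value_fn \<gamma> \<kappa> m \<pi>) (s, a)" for \<pi>
    by (simp add: q_fn_def trans_avg_def expectation_finite_type)
  have soft: "q_fn \<gamma> \<kappa> m (soft_policy \<gamma> \<kappa> m) s a = soft_q \<gamma> \<kappa> m (s, a)"
    unfolding q_fn using soft_q_fixpoint[OF \<gamma> \<kappa>, of m "(s, a)"] value_fn_soft_policy[OF \<gamma> \<kappa>, of m]
    by (simp add: trans_avg_def)
  show ?thesis
    unfolding optimal_q_def
  proof (rule cSup_eq_maximum)
    show "soft_q \<gamma> \<kappa> m (s, a) \<in> (\<lambda>\<pi>. q_fn \<gamma> \<kappa> m \<pi> s a) ` {\<pi>. is_policy \<pi>}"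
      using soft is_policy_soft_policy by (metis (mono_tags) image_eqI mem_Collect_eq)
    fix q assume "q \<in> (\<lambda>\<pi>. q_fn \<gamma> \<kappa> m \<pi> s a) ` {\<pi>. is_policy \<pi>}"
    then obtain \<pi> where \<pi>: "is_policy \<pi>" "q = q_fn \<gamma> \<kappa> m \<pi> s a" by auto
    have "trans_avg m (value_fn \<gamma> \<kappa> m \<pi>) (s, a) \<le> trans_avg m (soft_v \<gamma> \<kappa> m) (s, a)"
      by (intro trans_avg_mono value_fn_le_soft_v[OF \<gamma> \<kappa> \<pi>(1)])
    then show "q \<le> soft_q \<gamma> \<kappa> m (s, a)"
      unfolding \<pi>(2) q_fn soft_q_fixpoint[OF \<gamma> \<kappa>] using \<gamma> by (simp add: mult_left_mono)
  qed
qed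

lemma follower_policy_eq_soft_policy:
  assumes \<gamma>: "0 \<le> \<gamma>" "\<gamma> < 1" and \<kappa>: "0 < \<kappa>"
  shows "follower_policy \<gamma> \<kappa> m = soft_policy \<gamma> \<kappa> m"
  unfolding follower_policy_def
proof (rule the_equality)
  show "is_follower_policy \<gamma> \<kappa> m (soft_policy \<gamma> \<kappa> m)"
    unfolding is_follower_policy_def
  proof (intro conjI allI impI)
    fix \<pi> :: "('a, 'b) policy" assume "is_policy \<pi>"
    then show "measure_pmf.expectation (init_dist m) (value_fn \<gamma> \<kappa> m \<pi>)
        \<le> measure_pmf.expectation (init_dist m) (value_fn \<gamma> \<kappa> m (soft_policy \<gamma> \<kappa> m))"
      unfolding expectation_finite_type value_fn_soft_policy[OF assms]
      by (intro sum_mono scaleR_left_mono value_fn_le_soft_v[OF assms]) auto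
  qed (simp_all add: is_policy_soft_policy soft_policy_nth softmax_def optimal_q_eq_soft_q[OF assms])
  fix \<pi> :: "('a, 'b) policy" assume \<pi>: "is_follower_policy \<gamma> \<kappa> m \<pi>"
  have "\<pi> $ z = soft_policy \<gamma> \<kappa> m $ z" for z
    using \<pi> by (cases z) (simp add: is_follower_policy_def soft_policy_nth softmax_def optimal_q_eq_soft_q[OF assms])
  then show "\<pi> = soft_policy \<gamma> \<kappa> m"
    by (simp add: vec_eq_iff)
qed

section \<open>The family of decision processes\<close>

lemma norm_le_infnorm_bound:
  fixes v :: "'v::euclidean_space"
  assumes "infnorm v \<le> b" shows "norm v \<le> sqrt DIM('v) * b"
  by (rule order_trans[OF norm_le_infnorm mult_left_mono[OF assms]]) simp

lemma infnorm_Lipschitz_imp_norm: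
  fixes v :: "'v::euclidean_space" and h :: "'w::euclidean_space"
  assumes "infnorm v \<le> b * infnorm h" shows "norm v \<le> sqrt DIM('v) * \<bar>b\<bar> * norm h"
proof -
  have "b * infnorm h \<le> \<bar>b\<bar> * norm h"
    by (intro mult_mono infnorm_le_norm infnorm_pos_le) auto
  with assms have "infnorm v \<le> \<bar>b\<bar> * norm h" by simp
  from norm_le_infnorm_bound[OF this] show ?thesis by (simp add: mult.assoc)
qed

lemma convex_policies: "convex {\<pi> :: ('s::finite, 'a::finite) policy. is_policy \<pi>}"
  unfolding convex_alt
proof clarify
  fix p q :: "('s, 'a) policy" and u :: real
  assume p: "is_policy p" and q: "is_policy q" and u: "0 \<le> u" "u \<le> 1"
  show "is_policy ((1 - u) *\<^sub>R p + u *\<^sub>R q)"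
    using p q u by (simp add: is_policy_def sum.distrib sum_distrib_left[symmetric])
qed

lemma GDERIV_norm_le:
  assumes "GDERIV g x :> D" and "0 \<le> B"
    and "\<forall>\<^sub>F y in nhds x. \<bar>g y - g x\<bar> \<le> B * norm (y - x)"
  shows "norm D \<le> B"
proof -
  have "(\<lambda>n. real (Suc n) * (g (x + (1 / real (Suc n)) *\<^sub>R D) - g x)) \<longlonglongrightarrow> inner D D"
    by (rule GDERIV_quotient_LIMSEQ[OF assms(1)])
  moreover have "\<forall>\<^sub>F n in sequentially. real (Suc n) * (g (x + (1 / real (Suc n)) *\<^sub>R D) - g x) \<le> B * norm D"
  proof -
    have "(\<lambda>n. x + (1 / real (Suc n)) *\<^sub>R D) \<longlonglongrightarrow> x + 0 *\<^sub>R D"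
      by (intro tendsto_intros) (use LIMSEQ_inverse_real_of_nat in \<open>simp add: divide_inverse\<close>)
    then have "filterlim (\<lambda>n. x + (1 / real (Suc n)) *\<^sub>R D) (nhds x) sequentially"
      by simp
    from filterlim_iff[THEN iffD1, OF this, rule_format, OF assms(3)] show ?thesis
    proof eventually_elim
      case (elim n)
      then have "g (x + (1 / real (Suc n)) *\<^sub>R D) - g x \<le> B * norm D / real (Suc n)"
        by simp
      then have "real (Suc n) * (g (x + (1 / real (Suc n)) *\<^sub>R D) - g x) \<le> real (Suc n) * (B * norm D / real (Suc n))"
        by (intro mult_left_mono) auto
      then show ?case by simp
    qed
  qed
  ultimately have "inner D D \<le> B * norm D"
    by (intro tendsto_le[OF _ tendsto_const]) auto
  then have "norm D * norm D \<le> B * norm D"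
    by (simp add: dot_square_norm power2_eq_square)
  then show ?thesis
    using assms(2) by (cases "norm D = 0") (auto simp: mult_le_cancel_right)
qed

lemma abs_sum_mult_le:
  fixes c v :: "'z::finite \<Rightarrow> real"
  assumes "\<And>z. \<bar>c z\<bar> \<le> A" "\<And>z. \<bar>v z\<bar> \<le> B"
  shows "\<bar>\<Sum>z\<in>UNIV. c z * v z\<bar> \<le> real CARD('z) * (A * B)"
proof -
  have "0 \<le> A" using assms(1)[of undefined] by linarith
  have "\<bar>\<Sum>z\<in>UNIV. c z * v z\<bar> \<le> (\<Sum>z\<in>(UNIV::'z set). A * B)"
    using \<open>0 \<le> A\<close> assms by (intro order_trans[OF sum_abs] sum_mono) (simp only: abs_mult, intro mult_mono, auto)
  then show ?thesis by simp
qed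

lemma trans_avg_sub:
  fixes v v' :: "'s::finite \<Rightarrow> real"
  shows "trans_avg m' v' z - trans_avg m v z =
    (\<Sum>s\<in>UNIV. (pmf (trans m' (fst z) (snd z)) s - pmf (trans m (fst z) (snd z)) s) * v' s)
    + trans_avg m (\<lambda>s. v' s - v s) z"
  by (simp add: trans_avg_def sum.distrib[symmetric] sum_subtractf[symmetric] algebra_simps)

text \<open>The bounds below are uniform in contexts \<open>\<xi>\<close> from the space of \<open>\<Xi>\<close>; the hypotheses say nothing
  about other contexts.\<close>

locale bilevel_problem =
  fixes \<Xi> :: "'c measure"
    and M :: "real ^ 'd::finite \<Rightarrow> 'c \<Rightarrow> ('s::finite, 'a::finite) mdp"
    and f :: "real ^ 'd \<Rightarrow> ('s, 'a) policy \<Rightarrow> 'c \<Rightarrow> real"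
    and \<gamma> \<kappa> L S R K\<^sub>1 K\<^sub>2 K\<^sub>3 :: real
  assumes prob_space_Xi: "prob_space \<Xi>"
    and \<gamma>_pos: "0 < \<gamma>" and \<gamma>_less: "\<gamma> < 1" and \<kappa>_pos: "0 < \<kappa>"
    and loss: "regular_loss \<Xi> L S f"
    and mdps: "regular_mdps \<Xi> R K\<^sub>1 K\<^sub>2 M"
    and smooth: "smooth_mdps \<Xi> K\<^sub>3 M"
begin

lemma \<gamma>_nonneg: "0 \<le> \<gamma>"
  using \<gamma>_pos by simp

abbreviation follower :: "real ^ 'd \<Rightarrow> 'c \<Rightarrow> ('s, 'a) policy" where
  "follower x \<xi> \<equiv> soft_policy \<gamma> \<kappa> (M x \<xi>)"

text \<open>The assumptions bound supremum norms. Everything below uses the Euclidean norm, hence the square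
  roots of dimensions in the constants.\<close>

definition reward_slope :: real where "reward_slope = sqrt DIM(real ^ 'd) * \<bar>K\<^sub>2\<bar>"
definition log_trans_slope :: real where "log_trans_slope = sqrt DIM(real ^ 'd) * \<bar>K\<^sub>1\<bar>"
definition smoothness :: real where "smoothness = sqrt DIM(real ^ 'd) * \<bar>K\<^sub>3\<bar>"

lemma slopes_nonneg: "0 \<le> reward_slope" "0 \<le> log_trans_slope" "0 \<le> smoothness"
  by (simp_all add: reward_slope_def log_trans_slope_def smoothness_def)

subsection \<open>Rewards\<close>

lemma abs_reward_le: "\<xi> \<in> space \<Xi> \<Longrightarrow> \<bar>reward (M x \<xi>) s a\<bar> \<le> \<bar>R\<bar>"
  using mdps unfolding regular_mdps_def by (meson abs_ge_self less_imp_le order_trans)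

lemma GDERIV_reward:
  "\<xi> \<in> space \<Xi> \<Longrightarrow> GDERIV (\<lambda>y. reward (M y \<xi>) s a) x :> grad_reward M x \<xi> s a"
  unfolding grad_reward_def using mdps by (intro GDERIV_gradient) (simp add: regular_mdps_def)

lemma norm_grad_reward_le: "\<xi> \<in> space \<Xi> \<Longrightarrow> norm (grad_reward M x \<xi> s a) \<le> reward_slope"
  unfolding reward_slope_def
proof (rule norm_le_infnorm_bound)
  assume "\<xi> \<in> space \<Xi>"
  then have "infnorm (grad_reward M x \<xi> s a) < K\<^sub>2"
    using mdps by (simp add: regular_mdps_def)
  then show "infnorm (grad_reward M x \<xi> s a) \<le> \<bar>K\<^sub>2\<bar>" by simp
qed

lemma grad_reward_Lipschitz:
  "\<xi> \<in> space \<Xi> \<Longrightarrow> norm (grad_reward M y \<xi> s a - grad_reward M x \<xi> s a) \<le> smoothness * norm (y - x)"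
  unfolding smoothness_def using smooth
  by (intro infnorm_Lipschitz_imp_norm) (simp add: smooth_mdps_def)

lemma reward_Lipschitz:
  "\<xi> \<in> space \<Xi> \<Longrightarrow> \<bar>reward (M y \<xi>) s a - reward (M x \<xi>) s a\<bar> \<le> reward_slope * norm (y - x)"
  by (rule gradient_bounded_imp_Lipschitz[OF GDERIV_reward norm_grad_reward_le])

lemma reward_quadratic:
  "\<xi> \<in> space \<Xi> \<Longrightarrow> \<bar>reward (M y \<xi>) s a - reward (M x \<xi>) s a - inner (y - x) (grad_reward M x \<xi> s a)\<bar>
     \<le> smoothness * (norm (y - x))\<^sup>2"
  by (rule gradient_quadratic_remainder[OF GDERIV_reward grad_reward_Lipschitz slopes_nonneg(3)])

subsection \<open>Transition probabilities\<close>

lemma norm_grad_log_trans_le: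
  assumes "\<xi> \<in> space \<Xi>" "0 < pmf (trans (M x \<xi>) s a) s'"
  shows "norm (grad_log_trans M x \<xi> s a s') \<le> log_trans_slope"
  unfolding log_trans_slope_def
proof (rule norm_le_infnorm_bound)
  have "infnorm (grad_log_trans M x \<xi> s a s') < K\<^sub>1"
    using mdps assms by (simp add: regular_mdps_def)
  then show "infnorm (grad_log_trans M x \<xi> s a s') \<le> \<bar>K\<^sub>1\<bar>" by simp
qed

text \<open>The gradient of a transition probability, in the form in which the estimator samples it.\<close>

definition grad_trans :: "real ^ 'd \<Rightarrow> 'c \<Rightarrow> 's \<Rightarrow> 'a \<Rightarrow> 's \<Rightarrow> real ^ 'd" where
  "grad_trans x \<xi> s a s' = pmf (trans (M x \<xi>) s a) s' *\<^sub>R grad_log_trans M x \<xi> s a s'"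

lemma norm_grad_trans_le:
  assumes "\<xi> \<in> space \<Xi>"
  shows "norm (grad_trans x \<xi> s a s') \<le> log_trans_slope * pmf (trans (M x \<xi>) s a) s'"
proof (cases "pmf (trans (M x \<xi>) s a) s' = 0")
  case False
  then have "0 < pmf (trans (M x \<xi>) s a) s'" by (simp add: pmf_pos)
  from mult_left_mono[OF norm_grad_log_trans_le[OF assms this], of "pmf (trans (M x \<xi>) s a) s'"]
  show ?thesis
    by (simp add: grad_trans_def mult.commute)
qed (simp add: grad_trans_def)

text \<open>Where the probability vanishes it is minimal, so its gradient is zero, as the formula says.\<close>

lemma GDERIV_trans:
  assumes \<xi>: "\<xi> \<in> space \<Xi>"
  shows "GDERIV (\<lambda>y. pmf (trans (M y \<xi>) s a) s') x :> grad_trans x \<xi> s a s'"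
proof -
  let ?P = "\<lambda>y. pmf (trans (M y \<xi>) s a) s'"
  have d: "GDERIV ?P x :> gradient ?P x"
    using mdps \<xi> by (intro GDERIV_gradient) (simp add: regular_mdps_def)
  show ?thesis
  proof (cases "?P x = 0")
    case True
    have "(\<lambda>h. inner h (gradient ?P x)) = (\<lambda>h. 0)"
    proof (rule differential_zero_maxmin[OF UNIV_I open_UNIV])
      show "(?P has_derivative (\<lambda>h. inner h (gradient ?P x))) (at x)"
        using d unfolding gderiv_def .
      show "(\<forall>y\<in>UNIV. ?P y \<le> ?P x) \<or> (\<forall>y\<in>UNIV. ?P x \<le> ?P y)"
        using True by simp
    qed
    then have "inner (gradient ?P x) (gradient ?P x) = 0" by (rule fun_cong)
    with d True show ?thesis by (simp add: grad_trans_def)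
  next
    case False
    then have pos: "0 < ?P x" by (simp add: pmf_pos)
    have "GDERIV (\<lambda>y. ln (?P y)) x :> (1 / ?P x) *\<^sub>R gradient ?P x"
      using pos by (intro GDERIV_DERIV_compose d) (auto intro!: derivative_eq_intros)
    then have "grad_log_trans M x \<xi> s a s' = (1 / ?P x) *\<^sub>R gradient ?P x"
      unfolding grad_log_trans_def by (rule gradient_eqI)
    with False d show ?thesis
      by (simp add: grad_trans_def)
  qed
qed

text \<open>The bounded logarithmic gradient keeps a transition probability from reaching zero. The support is
  therefore the same for all decisions, and products of a probability with its logarithmic gradient are
  Lipschitz.\<close>

lemma trans_support_constant:
  assumes "\<xi> \<in> space \<Xi>" "0 < pmf (trans (M x \<xi>) s a) s'"
  shows "0 < pmf (trans (M y \<xi>) s a) s'"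
  by (rule positive_of_gradient_le[OF GDERIV_trans[OF assms(1)] norm_grad_trans_le[OF assms(1)] assms(2)])

lemma norm_grad_trans_le_slope:
  assumes "\<xi> \<in> space \<Xi>" shows "norm (grad_trans x \<xi> s a s') \<le> log_trans_slope"
proof -
  have "log_trans_slope * pmf (trans (M x \<xi>) s a) s' \<le> log_trans_slope * 1"
    by (intro mult_left_mono pmf_le_1 slopes_nonneg)
  with norm_grad_trans_le[OF assms, of x s a s'] show ?thesis by linarith
qed

lemma trans_Lipschitz:
  "\<xi> \<in> space \<Xi> \<Longrightarrow> \<bar>pmf (trans (M y \<xi>) s a) s' - pmf (trans (M x \<xi>) s a) s'\<bar> \<le> log_trans_slope * norm (y - x)"
  by (rule gradient_bounded_imp_Lipschitz[OF GDERIV_trans norm_grad_trans_le_slope])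

lemma grad_log_trans_Lipschitz:
  assumes "\<xi> \<in> space \<Xi>" "0 < pmf (trans (M x \<xi>) s a) s'"
  shows "norm (grad_log_trans M y \<xi> s a s' - grad_log_trans M x \<xi> s a s') \<le> smoothness * norm (y - x)"
  unfolding smoothness_def using smooth assms trans_support_constant[OF assms]
  by (intro infnorm_Lipschitz_imp_norm) (simp add: smooth_mdps_def)

lemma grad_trans_Lipschitz:
  assumes \<xi>: "\<xi> \<in> space \<Xi>"
  shows "norm (grad_trans y \<xi> s a s' - grad_trans x \<xi> s a s')
    \<le> (log_trans_slope\<^sup>2 + smoothness) * norm (y - x)"
proof (cases "0 < pmf (trans (M x \<xi>) s a) s'")
  case False
  then have "pmf (trans (M x \<xi>) s a) s' = 0" "pmf (trans (M y \<xi>) s a) s' = 0"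
    using trans_support_constant[OF \<xi>, of y s a s' x] by (metis less_irrefl pmf_pos)+
  then show ?thesis by (simp add: grad_trans_def slopes_nonneg)
next
  case True
  let ?P = "pmf (trans (M x \<xi>) s a) s'" and ?P' = "pmf (trans (M y \<xi>) s a) s'"
  let ?l = "grad_log_trans M x \<xi> s a s'" and ?l' = "grad_log_trans M y \<xi> s a s'"
  have "grad_trans y \<xi> s a s' - grad_trans x \<xi> s a s' = (?P' - ?P) *\<^sub>R ?l + ?P' *\<^sub>R (?l' - ?l)"
    by (simp add: grad_trans_def algebra_simps)
  then have "norm (grad_trans y \<xi> s a s' - grad_trans x \<xi> s a s') \<le> \<bar>?P' - ?P\<bar> * norm ?l + ?P' * norm (?l' - ?l)"
    by (metis norm_triangle_ineq norm_scaleR abs_of_nonneg pmf_nonneg)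
  also have "\<dots> \<le> (log_trans_slope * norm (y - x)) * log_trans_slope + 1 * (smoothness * norm (y - x))"
    using slopes_nonneg
    by (intro add_mono mult_mono trans_Lipschitz[OF \<xi>] norm_grad_log_trans_le[OF \<xi> True]
        grad_log_trans_Lipschitz[OF \<xi> True] pmf_le_1) auto
  finally show ?thesis by (simp add: power2_eq_square algebra_simps)
qed

lemma trans_quadratic:
  "\<xi> \<in> space \<Xi> \<Longrightarrow> \<bar>pmf (trans (M y \<xi>) s a) s' - pmf (trans (M x \<xi>) s a) s' - inner (y - x) (grad_trans x \<xi> s a s')\<bar>
     \<le> (log_trans_slope\<^sup>2 + smoothness) * (norm (y - x))\<^sup>2"
  by (rule gradient_quadratic_remainder[OF GDERIV_trans grad_trans_Lipschitz])
     (use slopes_nonneg in auto)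

subsection \<open>The loss\<close>

lemma loss_domain:
  obtains U where "open U" "{\<pi>. is_policy \<pi>} \<subseteq> U"
    and "\<And>x \<pi>. \<pi> \<in> U \<Longrightarrow> f x \<pi> \<in> borel_measurable \<Xi>"
    and "\<And>\<xi> x \<pi>. \<xi> \<in> space \<Xi> \<Longrightarrow> \<pi> \<in> U \<Longrightarrow> (\<lambda>(y, p). f y p \<xi>) differentiable (at (x, \<pi>))"
    and "\<And>\<xi> x1 x2 \<pi>1 \<pi>2. \<xi> \<in> space \<Xi> \<Longrightarrow> \<pi>1 \<in> U \<Longrightarrow> \<pi>2 \<in> U \<Longrightarrow>
      \<bar>f x1 \<pi>1 \<xi> - f x2 \<pi>2 \<xi>\<bar> \<le> \<bar>L\<bar> * (norm (x1 - x2) + norm (\<pi>1 - \<pi>2))"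
    and "\<And>\<xi> x1 x2 \<pi>1 \<pi>2. \<xi> \<in> space \<Xi> \<Longrightarrow> \<pi>1 \<in> U \<Longrightarrow> \<pi>2 \<in> U \<Longrightarrow>
      norm (gradient (\<lambda>y. f y \<pi>1 \<xi>) x1 - gradient (\<lambda>y. f y \<pi>2 \<xi>) x2)
        \<le> sqrt DIM(real ^ 'd) * (\<bar>S\<bar> * (norm (x1 - x2) + norm (\<pi>1 - \<pi>2)))"
    and "\<And>\<xi> x1 x2 \<pi>1 \<pi>2. \<xi> \<in> space \<Xi> \<Longrightarrow> \<pi>1 \<in> U \<Longrightarrow> \<pi>2 \<in> U \<Longrightarrow>
      norm (gradient (\<lambda>p. f x1 p \<xi>) \<pi>1 - gradient (\<lambda>p. f x2 p \<xi>) \<pi>2)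
        \<le> sqrt DIM(('s, 'a) policy) * (\<bar>S\<bar> * (norm (x1 - x2) + norm (\<pi>1 - \<pi>2)))"
proof -
  from loss obtain U where U: "open U" "{\<pi>. is_policy \<pi>} \<subseteq> U"
    "\<forall>x. \<forall>\<pi>\<in>U. f x \<pi> \<in> borel_measurable \<Xi>"
    "\<forall>\<xi>\<in>space \<Xi>. \<forall>x. \<forall>\<pi>\<in>U. (\<lambda>(y, p). f y p \<xi>) differentiable (at (x, \<pi>))"
    and lip: "\<forall>\<xi>\<in>space \<Xi>. \<forall>x1 x2. \<forall>\<pi>1\<in>U. \<forall>\<pi>2\<in>U.
          \<bar>f x1 \<pi>1 \<xi> - f x2 \<pi>2 \<xi>\<bar> \<le> L * (infnorm (x1 - x2) + infnorm (\<pi>1 - \<pi>2)) \<and>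
          infnorm (gradient (\<lambda>y. f y \<pi>1 \<xi>) x1 - gradient (\<lambda>y. f y \<pi>2 \<xi>) x2)
            \<le> S * (infnorm (x1 - x2) + infnorm (\<pi>1 - \<pi>2)) \<and>
          infnorm (gradient (\<lambda>p. f x1 p \<xi>) \<pi>1 - gradient (\<lambda>p. f x2 p \<xi>) \<pi>2)
            \<le> S * (infnorm (x1 - x2) + infnorm (\<pi>1 - \<pi>2))"
    unfolding regular_loss_def by blast
  have le: "b * (infnorm u + infnorm w) \<le> \<bar>b\<bar> * (norm u + norm w)"
    for b and u :: "real ^ 'd" and w :: "('s, 'a) policy"
    by (intro mult_mono add_mono infnorm_le_norm add_nonneg_nonneg infnorm_pos_le) auto
  show thesis
  proof (rule that[OF U(1,2)])
    show "\<bar>f x1 \<pi>1 \<xi> - f x2 \<pi>2 \<xi>\<bar> \<le> \<bar>L\<bar> * (norm (x1 - x2) + norm (\<pi>1 - \<pi>2))"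
      if "\<xi> \<in> space \<Xi>" "\<pi>1 \<in> U" "\<pi>2 \<in> U" for \<xi> x1 x2 \<pi>1 \<pi>2
      using lip that le order_trans by blast
    show "norm (gradient (\<lambda>y. f y \<pi>1 \<xi>) x1 - gradient (\<lambda>y. f y \<pi>2 \<xi>) x2)
        \<le> sqrt DIM(real ^ 'd) * (\<bar>S\<bar> * (norm (x1 - x2) + norm (\<pi>1 - \<pi>2)))"
      if "\<xi> \<in> space \<Xi>" "\<pi>1 \<in> U" "\<pi>2 \<in> U" for \<xi> x1 x2 \<pi>1 \<pi>2
      by (rule norm_le_infnorm_bound) (use lip that le order_trans in blast)
    show "norm (gradient (\<lambda>p. f x1 p \<xi>) \<pi>1 - gradient (\<lambda>p. f x2 p \<xi>) \<pi>2)
        \<le> sqrt DIM(('s, 'a) policy) * (\<bar>S\<bar> * (norm (x1 - x2) + norm (\<pi>1 - \<pi>2)))"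
      if "\<xi> \<in> space \<Xi>" "\<pi>1 \<in> U" "\<pi>2 \<in> U" for \<xi> x1 x2 \<pi>1 \<pi>2
      by (rule norm_le_infnorm_bound) (use lip that le order_trans in blast)
  qed (use U in auto)
qed

definition loss_smoothness :: real where
  "loss_smoothness = (sqrt DIM(real ^ 'd) + sqrt DIM(('s, 'a) policy)) * \<bar>S\<bar>"

lemma loss_smoothness_nonneg: "0 \<le> loss_smoothness"
  by (simp add: loss_smoothness_def)

lemma GDERIV_loss:
  assumes \<xi>: "\<xi> \<in> space \<Xi>" and \<pi>: "is_policy \<pi>"
  shows "GDERIV (\<lambda>(y, p). f y p \<xi>) (x, \<pi>) :> (gradient (\<lambda>y. f y \<pi> \<xi>) x, gradient (\<lambda>p. f x p \<xi>) \<pi>)"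
    and "GDERIV (\<lambda>y. f y \<pi> \<xi>) x :> gradient (\<lambda>y. f y \<pi> \<xi>) x"
    and "GDERIV (\<lambda>p. f x p \<xi>) \<pi> :> gradient (\<lambda>p. f x p \<xi>) \<pi>"
proof -
  let ?g = "\<lambda>(y, p). f y p \<xi>"
  obtain U where "{\<pi>. is_policy \<pi>} \<subseteq> U" and diff: "\<And>x \<pi>. \<pi> \<in> U \<Longrightarrow> ?g differentiable (at (x, \<pi>))"
    using loss_domain \<xi> by metis
  then have d: "GDERIV ?g (x, \<pi>) :> gradient ?g (x, \<pi>)"
    using \<pi> by (intro GDERIV_gradient) auto
  obtain A B where AB: "gradient ?g (x, \<pi>) = (A, B)" by fastforce
  have "((\<lambda>y. ?g (y, \<pi>)) has_derivative (\<lambda>h. inner (h, 0) (A, B))) (at x)"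
    using d unfolding AB gderiv_def
    by (intro has_derivative_compose[where f = "\<lambda>y. (y, \<pi>)" and g = ?g])
       (auto intro!: derivative_eq_intros)
  then have A: "GDERIV (\<lambda>y. f y \<pi> \<xi>) x :> A"
    by (simp add: gderiv_def)
  have "((\<lambda>p. ?g (x, p)) has_derivative (\<lambda>h. inner (0, h) (A, B))) (at \<pi>)"
    using d unfolding AB gderiv_def
    by (intro has_derivative_compose[where f = "\<lambda>p. (x, p)" and g = ?g])
       (auto intro!: derivative_eq_intros)
  then have B: "GDERIV (\<lambda>p. f x p \<xi>) \<pi> :> B"
    by (simp add: gderiv_def)
  from d show "GDERIV ?g (x, \<pi>) :> (gradient (\<lambda>y. f y \<pi> \<xi>) x, gradient (\<lambda>p. f x p \<xi>) \<pi>)"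
    unfolding AB gradient_eqI[OF A] gradient_eqI[OF B] .
  from A show "GDERIV (\<lambda>y. f y \<pi> \<xi>) x :> gradient (\<lambda>y. f y \<pi> \<xi>) x"
    unfolding gradient_eqI[OF A] .
  from B show "GDERIV (\<lambda>p. f x p \<xi>) \<pi> :> gradient (\<lambda>p. f x p \<xi>) \<pi>"
    unfolding gradient_eqI[OF B] .
qed

lemma loss_gradients_Lipschitz:
  assumes "\<xi> \<in> space \<Xi>" "is_policy \<pi>1" "is_policy \<pi>2"
  shows "norm (gradient (\<lambda>y. f y \<pi>1 \<xi>) x1 - gradient (\<lambda>y. f y \<pi>2 \<xi>) x2)
      \<le> loss_smoothness * (norm (x1 - x2) + norm (\<pi>1 - \<pi>2))"
    and "norm (gradient (\<lambda>p. f x1 p \<xi>) \<pi>1 - gradient (\<lambda>p. f x2 p \<xi>) \<pi>2)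
      \<le> loss_smoothness * (norm (x1 - x2) + norm (\<pi>1 - \<pi>2))"
proof -
  obtain U where U: "{\<pi>. is_policy \<pi>} \<subseteq> U"
    "\<And>\<xi> x1 x2 \<pi>1 \<pi>2. \<xi> \<in> space \<Xi> \<Longrightarrow> \<pi>1 \<in> U \<Longrightarrow> \<pi>2 \<in> U \<Longrightarrow>
      norm (gradient (\<lambda>y. f y \<pi>1 \<xi>) x1 - gradient (\<lambda>y. f y \<pi>2 \<xi>) x2)
        \<le> sqrt DIM(real ^ 'd) * (\<bar>S\<bar> * (norm (x1 - x2) + norm (\<pi>1 - \<pi>2)))"
    "\<And>\<xi> x1 x2 \<pi>1 \<pi>2. \<xi> \<in> space \<Xi> \<Longrightarrow> \<pi>1 \<in> U \<Longrightarrow> \<pi>2 \<in> U \<Longrightarrow>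
      norm (gradient (\<lambda>p. f x1 p \<xi>) \<pi>1 - gradient (\<lambda>p. f x2 p \<xi>) \<pi>2)
        \<le> sqrt DIM(('s, 'a) policy) * (\<bar>S\<bar> * (norm (x1 - x2) + norm (\<pi>1 - \<pi>2)))"
    using loss_domain by metis
  have le: "c1 * (\<bar>S\<bar> * n) \<le> (c1 + c2) * \<bar>S\<bar> * n" "c2 * (\<bar>S\<bar> * n) \<le> (c1 + c2) * \<bar>S\<bar> * n"
    if "0 \<le> c1" "0 \<le> c2" "0 \<le> n" for c1 c2 n :: real
    using that by (simp_all add: algebra_simps)
  have mem: "\<pi>1 \<in> U" "\<pi>2 \<in> U" using assms U(1) by auto
  show "norm (gradient (\<lambda>y. f y \<pi>1 \<xi>) x1 - gradient (\<lambda>y. f y \<pi>2 \<xi>) x2)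
      \<le> loss_smoothness * (norm (x1 - x2) + norm (\<pi>1 - \<pi>2))"
    unfolding loss_smoothness_def
    by (rule order_trans[OF U(2)[OF assms(1) mem] le(1)]) auto
  show "norm (gradient (\<lambda>p. f x1 p \<xi>) \<pi>1 - gradient (\<lambda>p. f x2 p \<xi>) \<pi>2)
      \<le> loss_smoothness * (norm (x1 - x2) + norm (\<pi>1 - \<pi>2))"
    unfolding loss_smoothness_def
    by (rule order_trans[OF U(3)[OF assms(1) mem] le(2)]) auto
qed

lemma loss_gradients_bounded:
  assumes \<xi>: "\<xi> \<in> space \<Xi>" and \<pi>: "is_policy \<pi>"
  shows "norm (gradient (\<lambda>y. f y \<pi> \<xi>) x) \<le> \<bar>L\<bar>" and "norm (gradient (\<lambda>p. f x p \<xi>) \<pi>) \<le> \<bar>L\<bar>"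
proof -
  obtain U where U: "open U" "{\<pi>. is_policy \<pi>} \<subseteq> U"
    and lip: "\<And>x1 x2 \<pi>1 \<pi>2. \<pi>1 \<in> U \<Longrightarrow> \<pi>2 \<in> U \<Longrightarrow>
      \<bar>f x1 \<pi>1 \<xi> - f x2 \<pi>2 \<xi>\<bar> \<le> \<bar>L\<bar> * (norm (x1 - x2) + norm (\<pi>1 - \<pi>2))"
    using loss_domain \<xi> by metis
  have \<pi>U: "\<pi> \<in> U" using U \<pi> by auto
  have "\<forall>\<^sub>F p in nhds \<pi>. p \<in> U"
    using U(1) \<pi>U by (rule eventually_nhds_in_open)
  then have "\<forall>\<^sub>F p in nhds \<pi>. \<bar>f x p \<xi> - f x \<pi> \<xi>\<bar> \<le> \<bar>L\<bar> * norm (p - \<pi>)"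
  proof eventually_elim
    case (elim p)
    show ?case using lip[OF elim \<pi>U, of x x] by simp
  qed
  then show "norm (gradient (\<lambda>p. f x p \<xi>) \<pi>) \<le> \<bar>L\<bar>"
    by (intro GDERIV_norm_le[OF GDERIV_loss(3)[OF \<xi> \<pi>]]) auto
  have "\<forall>\<^sub>F y in nhds x. \<bar>f y \<pi> \<xi> - f x \<pi> \<xi>\<bar> \<le> \<bar>L\<bar> * norm (y - x)"
  proof (rule always_eventually, rule allI)
    show "\<bar>f y \<pi> \<xi> - f x \<pi> \<xi>\<bar> \<le> \<bar>L\<bar> * norm (y - x)" for y
      using lip[OF \<pi>U \<pi>U, of y x] by simp
  qed
  then show "norm (gradient (\<lambda>y. f y \<pi> \<xi>) x) \<le> \<bar>L\<bar>"
    by (intro GDERIV_norm_le[OF GDERIV_loss(2)[OF \<xi> \<pi>]]) auto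
qed

text \<open>The set of policies is convex, so the segment between the two arguments stays in the domain of the
  loss.\<close>

lemma loss_quadratic:
  assumes \<xi>: "\<xi> \<in> space \<Xi>" and \<pi>: "is_policy \<pi>" and \<pi>': "is_policy \<pi>'"
  shows "\<bar>f y \<pi>' \<xi> - f x \<pi> \<xi> - inner (y - x) (gradient (\<lambda>y. f y \<pi> \<xi>) x)
      - inner (\<pi>' - \<pi>) (gradient (\<lambda>p. f x p \<xi>) \<pi>)\<bar>
    \<le> 4 * loss_smoothness * ((norm (y - x))\<^sup>2 + (norm (\<pi>' - \<pi>))\<^sup>2)"
proof -
  let ?g = "\<lambda>(y, p). f y p \<xi>"
  let ?G = "\<lambda>z. (gradient (\<lambda>y. f y (snd z) \<xi>) (fst z), gradient (\<lambda>p. f (fst z) p \<xi>) (snd z))"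
  have "convex ((UNIV :: (real ^ 'd) set) \<times> {\<pi> :: ('s, 'a) policy. is_policy \<pi>})"
    by (intro convex_Times convex_policies) simp
  then have seg: "closed_segment (x, \<pi>) (y, \<pi>') \<subseteq> UNIV \<times> {\<pi>. is_policy \<pi>}"
    using \<pi> \<pi>' by (intro closed_segment_subset) auto
  have "\<bar>?g (y, \<pi>') - ?g (x, \<pi>) - inner ((y, \<pi>') - (x, \<pi>)) (?G (x, \<pi>))\<bar>
      \<le> 4 * loss_smoothness * (norm ((y, \<pi>') - (x, \<pi>)))\<^sup>2"
  proof (rule gradient_quadratic_remainder)
    fix z assume "z \<in> closed_segment (x, \<pi>) (y, \<pi>')"
    with seg obtain u p where z: "z = (u, p)" and p: "is_policy p" by auto
    show "GDERIV ?g z :> ?G z"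
      unfolding z using GDERIV_loss(1)[OF \<xi> p, of u] by simp
    have "norm (?G z - ?G (x, \<pi>)) \<le> norm (gradient (\<lambda>y. f y p \<xi>) u - gradient (\<lambda>y. f y \<pi> \<xi>) x)
        + norm (gradient (\<lambda>p. f u p \<xi>) p - gradient (\<lambda>p. f x p \<xi>) \<pi>)"
      unfolding z by (simp add: norm_Pair_le)
    also have "\<dots> \<le> loss_smoothness * (norm (u - x) + norm (p - \<pi>)) + loss_smoothness * (norm (u - x) + norm (p - \<pi>))"
      by (intro add_mono loss_gradients_Lipschitz \<xi> p \<pi>)
    also have "norm (u - x) + norm (p - \<pi>) \<le> 2 * norm (z - (x, \<pi>))"
      using norm_fst_le[of "u - x" "p - \<pi>"] norm_snd_le[of "p - \<pi>" "u - x"] by (simp add: z)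
    then have "loss_smoothness * (norm (u - x) + norm (p - \<pi>)) \<le> loss_smoothness * (2 * norm (z - (x, \<pi>)))"
      by (rule mult_left_mono[OF _ loss_smoothness_nonneg])
    finally show "norm (?G z - ?G (x, \<pi>)) \<le> 4 * loss_smoothness * norm (z - (x, \<pi>))"
      by simp
  qed (simp add: loss_smoothness_nonneg)
  then show ?thesis
    by (simp add: norm_Pair diff_diff_eq)
qed

end

section \<open>First-order expansions\<close>

lemma abs_add_scaled_le:
  fixes a b c x :: real
  assumes "0 \<le> c" "x = a + c * b"
  shows "\<bar>x\<bar> \<le> \<bar>a\<bar> + c * \<bar>b\<bar>"
  using abs_triangle_ineq[of a "c * b"] assms by (simp add: abs_mult)

context bilevel_problem
begin

lemma trans_difference_le:
  fixes v :: "'s \<Rightarrow> real"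
  assumes "\<xi> \<in> space \<Xi>" "\<And>s. \<bar>v s\<bar> \<le> B"
  shows "\<bar>\<Sum>s\<in>UNIV. (pmf (trans (M y \<xi>) s0 a) s - pmf (trans (M x \<xi>) s0 a) s) * v s\<bar>
    \<le> real CARD('s) * log_trans_slope * B * norm (y - x)"
proof -
  have "\<bar>\<Sum>s\<in>UNIV. (pmf (trans (M y \<xi>) s0 a) s - pmf (trans (M x \<xi>) s0 a) s) * v s\<bar>
      \<le> real CARD('s) * ((log_trans_slope * norm (y - x)) * B)"
    by (intro abs_sum_mult_le trans_Lipschitz assms)
  then show ?thesis by (simp add: mult_ac)
qed

text \<open>From here on constants that depend neither on the decision nor on the context are named as they
  arise; only this independence and their sign matter.\<close>

definition q_bound :: real where
  "q_bound = (\<bar>R\<bar> + \<gamma> * (\<kappa> * ln (real CARD('a)))) / (1 - \<gamma>)"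

definition v_bound :: real where
  "v_bound = q_bound + \<kappa> * ln (real CARD('a))"

lemma ln_card_nonneg: "0 \<le> \<kappa> * ln (real CARD('a))"
  using \<kappa>_pos by (intro mult_nonneg_nonneg) (auto simp: Suc_le_eq)

lemma bounds_nonneg: "0 \<le> q_bound" "0 \<le> v_bound"
  using \<gamma>_less \<gamma>_pos ln_card_nonneg by (auto simp: q_bound_def v_bound_def)

lemma soft_q_bounded:
  assumes \<xi>: "\<xi> \<in> space \<Xi>"
  shows "\<bar>soft_q \<gamma> \<kappa> (M x \<xi>) z\<bar> \<le> q_bound"
  unfolding q_bound_def
proof (rule sup_self_bound[where e = "\<lambda>z. \<bar>soft_q \<gamma> \<kappa> (M x \<xi>) z\<bar>", OF \<gamma>_less])
  fix c z assume c: "\<And>z. \<bar>soft_q \<gamma> \<kappa> (M x \<xi>) z\<bar> \<le> c"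
  have "norm (trans_avg (M x \<xi>) (soft_v \<gamma> \<kappa> (M x \<xi>)) z) \<le> c + \<kappa> * ln (real CARD('a))"
    by (rule norm_trans_avg_le) (use c \<kappa>_pos in \<open>auto simp: soft_v_def intro!: log_sum_exp_bound\<close>)
  then have "\<gamma> * \<bar>trans_avg (M x \<xi>) (soft_v \<gamma> \<kappa> (M x \<xi>)) z\<bar> \<le> \<gamma> * (c + \<kappa> * ln (real CARD('a)))"
    by (intro mult_left_mono \<gamma>_nonneg) simp
  moreover have "\<bar>soft_q \<gamma> \<kappa> (M x \<xi>) z\<bar> \<le> \<bar>reward (M x \<xi>) (fst z) (snd z)\<bar>
      + \<gamma> * \<bar>trans_avg (M x \<xi>) (soft_v \<gamma> \<kappa> (M x \<xi>)) z\<bar>"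
    unfolding soft_q_fixpoint[OF \<gamma>_nonneg \<gamma>_less \<kappa>_pos, of "M x \<xi>" z]
    using \<gamma>_nonneg by (intro order_trans[OF abs_triangle_ineq]) (simp add: abs_mult)
  ultimately show "\<bar>soft_q \<gamma> \<kappa> (M x \<xi>) z\<bar> \<le> \<bar>R\<bar> + \<gamma> * (\<kappa> * ln (real CARD('a))) + \<gamma> * c"
    using abs_reward_le[OF \<xi>, of x "fst z" "snd z"] by (simp add: algebra_simps)
qed

lemma soft_v_bounded:
  assumes \<xi>: "\<xi> \<in> space \<Xi>"
  shows "\<bar>soft_v \<gamma> \<kappa> (M x \<xi>) s\<bar> \<le> v_bound"
  unfolding soft_v_def v_bound_def
  by (rule log_sum_exp_bound[OF \<kappa>_pos]) (simp add: soft_q_bounded[OF \<xi>])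

definition q_slope :: real where
  "q_slope = (reward_slope + \<gamma> * (real CARD('s) * log_trans_slope * v_bound)) / (1 - \<gamma>)"

lemma q_slope_nonneg: "0 \<le> q_slope"
  using \<gamma>_less \<gamma>_pos slopes_nonneg bounds_nonneg by (simp add: q_slope_def)

lemma soft_q_Lipschitz:
  assumes \<xi>: "\<xi> \<in> space \<Xi>"
  shows "\<bar>soft_q \<gamma> \<kappa> (M y \<xi>) z - soft_q \<gamma> \<kappa> (M x \<xi>) z\<bar> \<le> q_slope * norm (y - x)"
proof -
  let ?n = "norm (y - x)"
  let ?q = "soft_q \<gamma> \<kappa> (M x \<xi>)" and ?q' = "soft_q \<gamma> \<kappa> (M y \<xi>)"
  let ?v = "soft_v \<gamma> \<kappa> (M x \<xi>)" and ?v' = "soft_v \<gamma> \<kappa> (M y \<xi>)"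
  have "\<bar>?q' z - ?q z\<bar> \<le> (reward_slope * ?n + \<gamma> * (real CARD('s) * log_trans_slope * v_bound * ?n)) / (1 - \<gamma>)"
  proof (rule sup_self_bound[where e = "\<lambda>z. \<bar>?q' z - ?q z\<bar>", OF \<gamma>_less])
    fix c z assume c: "\<And>z. \<bar>?q' z - ?q z\<bar> \<le> c"
    have "norm (trans_avg (M x \<xi>) (\<lambda>s. ?v' s - ?v s) z) \<le> c"
      by (rule norm_trans_avg_le)
         (use c \<kappa>_pos in \<open>auto simp: soft_v_def intro!: log_sum_exp_nonexpansive\<close>)
    moreover have "\<bar>\<Sum>s\<in>UNIV. (pmf (trans (M y \<xi>) (fst z) (snd z)) s - pmf (trans (M x \<xi>) (fst z) (snd z)) s) * ?v' s\<bar>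
        \<le> real CARD('s) * log_trans_slope * v_bound * ?n"
      by (rule trans_difference_le[OF \<xi> soft_v_bounded[OF \<xi>]])
    ultimately have "\<bar>trans_avg (M y \<xi>) ?v' z - trans_avg (M x \<xi>) ?v z\<bar>
        \<le> real CARD('s) * log_trans_slope * v_bound * ?n + c"
      unfolding trans_avg_sub by simp
    then have "\<gamma> * \<bar>trans_avg (M y \<xi>) ?v' z - trans_avg (M x \<xi>) ?v z\<bar>
        \<le> \<gamma> * (real CARD('s) * log_trans_slope * v_bound * ?n + c)"
      by (intro mult_left_mono \<gamma>_nonneg)
    moreover have "\<bar>?q' z - ?q z\<bar> \<le> \<bar>reward (M y \<xi>) (fst z) (snd z) - reward (M x \<xi>) (fst z) (snd z)\<bar>
        + \<gamma> * \<bar>trans_avg (M y \<xi>) ?v' z - trans_avg (M x \<xi>) ?v z\<bar>"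
    proof -
      have "?q' z - ?q z = (reward (M y \<xi>) (fst z) (snd z) - reward (M x \<xi>) (fst z) (snd z))
          + \<gamma> * (trans_avg (M y \<xi>) ?v' z - trans_avg (M x \<xi>) ?v z)"
        unfolding soft_q_fixpoint[OF \<gamma>_nonneg \<gamma>_less \<kappa>_pos, of "M y \<xi>" z]
          soft_q_fixpoint[OF \<gamma>_nonneg \<gamma>_less \<kappa>_pos, of "M x \<xi>" z] by (simp add: algebra_simps)
      then show ?thesis
        by (rule abs_add_scaled_le[OF \<gamma>_nonneg])
    qed
    ultimately show "\<bar>?q' z - ?q z\<bar> \<le> reward_slope * ?n
        + \<gamma> * (real CARD('s) * log_trans_slope * v_bound * ?n) + \<gamma> * c"
      using reward_Lipschitz[OF \<xi>, of y "fst z" "snd z" x] by (simp add: algebra_simps)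
  qed
  also have "\<dots> = q_slope * ?n"
    by (simp add: q_slope_def algebra_simps)
  finally show ?thesis .
qed

text \<open>The derivative of the Bellman equation in the decision with the policy held fixed. For the
  follower's policy it is the derivative of \<open>soft_q\<close>, because the derivative of log-sum-exp is the
  average under softmax; for every policy it is the mean of the sampled quantity.\<close>

definition grad_q :: "real ^ 'd \<Rightarrow> 'c \<Rightarrow> ('s, 'a) policy \<Rightarrow> 's \<times> 'a \<Rightarrow> real ^ 'd" where
  "grad_q x \<xi> \<pi> = (SOME D. \<forall>z. grad_reward M x \<xi> (fst z) (snd z)
     + \<gamma> *\<^sub>R ((\<Sum>s\<in>UNIV. value_fn \<gamma> \<kappa> (M x \<xi>) \<pi> s *\<^sub>R grad_trans x \<xi> (fst z) (snd z) s)
        + trans_avg (M x \<xi>) (policy_avg \<pi> D) z) = D z)"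

lemma grad_q_fixpoint:
  assumes \<pi>: "is_policy \<pi>"
  shows "grad_q x \<xi> \<pi> z = grad_reward M x \<xi> (fst z) (snd z)
     + \<gamma> *\<^sub>R ((\<Sum>s\<in>UNIV. value_fn \<gamma> \<kappa> (M x \<xi>) \<pi> s *\<^sub>R grad_trans x \<xi> (fst z) (snd z) s)
        + trans_avg (M x \<xi>) (policy_avg \<pi> (grad_q x \<xi> \<pi>)) z)"
proof -
  let ?B = "\<lambda>D z. grad_reward M x \<xi> (fst z) (snd z)
     + \<gamma> *\<^sub>R ((\<Sum>s\<in>UNIV. value_fn \<gamma> \<kappa> (M x \<xi>) \<pi> s *\<^sub>R grad_trans x \<xi> (fst z) (snd z) s)
        + trans_avg (M x \<xi>) (policy_avg \<pi> D) z)"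
  have "\<exists>D. \<forall>z. ?B D z = D z"
  proof (rule contraction_fixpoint[OF \<gamma>_nonneg \<gamma>_less])
    fix g h :: "'s \<times> 'a \<Rightarrow> real ^ 'd" and c z
    assume le: "\<And>z. norm (g z - h z) \<le> c"
    have "norm (trans_avg (M x \<xi>) (policy_avg \<pi> (\<lambda>z. g z - h z)) z) \<le> c"
      by (intro norm_trans_avg_le norm_policy_avg_le \<pi> le)
    then have "\<gamma> * norm (trans_avg (M x \<xi>) (policy_avg \<pi> (\<lambda>z. g z - h z)) z) \<le> \<gamma> * c"
      by (intro mult_left_mono \<gamma>_nonneg)
    moreover have "policy_avg \<pi> (\<lambda>z. g z - h z) = (\<lambda>s. policy_avg \<pi> g s - policy_avg \<pi> h s)"
      by (rule ext) (rule policy_avg_diff)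
    then have "?B g z - ?B h z = \<gamma> *\<^sub>R trans_avg (M x \<xi>) (policy_avg \<pi> (\<lambda>z. g z - h z)) z"
      by (simp add: trans_avg_diff scaleR_diff_right scaleR_add_right)
    ultimately show "norm (?B g z - ?B h z) \<le> \<gamma> * c"
      using \<gamma>_nonneg by simp
  qed
  then have "\<forall>z. ?B (grad_q x \<xi> \<pi>) z = grad_q x \<xi> \<pi> z"
    unfolding grad_q_def by (rule someI_ex)
  then have "?B (grad_q x \<xi> \<pi>) z = grad_q x \<xi> \<pi> z" ..
  then show ?thesis by (rule sym)
qed

lemma inner_trans_avg: "inner v (trans_avg m h z) = trans_avg m (\<lambda>s. inner v (h s)) z"
  by (simp add: trans_avg_def inner_sum_right)

lemma inner_policy_avg: "inner v (policy_avg \<pi> h s) = policy_avg \<pi> (\<lambda>z. inner v (h z)) s"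
  by (simp add: policy_avg_def inner_sum_right)

lemma inner_grad_q_fixpoint:
  assumes \<pi>: "is_policy \<pi>"
  shows "inner h (grad_q x \<xi> \<pi> z) = inner h (grad_reward M x \<xi> (fst z) (snd z))
     + \<gamma> * ((\<Sum>s\<in>UNIV. inner h (grad_trans x \<xi> (fst z) (snd z) s) * value_fn \<gamma> \<kappa> (M x \<xi>) \<pi> s)
        + trans_avg (M x \<xi>) (policy_avg \<pi> (\<lambda>z. inner h (grad_q x \<xi> \<pi> z))) z)"
  by (subst grad_q_fixpoint[OF \<pi>])
     (simp add: inner_add_right inner_sum_right inner_trans_avg inner_policy_avg mult.commute)

definition q_smoothness :: real where
  "q_smoothness = (smoothness + \<gamma> * (real CARD('s) * ((log_trans_slope\<^sup>2 + smoothness) * v_bound)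
      + real CARD('s) * (log_trans_slope * q_slope) + 4 / \<kappa> * q_slope\<^sup>2)) / (1 - \<gamma>)"

lemma q_smoothness_nonneg: "0 \<le> q_smoothness"
  using \<gamma>_less \<gamma>_pos \<kappa>_pos slopes_nonneg bounds_nonneg q_slope_nonneg by (simp add: q_smoothness_def)

text \<open>Subtracting the equation for \<open>grad_q\<close> from the difference of two soft Bellman equations leaves terms
  of second order and \<open>\<gamma>\<close> times an average of the remainder itself.\<close>

lemma soft_q_quadratic:
  assumes \<xi>: "\<xi> \<in> space \<Xi>"
  shows "\<bar>soft_q \<gamma> \<kappa> (M y \<xi>) z - soft_q \<gamma> \<kappa> (M x \<xi>) z - inner (y - x) (grad_q x \<xi> (follower x \<xi>) z)\<bar>
    \<le> q_smoothness * (norm (y - x))\<^sup>2"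
proof -
  define n where "n = norm (y - x)"
  define h where "h = y - x"
  let ?q = "soft_q \<gamma> \<kappa> (M x \<xi>)" and ?q' = "soft_q \<gamma> \<kappa> (M y \<xi>)"
  let ?v = "soft_v \<gamma> \<kappa> (M x \<xi>)" and ?v' = "soft_v \<gamma> \<kappa> (M y \<xi>)"
  let ?\<pi> = "follower x \<xi>"
  note \<pi> = is_policy_soft_policy[of \<gamma> \<kappa> "M x \<xi>"]
  let ?D = "\<lambda>z. inner h (grad_q x \<xi> ?\<pi> z)"
  define k where "k = real CARD('s)"
  define cP where "cP = (log_trans_slope\<^sup>2 + smoothness)"
  have n: "0 \<le> n" by (simp add: n_def)
  have dq: "\<bar>?q' z - ?q z\<bar> \<le> q_slope * n" for z
    unfolding n_def by (rule soft_q_Lipschitz[OF \<xi>])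
  have dv: "\<bar>?v' s - ?v s\<bar> \<le> q_slope * n" for s
    unfolding soft_v_def by (rule log_sum_exp_nonexpansive[OF \<kappa>_pos]) (use dq in auto)
  have "\<bar>?q' z - ?q z - ?D z\<bar> \<le> (smoothness * n\<^sup>2 + \<gamma> * (k * (cP * n\<^sup>2 * v_bound)
      + k * (log_trans_slope * n * (q_slope * n)) + 4 / \<kappa> * (q_slope * n)\<^sup>2)) / (1 - \<gamma>)"
  proof (rule sup_self_bound[where e = "\<lambda>z. \<bar>?q' z - ?q z - ?D z\<bar>", OF \<gamma>_less])
    fix c z assume c: "\<And>z. \<bar>?q' z - ?q z - ?D z\<bar> \<le> c"
    let ?P = "\<lambda>s. pmf (trans (M x \<xi>) (fst z) (snd z)) s" and ?P' = "\<lambda>s. pmf (trans (M y \<xi>) (fst z) (snd z)) s"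
    let ?dP = "\<lambda>s. inner h (grad_trans x \<xi> (fst z) (snd z) s)"
    let ?dr = "inner h (grad_reward M x \<xi> (fst z) (snd z))"
    have 1: "\<bar>reward (M y \<xi>) (fst z) (snd z) - reward (M x \<xi>) (fst z) (snd z) - ?dr\<bar> \<le> smoothness * n\<^sup>2"
      unfolding n_def h_def by (rule reward_quadratic[OF \<xi>])
    have 2: "\<bar>\<Sum>s\<in>UNIV. (?P' s - ?P s - ?dP s) * ?v' s\<bar> \<le> k * (cP * n\<^sup>2 * v_bound)"
      unfolding k_def cP_def n_def h_def by (intro abs_sum_mult_le trans_quadratic \<xi> soft_v_bounded)
    have 3: "\<bar>\<Sum>s\<in>UNIV. ?dP s * (?v' s - ?v s)\<bar> \<le> k * (log_trans_slope * n * (q_slope * n))"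
      unfolding k_def
    proof (intro abs_sum_mult_le dv)
      fix s
      have "\<bar>?dP s\<bar> \<le> norm h * norm (grad_trans x \<xi> (fst z) (snd z) s)"
        by (rule Cauchy_Schwarz_ineq2)
      also have "\<dots> \<le> n * log_trans_slope"
        unfolding h_def n_def by (intro mult_left_mono norm_grad_trans_le_slope \<xi> norm_ge_zero)
      finally show "\<bar>?dP s\<bar> \<le> log_trans_slope * n" by (simp add: mult.commute)
    qed
    have 4: "norm (trans_avg (M x \<xi>) (\<lambda>s. ?v' s - ?v s - policy_avg ?\<pi> ?D s) z) \<le> 4 / \<kappa> * (q_slope * n)\<^sup>2 + c"
    proof (rule norm_trans_avg_le)
      fix s
      have "?v' s - ?v s - policy_avg ?\<pi> ?D s =
          (?v' s - ?v s - policy_avg ?\<pi> (\<lambda>z. ?q' z - ?q z) s) + policy_avg ?\<pi> (\<lambda>z. ?q' z - ?q z - ?D z) s"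
        by (simp add: policy_avg_diff)
      also have "\<bar>\<dots>\<bar> \<le> 4 / \<kappa> * (q_slope * n)\<^sup>2 + c"
      proof (intro order_trans[OF abs_triangle_ineq] add_mono)
        show "\<bar>?v' s - ?v s - policy_avg ?\<pi> (\<lambda>z. ?q' z - ?q z) s\<bar> \<le> 4 / \<kappa> * (q_slope * n)\<^sup>2"
          unfolding soft_v_def policy_avg_def soft_policy_nth real_scaleR_def
          by (rule log_sum_exp_quadratic[OF \<kappa>_pos]) (use dq in auto)
        show "\<bar>policy_avg ?\<pi> (\<lambda>z. ?q' z - ?q z - ?D z) s\<bar> \<le> c"
          using norm_policy_avg_le[OF \<pi>, of "\<lambda>z. ?q' z - ?q z - ?D z" c s] c by simp
      qed
      finally show "norm (?v' s - ?v s - policy_avg ?\<pi> ?D s) \<le> 4 / \<kappa> * (q_slope * n)\<^sup>2 + c" by simp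
    qed
    \<comment> \<open>The three errors: the kernel's own remainder, the product of the changes of kernel and value, and the
      remainder of the value.\<close>
    have "trans_avg (M y \<xi>) ?v' z - trans_avg (M x \<xi>) ?v z
        - ((\<Sum>s\<in>UNIV. ?dP s * ?v s) + trans_avg (M x \<xi>) (policy_avg ?\<pi> ?D) z)
      = (\<Sum>s\<in>UNIV. (?P' s - ?P s - ?dP s) * ?v' s) + (\<Sum>s\<in>UNIV. ?dP s * (?v' s - ?v s))
        + trans_avg (M x \<xi>) (\<lambda>s. ?v' s - ?v s - policy_avg ?\<pi> ?D s) z"
      unfolding trans_avg_sub
      by (simp add: trans_avg_diff left_diff_distrib right_diff_distrib sum_subtractf)
    then have "\<bar>trans_avg (M y \<xi>) ?v' z - trans_avg (M x \<xi>) ?v z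
        - ((\<Sum>s\<in>UNIV. ?dP s * ?v s) + trans_avg (M x \<xi>) (policy_avg ?\<pi> ?D) z)\<bar>
      \<le> k * (cP * n\<^sup>2 * v_bound) + k * (log_trans_slope * n * (q_slope * n)) + (4 / \<kappa> * (q_slope * n)\<^sup>2 + c)"
      using 2 3 4 unfolding real_norm_def by linarith
    then have "\<gamma> * \<bar>trans_avg (M y \<xi>) ?v' z - trans_avg (M x \<xi>) ?v z
        - ((\<Sum>s\<in>UNIV. ?dP s * ?v s) + trans_avg (M x \<xi>) (policy_avg ?\<pi> ?D) z)\<bar>
      \<le> \<gamma> * (k * (cP * n\<^sup>2 * v_bound) + k * (log_trans_slope * n * (q_slope * n)) + (4 / \<kappa> * (q_slope * n)\<^sup>2 + c))"
      by (intro mult_left_mono \<gamma>_nonneg)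
    moreover have "?q' z - ?q z - ?D z = (reward (M y \<xi>) (fst z) (snd z) - reward (M x \<xi>) (fst z) (snd z) - ?dr)
        + \<gamma> * (trans_avg (M y \<xi>) ?v' z - trans_avg (M x \<xi>) ?v z
        - ((\<Sum>s\<in>UNIV. ?dP s * ?v s) + trans_avg (M x \<xi>) (policy_avg ?\<pi> ?D) z))"
      unfolding soft_q_fixpoint[OF \<gamma>_nonneg \<gamma>_less \<kappa>_pos, of "M y \<xi>" z]
        soft_q_fixpoint[OF \<gamma>_nonneg \<gamma>_less \<kappa>_pos, of "M x \<xi>" z]
      by (subst inner_grad_q_fixpoint[OF \<pi>])
         (simp add: value_fn_soft_policy[OF \<gamma>_nonneg \<gamma>_less \<kappa>_pos] algebra_simps)
    then have diff: "\<bar>?q' z - ?q z - ?D z\<bar> \<le> \<bar>reward (M y \<xi>) (fst z) (snd z) - reward (M x \<xi>) (fst z) (snd z) - ?dr\<bar>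
        + \<gamma> * \<bar>trans_avg (M y \<xi>) ?v' z - trans_avg (M x \<xi>) ?v z
        - ((\<Sum>s\<in>UNIV. ?dP s * ?v s) + trans_avg (M x \<xi>) (policy_avg ?\<pi> ?D) z)\<bar>"
      by (rule abs_add_scaled_le[OF \<gamma>_nonneg])
    ultimately show "\<bar>?q' z - ?q z - ?D z\<bar> \<le> smoothness * n\<^sup>2 + \<gamma> * (k * (cP * n\<^sup>2 * v_bound)
      + k * (log_trans_slope * n * (q_slope * n)) + 4 / \<kappa> * (q_slope * n)\<^sup>2) + \<gamma> * c"
      using 1 by (simp add: algebra_simps)
  qed
  also have "\<dots> = q_smoothness * n\<^sup>2"
    by (simp add: q_smoothness_def k_def cP_def power2_eq_square algebra_simps)
  finally show ?thesis
    by (simp add: h_def n_def)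
qed

text \<open>Softmax has the derivative \<open>\<pi>(a) / \<kappa>\<close> times the derivative of \<open>q(a)\<close> minus its average under \<open>\<pi>\<close>.\<close>

definition grad_policy :: "real ^ 'd \<Rightarrow> 'c \<Rightarrow> ('s, 'a) policy \<Rightarrow> 's \<times> 'a \<Rightarrow> real ^ 'd" where
  "grad_policy x \<xi> \<pi> z = (\<pi> $ z / \<kappa>) *\<^sub>R (grad_q x \<xi> \<pi> z - policy_avg \<pi> (grad_q x \<xi> \<pi>) (fst z))"

definition policy_smoothness :: real where
  "policy_smoothness = 12 / \<kappa>\<^sup>2 * q_slope\<^sup>2 + 2 / \<kappa> * q_smoothness"

lemma policy_smoothness_nonneg: "0 \<le> policy_smoothness"
  using \<kappa>_pos q_smoothness_nonneg by (simp add: policy_smoothness_def)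

text \<open>The remainder of softmax as a function of \<open>soft_q\<close> plus the remainder of \<open>soft_q\<close> inserted into the
  linear part.\<close>

lemma follower_quadratic:
  assumes \<xi>: "\<xi> \<in> space \<Xi>"
  shows "\<bar>follower y \<xi> $ z - follower x \<xi> $ z - inner (y - x) (grad_policy x \<xi> (follower x \<xi>) z)\<bar>
    \<le> policy_smoothness * (norm (y - x))\<^sup>2"
proof -
  obtain s a where z: "z = (s, a)" by fastforce
  let ?\<pi> = "follower x \<xi>"
  note \<pi> = is_policy_soft_policy[of \<gamma> \<kappa> "M x \<xi>"]
  let ?dq = "\<lambda>z. soft_q \<gamma> \<kappa> (M y \<xi>) z - soft_q \<gamma> \<kappa> (M x \<xi>) z"
  let ?e = "\<lambda>z. ?dq z - inner (y - x) (grad_q x \<xi> ?\<pi> z)"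
  let ?p = "?\<pi> $ (s, a)"
  have p: "0 \<le> ?p" "?p \<le> 1"
    using softmax_le_1 by (simp_all add: soft_policy_nth less_imp_le[OF softmax_pos])
  have 1: "\<bar>follower y \<xi> $ (s, a) - ?p - ?p / \<kappa> * (?dq (s, a) - policy_avg ?\<pi> ?dq s)\<bar>
      \<le> 12 / \<kappa>\<^sup>2 * (q_slope * norm (y - x))\<^sup>2"
    unfolding soft_policy_nth policy_avg_def real_scaleR_def
    by (rule softmax_quadratic[OF \<kappa>_pos]) (simp add: soft_q_Lipschitz[OF \<xi>])
  have e: "\<bar>?e z\<bar> \<le> q_smoothness * (norm (y - x))\<^sup>2" for z
    by (rule soft_q_quadratic[OF \<xi>])
  then have "\<bar>policy_avg ?\<pi> ?e s\<bar> \<le> q_smoothness * (norm (y - x))\<^sup>2"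
    using norm_policy_avg_le[OF \<pi>, of ?e] by simp
  with e[of "(s, a)"] have "\<bar>?e (s, a) - policy_avg ?\<pi> ?e s\<bar> \<le> 2 * (q_smoothness * (norm (y - x))\<^sup>2)"
    by linarith
  then have "?p / \<kappa> * \<bar>?e (s, a) - policy_avg ?\<pi> ?e s\<bar> \<le> 1 / \<kappa> * (2 * (q_smoothness * (norm (y - x))\<^sup>2))"
    using p \<kappa>_pos by (intro mult_mono divide_right_mono) auto
  then have 2: "\<bar>?p / \<kappa> * (?e (s, a) - policy_avg ?\<pi> ?e s)\<bar> \<le> 2 / \<kappa> * q_smoothness * (norm (y - x))\<^sup>2"
    using p \<kappa>_pos by (simp add: abs_mult)
  have "inner (y - x) (grad_policy x \<xi> ?\<pi> (s, a)) =
      ?p / \<kappa> * (inner (y - x) (grad_q x \<xi> ?\<pi> (s, a)) - policy_avg ?\<pi> (\<lambda>z. inner (y - x) (grad_q x \<xi> ?\<pi> z)) s)"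
    by (simp add: grad_policy_def inner_diff_right[where x = "y - x"] inner_policy_avg)
  then have "follower y \<xi> $ (s, a) - ?p - inner (y - x) (grad_policy x \<xi> ?\<pi> (s, a)) =
      (follower y \<xi> $ (s, a) - ?p - ?p / \<kappa> * (?dq (s, a) - policy_avg ?\<pi> ?dq s))
      + ?p / \<kappa> * (?e (s, a) - policy_avg ?\<pi> ?e s)"
    by (simp only: policy_avg_diff) (simp add: diff_divide_distrib algebra_simps)
  with 1 2 have "\<bar>follower y \<xi> $ (s, a) - ?p - inner (y - x) (grad_policy x \<xi> ?\<pi> (s, a))\<bar>
      \<le> 12 / \<kappa>\<^sup>2 * (q_slope * norm (y - x))\<^sup>2 + 2 / \<kappa> * q_smoothness * (norm (y - x))\<^sup>2"
    by linarith
  then show ?thesis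
    unfolding z by (simp add: policy_smoothness_def power_mult_distrib distrib_right mult.assoc)
qed

lemma follower_Lipschitz:
  assumes \<xi>: "\<xi> \<in> space \<Xi>"
  shows "norm (follower y \<xi> - follower x \<xi>) \<le> real CARD('s \<times> 'a) * (4 * q_slope / \<kappa>) * norm (y - x)"
proof -
  have "\<bar>(follower y \<xi> - follower x \<xi>) $ z\<bar> \<le> 4 * q_slope / \<kappa> * norm (y - x)" for z
  proof -
    obtain s a where z: "z = (s, a)" by fastforce
    let ?p = "softmax \<kappa> (\<lambda>a. soft_q \<gamma> \<kappa> (M x \<xi>) (s, a)) a" and ?p' = "softmax \<kappa> (\<lambda>a. soft_q \<gamma> \<kappa> (M y \<xi>) (s, a)) a"
    have "\<bar>?p' - ?p\<bar> \<le> (?p + ?p') * (2 * (q_slope * norm (y - x)) / \<kappa>)"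
      by (rule softmax_Lipschitz[OF \<kappa>_pos]) (simp add: soft_q_Lipschitz[OF \<xi>])
    also have "\<dots> \<le> 2 * (2 * (q_slope * norm (y - x)) / \<kappa>)"
      using q_slope_nonneg \<kappa>_pos add_mono[OF softmax_le_1 softmax_le_1, of \<kappa> "\<lambda>a. soft_q \<gamma> \<kappa> (M x \<xi>) (s, a)" a]
      by (intro mult_right_mono) auto
    finally show ?thesis by (simp add: z soft_policy_nth)
  qed
  then have "(\<Sum>z\<in>UNIV. \<bar>(follower y \<xi> - follower x \<xi>) $ z\<bar>) \<le> (\<Sum>z\<in>(UNIV::('s \<times> 'a) set). 4 * q_slope / \<kappa> * norm (y - x))"
    by (intro sum_mono)
  then show ?thesis
    using order_trans[OF norm_le_l1_cart] by fastforce
qed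

text \<open>The chain rule for \<open>f x (follower x \<xi>) \<xi>\<close>, with the derivative of the follower's policy expressed
  through \<open>grad_q\<close>. For other policies it is the mean of the estimator.\<close>

definition hypergradient :: "real ^ 'd \<Rightarrow> 'c \<Rightarrow> ('s, 'a) policy \<Rightarrow> real ^ 'd" where
  "hypergradient x \<xi> \<pi> = gradient (\<lambda>y. f y \<pi> \<xi>) x
     + (\<Sum>z\<in>UNIV. (gradient (\<lambda>p. f x p \<xi>) \<pi> $ z) *\<^sub>R grad_policy x \<xi> \<pi> z)"

lemma composed_loss_quadratic:
  "\<exists>C\<ge>0. \<forall>\<xi>\<in>space \<Xi>. \<forall>x y.
     \<bar>f y (follower y \<xi>) \<xi> - f x (follower x \<xi>) \<xi> - inner (y - x) (hypergradient x \<xi> (follower x \<xi>))\<bar>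
     \<le> C * (norm (y - x))\<^sup>2"
proof (intro exI conjI ballI allI)
  define B where "B = real CARD('s \<times> 'a) * (4 * q_slope / \<kappa>)"
  let ?C = "4 * loss_smoothness * (1 + B\<^sup>2) + real CARD('s \<times> 'a) * (\<bar>L\<bar> * policy_smoothness)"
  show "0 \<le> ?C"
    using loss_smoothness_nonneg policy_smoothness_nonneg by simp
  fix \<xi> x y assume \<xi>: "\<xi> \<in> space \<Xi>"
  let ?\<pi> = "follower x \<xi>" and ?\<pi>' = "follower y \<xi>"
  let ?g = "gradient (\<lambda>p. f x p \<xi>) ?\<pi>"
  note \<pi> = is_policy_soft_policy[of \<gamma> \<kappa> "M x \<xi>"] and \<pi>' = is_policy_soft_policy[of \<gamma> \<kappa> "M y \<xi>"]
  have "norm (?\<pi>' - ?\<pi>) \<le> B * norm (y - x)"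
    using follower_Lipschitz[OF \<xi>] by (simp add: B_def)
  then have "(norm (?\<pi>' - ?\<pi>))\<^sup>2 \<le> B\<^sup>2 * (norm (y - x))\<^sup>2"
    by (metis norm_ge_zero power_mono power_mult_distrib)
  then have "(norm (y - x))\<^sup>2 + (norm (?\<pi>' - ?\<pi>))\<^sup>2 \<le> (1 + B\<^sup>2) * (norm (y - x))\<^sup>2"
    by (simp add: algebra_simps)
  then have "4 * loss_smoothness * ((norm (y - x))\<^sup>2 + (norm (?\<pi>' - ?\<pi>))\<^sup>2)
      \<le> 4 * loss_smoothness * ((1 + B\<^sup>2) * (norm (y - x))\<^sup>2)"
    using loss_smoothness_nonneg by (intro mult_left_mono) auto
  with loss_quadratic[OF \<xi> \<pi> \<pi>', of y x]
  have 1: "\<bar>f y ?\<pi>' \<xi> - f x ?\<pi> \<xi> - inner (y - x) (gradient (\<lambda>y. f y ?\<pi> \<xi>) x) - inner (?\<pi>' - ?\<pi>) ?g\<bar>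
      \<le> 4 * loss_smoothness * (1 + B\<^sup>2) * (norm (y - x))\<^sup>2"
    by simp
  have "\<bar>?g $ z\<bar> \<le> \<bar>L\<bar>" for z
    using component_le_norm_cart[of ?g z] loss_gradients_bounded(2)[OF \<xi> \<pi>, of x] by linarith
  then have 2: "\<bar>\<Sum>z\<in>UNIV. ?g $ z * (?\<pi>' $ z - ?\<pi> $ z - inner (y - x) (grad_policy x \<xi> ?\<pi> z))\<bar>
      \<le> real CARD('s \<times> 'a) * (\<bar>L\<bar> * (policy_smoothness * (norm (y - x))\<^sup>2))"
    by (rule abs_sum_mult_le[OF _ follower_quadratic[OF \<xi>]])
  have "inner (?\<pi>' - ?\<pi>) ?g = (\<Sum>z\<in>UNIV. ?g $ z * (?\<pi>' $ z - ?\<pi> $ z))"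
    by (simp add: inner_vec_def mult.commute)
  then have "f y ?\<pi>' \<xi> - f x ?\<pi> \<xi> - inner (y - x) (hypergradient x \<xi> ?\<pi>) =
      (f y ?\<pi>' \<xi> - f x ?\<pi> \<xi> - inner (y - x) (gradient (\<lambda>y. f y ?\<pi> \<xi>) x) - inner (?\<pi>' - ?\<pi>) ?g)
      + (\<Sum>z\<in>UNIV. ?g $ z * (?\<pi>' $ z - ?\<pi> $ z - inner (y - x) (grad_policy x \<xi> ?\<pi> z)))"
    by (simp only: hypergradient_def inner_add_right inner_sum_right inner_scaleR_right
        right_diff_distrib sum_subtractf)
  with 1 2 have "\<bar>f y ?\<pi>' \<xi> - f x ?\<pi> \<xi> - inner (y - x) (hypergradient x \<xi> ?\<pi>)\<bar> \<le>
      4 * loss_smoothness * (1 + B\<^sup>2) * (norm (y - x))\<^sup>2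
      + real CARD('s \<times> 'a) * (\<bar>L\<bar> * (policy_smoothness * (norm (y - x))\<^sup>2))"
    by linarith
  then show "\<bar>f y ?\<pi>' \<xi> - f x ?\<pi> \<xi> - inner (y - x) (hypergradient x \<xi> ?\<pi>)\<bar> \<le> ?C * (norm (y - x))\<^sup>2"
    by (simp only: distrib_right mult.assoc)
qed

end

section \<open>Sensitivity to the oracle's policy\<close>

lemma policy_nth_bounds:
  assumes "is_policy \<pi>"
  shows "0 \<le> \<pi> $ z" "\<pi> $ z \<le> 1"
proof -
  obtain s a where z: "z = (s, a)" by fastforce
  show "0 \<le> \<pi> $ z" using assms by (simp add: z is_policy_def)
  have "\<pi> $ (s, a) \<le> (\<Sum>a\<in>UNIV. \<pi> $ (s, a))"
    using assms by (intro member_le_sum) (auto simp: is_policy_def)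
  then show "\<pi> $ z \<le> 1" using assms by (simp add: z is_policy_def)
qed

lemma policy_entropy_bounds:
  fixes \<pi> :: "('s::finite, 'a::finite) policy"
  assumes "is_policy \<pi>"
  shows "0 \<le> policy_entropy \<pi> s" "policy_entropy \<pi> s \<le> ln (real CARD('a))"
proof -
  have "\<pi> $ (s, a) * ln (\<pi> $ (s, a)) \<le> 0" for a
  proof (cases "\<pi> $ (s, a) = 0")
    case False
    then have "ln (\<pi> $ (s, a)) \<le> 0"
      using policy_nth_bounds[OF assms, of "(s, a)"] by simp
    then show ?thesis
      using policy_nth_bounds[OF assms, of "(s, a)"] by (simp add: mult_nonneg_nonpos)
  qed simp
  then show "0 \<le> policy_entropy \<pi> s"
    unfolding policy_entropy_def by (simp add: sum_nonpos)
  show "policy_entropy \<pi> s \<le> ln (real CARD('a))"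
    using Gibbs_variational[of 1 "\<lambda>a. \<pi> $ (s, a)" "\<lambda>_. 0"] assms
    by (simp add: policy_entropy_def is_policy_def log_sum_exp_def)
qed

lemma norm_policy_avg_policy_diff_le:
  fixes h :: "'s::finite \<times> 'a::finite \<Rightarrow> 'v::real_normed_vector"
  assumes "\<And>z. norm (h z) \<le> B"
  shows "norm (policy_avg \<pi> h s - policy_avg \<pi>' h s) \<le> real CARD('a) * (B * norm (\<pi> - \<pi>'))"
proof -
  have "0 \<le> B" using assms[of undefined] norm_ge_zero order_trans by blast
  have "norm (policy_avg \<pi> h s - policy_avg \<pi>' h s) =
      norm ((\<Sum>a\<in>UNIV. (\<pi> - \<pi>') $ (s, a) *\<^sub>R h (s, a)))"
    by (intro arg_cong[where f = norm]) (simp add: policy_avg_def sum_subtractf[symmetric] scaleR_left_diff_distrib)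
  also have "\<dots> \<le> (\<Sum>a\<in>(UNIV::'a set). B * norm (\<pi> - \<pi>'))"
  proof (rule sum_norm_le)
    fix a :: 'a
    have "norm ((\<pi> - \<pi>') $ (s, a) *\<^sub>R h (s, a)) \<le> norm (\<pi> - \<pi>') * B"
      unfolding norm_scaleR
      by (intro mult_mono component_le_norm_cart assms) auto
    then show "norm ((\<pi> - \<pi>') $ (s, a) *\<^sub>R h (s, a)) \<le> B * norm (\<pi> - \<pi>')"
      by (simp add: mult.commute)
  qed
  finally show ?thesis by simp
qed

context bilevel_problem
begin

text \<open>The follower's policy has no entry below this number, because \<open>soft_q\<close> is bounded.\<close>

definition policy_floor :: real where
  "policy_floor = exp (- (2 * q_bound + \<kappa> * ln (real CARD('a))) / \<kappa>)"

lemma policy_floor_le: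
  assumes "\<xi> \<in> space \<Xi>" shows "policy_floor \<le> follower x \<xi> $ z"
proof -
  obtain s a where z: "z = (s, a)" by fastforce
  have "\<forall>a. \<bar>soft_q \<gamma> \<kappa> (M x \<xi>) (s, a)\<bar> \<le> q_bound"
    using soft_q_bounded[OF assms] by blast
  from softmax_ge[OF \<kappa>_pos this, of a] show ?thesis
    by (simp add: policy_floor_def z soft_policy_nth)
qed

definition entropy_slope :: real where
  "entropy_slope = real CARD('a) * (1 + 1 / policy_floor + \<bar>ln policy_floor\<bar>)"

lemma entropy_Lipschitz_at_follower:
  assumes \<xi>: "\<xi> \<in> space \<Xi>" and \<pi>: "is_policy \<pi>"
  shows "\<bar>policy_entropy \<pi> s - policy_entropy (follower x \<xi>) s\<bar> \<le> entropy_slope * norm (\<pi> - follower x \<xi>)"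
proof -
  let ?\<pi> = "follower x \<xi>"
  let ?c = "1 + 1 / policy_floor + \<bar>ln policy_floor\<bar>"
  have "0 < policy_floor" by (simp add: policy_floor_def)
  then have c: "0 \<le> ?c" by simp
  have "policy_entropy \<pi> s - policy_entropy ?\<pi> s =
      - (\<Sum>a\<in>UNIV. \<pi> $ (s, a) * ln (\<pi> $ (s, a)) - ?\<pi> $ (s, a) * ln (?\<pi> $ (s, a)))"
    by (simp add: policy_entropy_def sum_subtractf)
  also have "\<bar>\<dots>\<bar> \<le> (\<Sum>a\<in>UNIV. \<bar>\<pi> $ (s, a) * ln (\<pi> $ (s, a)) - ?\<pi> $ (s, a) * ln (?\<pi> $ (s, a))\<bar>)"
    unfolding abs_minus_cancel by (rule sum_abs)
  also have "\<dots> \<le> (\<Sum>a\<in>(UNIV::'a set). ?c * norm (\<pi> - ?\<pi>))"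
  proof (rule sum_mono)
    fix a
    have "\<bar>\<pi> $ (s, a) * ln (\<pi> $ (s, a)) - ?\<pi> $ (s, a) * ln (?\<pi> $ (s, a))\<bar> \<le> ?c * \<bar>\<pi> $ (s, a) - ?\<pi> $ (s, a)\<bar>"
      by (intro xlogx_Lipschitz_at_interior \<open>0 < policy_floor\<close> policy_floor_le \<xi>
          policy_nth_bounds \<pi> is_policy_soft_policy)
    also have "\<dots> \<le> ?c * norm (\<pi> - ?\<pi>)"
      using component_le_norm_cart[of "\<pi> - ?\<pi>" "(s, a)"] by (intro mult_left_mono c) simp
    finally show "\<bar>\<pi> $ (s, a) * ln (\<pi> $ (s, a)) - ?\<pi> $ (s, a) * ln (?\<pi> $ (s, a))\<bar> \<le> ?c * norm (\<pi> - ?\<pi>)" .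
  qed
  also have "\<dots> = entropy_slope * norm (\<pi> - ?\<pi>)"
    by (simp add: entropy_slope_def)
  finally show ?thesis .
qed

lemma value_fn_follower: "value_fn \<gamma> \<kappa> (M x \<xi>) (follower x \<xi>) = soft_v \<gamma> \<kappa> (M x \<xi>)"
  by (rule ext) (rule value_fn_soft_policy[OF \<gamma>_nonneg \<gamma>_less \<kappa>_pos])

definition value_slope :: real where
  "value_slope = (real CARD('a) * q_bound + \<kappa> * entropy_slope) / (1 - \<gamma>)"

text \<open>The difference of the two values is \<open>\<gamma>\<close> times an average of itself plus the effects of
  exchanging the policy in the average of \<open>soft_q\<close> and in the entropy.\<close>

lemma value_Lipschitz_at_follower:
  assumes \<xi>: "\<xi> \<in> space \<Xi>" and \<pi>: "is_policy \<pi>"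
  shows "\<bar>value_fn \<gamma> \<kappa> (M x \<xi>) \<pi> s - soft_v \<gamma> \<kappa> (M x \<xi>) s\<bar> \<le> value_slope * norm (\<pi> - follower x \<xi>)"
proof -
  let ?m = "M x \<xi>" and ?\<pi> = "follower x \<xi>"
  let ?V = "value_fn \<gamma> \<kappa> ?m \<pi>" and ?v = "soft_v \<gamma> \<kappa> ?m" and ?q = "soft_q \<gamma> \<kappa> ?m"
  let ?n = "norm (\<pi> - ?\<pi>)"
  note \<pi>' = is_policy_soft_policy[of \<gamma> \<kappa> ?m]
  have "\<bar>?V s - ?v s\<bar> \<le> (real CARD('a) * (q_bound * ?n) + \<kappa> * (entropy_slope * ?n)) / (1 - \<gamma>)"
  proof (rule sup_self_bound[where e = "\<lambda>s. \<bar>?V s - ?v s\<bar>", OF \<gamma>_less])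
    fix c s assume c: "\<And>s. \<bar>?V s - ?v s\<bar> \<le> c"
    have "norm (policy_avg \<pi> (trans_avg ?m (\<lambda>s. ?V s - ?v s)) s) \<le> c"
      by (intro norm_policy_avg_le norm_trans_avg_le \<pi>) (use c in simp)
    then have 1: "\<gamma> * \<bar>policy_avg \<pi> (trans_avg ?m (\<lambda>s. ?V s - ?v s)) s\<bar> \<le> \<gamma> * c"
      by (intro mult_left_mono \<gamma>_nonneg) simp
    have 2: "\<bar>policy_avg \<pi> ?q s - policy_avg ?\<pi> ?q s\<bar> \<le> real CARD('a) * (q_bound * ?n)"
      using norm_policy_avg_policy_diff_le[of ?q q_bound \<pi> s ?\<pi>] soft_q_bounded[OF \<xi>] by simp
    have 3: "\<kappa> * \<bar>policy_entropy \<pi> s - policy_entropy ?\<pi> s\<bar> \<le> \<kappa> * (entropy_slope * ?n)"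
      using \<kappa>_pos by (intro mult_left_mono entropy_Lipschitz_at_follower \<xi> \<pi>) auto
    have "?V s = policy_avg \<pi> (\<lambda>z. reward ?m (fst z) (snd z)) s + \<kappa> * policy_entropy \<pi> s
        + \<gamma> * policy_avg \<pi> (trans_avg ?m ?V) s"
      by (subst value_fn_Bellman[OF \<gamma>_nonneg \<gamma>_less \<pi>])
         (simp add: reg_reward_def[abs_def] policy_avg_add policy_avg_mult
          policy_avg_state[OF \<pi>, where g = "policy_entropy \<pi>"])
    moreover have "?v s = policy_avg ?\<pi> (\<lambda>z. reward ?m (fst z) (snd z)) s + \<kappa> * policy_entropy ?\<pi> s
        + \<gamma> * policy_avg ?\<pi> (trans_avg ?m ?v) s"
      using value_fn_Bellman[OF \<gamma>_nonneg \<gamma>_less \<pi>', of \<kappa> ?m s]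
      by (simp add: value_fn_follower reg_reward_def[abs_def]
          policy_avg_add policy_avg_mult policy_avg_state[OF \<pi>', where g = "policy_entropy ?\<pi>"])
    moreover have q: "policy_avg p ?q s = policy_avg p (\<lambda>z. reward ?m (fst z) (snd z)) s
        + \<gamma> * policy_avg p (trans_avg ?m ?v) s" for p
      by (subst soft_q_fixpoint[OF \<gamma>_nonneg \<gamma>_less \<kappa>_pos, abs_def]) (simp add: policy_avg_add policy_avg_mult)
    moreover have "\<gamma> * policy_avg \<pi> (trans_avg ?m (\<lambda>s. ?V s - ?v s)) s
        = \<gamma> * policy_avg \<pi> (trans_avg ?m ?V) s - \<gamma> * policy_avg \<pi> (trans_avg ?m ?v) s"
      by (subst trans_avg_diff[abs_def]) (simp add: policy_avg_diff right_diff_distrib)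
    ultimately have "?V s - ?v s = \<gamma> * policy_avg \<pi> (trans_avg ?m (\<lambda>s. ?V s - ?v s)) s
        + (policy_avg \<pi> ?q s - policy_avg ?\<pi> ?q s) + \<kappa> * (policy_entropy \<pi> s - policy_entropy ?\<pi> s)"
      by (simp add: algebra_simps)
    then have "\<bar>?V s - ?v s\<bar> \<le> \<gamma> * \<bar>policy_avg \<pi> (trans_avg ?m (\<lambda>s. ?V s - ?v s)) s\<bar>
        + \<bar>policy_avg \<pi> ?q s - policy_avg ?\<pi> ?q s\<bar> + \<kappa> * \<bar>policy_entropy \<pi> s - policy_entropy ?\<pi> s\<bar>"
      using \<kappa>_pos \<gamma>_nonneg by (auto intro!: order_trans[OF abs_triangle_ineq] add_mono simp: abs_mult)
    with 1 2 3 show "\<bar>?V s - ?v s\<bar> \<le> real CARD('a) * (q_bound * ?n) + \<kappa> * (entropy_slope * ?n) + \<gamma> * c"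
      by linarith
  qed
  also have "\<dots> = value_slope * ?n"
    by (simp add: value_slope_def algebra_simps)
  finally show ?thesis .
qed

lemma sum_grad_trans_le:
  assumes \<xi>: "\<xi> \<in> space \<Xi>" and w: "\<And>s. \<bar>w s\<bar> \<le> B"
  shows "norm (\<Sum>s'\<in>UNIV. w s' *\<^sub>R grad_trans x \<xi> s a s') \<le> real CARD('s) * (B * log_trans_slope)"
proof -
  have "0 \<le> B" using w[of undefined] by linarith
  have "norm (\<Sum>s'\<in>UNIV. w s' *\<^sub>R grad_trans x \<xi> s a s') \<le> (\<Sum>s'\<in>(UNIV::'s set). B * log_trans_slope)"
    by (intro sum_norm_le) (simp add: mult_mono[OF w norm_grad_trans_le_slope[OF \<xi>] \<open>0 \<le> B\<close>])
  then show ?thesis by simp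
qed

definition grad_q_bound :: real where
  "grad_q_bound = (reward_slope + \<gamma> * (real CARD('s) * (v_bound * log_trans_slope))) / (1 - \<gamma>)"

lemma grad_q_bound_nonneg: "0 \<le> grad_q_bound"
  using \<gamma>_less \<gamma>_pos slopes_nonneg bounds_nonneg by (simp add: grad_q_bound_def)

lemma norm_grad_q_follower_le:
  assumes \<xi>: "\<xi> \<in> space \<Xi>"
  shows "norm (grad_q x \<xi> (follower x \<xi>) z) \<le> grad_q_bound"
  unfolding grad_q_bound_def
proof (rule sup_self_bound[where e = "\<lambda>z. norm (grad_q x \<xi> (follower x \<xi>) z)", OF \<gamma>_less])
  let ?\<pi> = "follower x \<xi>"
  let ?D = "grad_q x \<xi> ?\<pi>"
  note \<pi> = is_policy_soft_policy[of \<gamma> \<kappa> "M x \<xi>"]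
  fix c z assume c: "\<And>z. norm (?D z) \<le> c"
  let ?S = "\<Sum>s\<in>UNIV. value_fn \<gamma> \<kappa> (M x \<xi>) ?\<pi> s *\<^sub>R grad_trans x \<xi> (fst z) (snd z) s"
  let ?T = "trans_avg (M x \<xi>) (policy_avg ?\<pi> ?D) z"
  have "norm (?S + ?T) \<le> real CARD('s) * (v_bound * log_trans_slope) + c"
  proof (intro order_trans[OF norm_triangle_ineq] add_mono)
    show "norm ?S \<le> real CARD('s) * (v_bound * log_trans_slope)"
      by (intro sum_grad_trans_le \<xi>)
         (simp add: value_fn_soft_policy[OF \<gamma>_nonneg \<gamma>_less \<kappa>_pos] soft_v_bounded[OF \<xi>])
    show "norm ?T \<le> c"
      by (intro norm_trans_avg_le norm_policy_avg_le \<pi> c)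
  qed
  then have "\<gamma> * norm (?S + ?T) \<le> \<gamma> * (real CARD('s) * (v_bound * log_trans_slope) + c)"
    by (intro mult_left_mono \<gamma>_nonneg)
  moreover have "norm (?D z) \<le> norm (grad_reward M x \<xi> (fst z) (snd z)) + \<gamma> * norm (?S + ?T)"
    using norm_triangle_ineq[of "grad_reward M x \<xi> (fst z) (snd z)" "\<gamma> *\<^sub>R (?S + ?T)"] \<gamma>_nonneg
    unfolding grad_q_fixpoint[OF \<pi>, of x \<xi> z, symmetric] by simp
  ultimately show "norm (?D z) \<le> reward_slope + \<gamma> * (real CARD('s) * (v_bound * log_trans_slope)) + \<gamma> * c"
    using norm_grad_reward_le[OF \<xi>, of x "fst z" "snd z"] by (simp add: algebra_simps)
qed

definition grad_q_slope :: real where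
  "grad_q_slope = (\<gamma> * (real CARD('s) * (value_slope * log_trans_slope) + real CARD('a) * grad_q_bound)) / (1 - \<gamma>)"

lemma grad_q_Lipschitz_at_follower:
  assumes \<xi>: "\<xi> \<in> space \<Xi>" and \<pi>: "is_policy \<pi>"
  shows "norm (grad_q x \<xi> \<pi> z - grad_q x \<xi> (follower x \<xi>) z) \<le> grad_q_slope * norm (\<pi> - follower x \<xi>)"
proof -
  let ?m = "M x \<xi>" and ?\<pi> = "follower x \<xi>"
  let ?D = "grad_q x \<xi> \<pi>" and ?D' = "grad_q x \<xi> ?\<pi>"
  let ?n = "norm (\<pi> - ?\<pi>)"
  note \<pi>' = is_policy_soft_policy[of \<gamma> \<kappa> ?m]
  have "norm (?D z - ?D' z) \<le>
      (\<gamma> * (real CARD('s) * (value_slope * ?n * log_trans_slope) + real CARD('a) * (grad_q_bound * ?n))) / (1 - \<gamma>)"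
  proof (rule sup_self_bound[where e = "\<lambda>z. norm (?D z - ?D' z)", OF \<gamma>_less])
    fix c z assume c: "\<And>z. norm (?D z - ?D' z) \<le> c"
    let ?S = "\<Sum>s\<in>UNIV. (value_fn \<gamma> \<kappa> ?m \<pi> s - soft_v \<gamma> \<kappa> ?m s) *\<^sub>R grad_trans x \<xi> (fst z) (snd z) s"
    let ?T = "trans_avg ?m (policy_avg \<pi> (\<lambda>z. ?D z - ?D' z)) z"
    let ?U = "trans_avg ?m (\<lambda>s. policy_avg \<pi> ?D' s - policy_avg ?\<pi> ?D' s) z"
    have S: "norm ?S \<le> real CARD('s) * (value_slope * ?n * log_trans_slope)"
      by (intro sum_grad_trans_le \<xi> value_Lipschitz_at_follower \<pi>)
    have T: "norm ?T \<le> c"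
      by (intro norm_trans_avg_le norm_policy_avg_le \<pi> c)
    have U: "norm ?U \<le> real CARD('a) * (grad_q_bound * ?n)"
      by (intro norm_trans_avg_le norm_policy_avg_policy_diff_le norm_grad_q_follower_le \<xi>)
    have "policy_avg \<pi> (\<lambda>z. ?D z - ?D' z) = (\<lambda>s. policy_avg \<pi> ?D s - policy_avg \<pi> ?D' s)"
      by (rule ext) (rule policy_avg_diff)
    then have "?D z - ?D' z = \<gamma> *\<^sub>R (?S + ?T + ?U)"
      by (subst grad_q_fixpoint[OF \<pi>], subst grad_q_fixpoint[OF \<pi>'])
         (simp add: value_fn_soft_policy[OF \<gamma>_nonneg \<gamma>_less \<kappa>_pos] trans_avg_diff
          scaleR_left_diff_distrib sum_subtractf scaleR_diff_right scaleR_add_right)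
    then have "norm (?D z - ?D' z) = \<gamma> * norm (?S + ?T + ?U)"
      using \<gamma>_nonneg by simp
    also have "\<dots> \<le> \<gamma> * (real CARD('s) * (value_slope * ?n * log_trans_slope) + c + real CARD('a) * (grad_q_bound * ?n))"
      using S T U
      by (intro mult_left_mono \<gamma>_nonneg order_trans[OF norm_triangle_ineq] add_mono) auto
    finally show "norm (?D z - ?D' z) \<le> \<gamma> * (real CARD('s) * (value_slope * ?n * log_trans_slope)
        + real CARD('a) * (grad_q_bound * ?n)) + \<gamma> * c"
      by (simp add: algebra_simps)
  qed
  also have "\<dots> = grad_q_slope * ?n"
    by (simp add: grad_q_slope_def algebra_simps)
  finally show ?thesis .
qed

lemma norm_grad_policy_follower_le:
  assumes \<xi>: "\<xi> \<in> space \<Xi>"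
  shows "norm (grad_policy x \<xi> (follower x \<xi>) z) \<le> 2 * grad_q_bound / \<kappa>"
proof -
  let ?\<pi> = "follower x \<xi>"
  note \<pi> = is_policy_soft_policy[of \<gamma> \<kappa> "M x \<xi>"]
  have "norm (grad_q x \<xi> ?\<pi> z - policy_avg ?\<pi> (grad_q x \<xi> ?\<pi>) (fst z)) \<le> grad_q_bound + grad_q_bound"
    by (intro order_trans[OF norm_triangle_ineq4] add_mono norm_policy_avg_le norm_grad_q_follower_le \<xi> \<pi>)
  then have "(?\<pi> $ z / \<kappa>) * norm (grad_q x \<xi> ?\<pi> z - policy_avg ?\<pi> (grad_q x \<xi> ?\<pi>) (fst z)) \<le> (1 / \<kappa>) * (2 * grad_q_bound)"
    using \<kappa>_pos policy_nth_bounds[OF \<pi>, of z] by (intro mult_mono divide_right_mono) auto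
  then show ?thesis
    using \<kappa>_pos policy_nth_bounds[OF \<pi>, of z] by (simp add: grad_policy_def)
qed

lemma grad_policy_Lipschitz_at_follower:
  assumes \<xi>: "\<xi> \<in> space \<Xi>" and \<pi>: "is_policy \<pi>"
  shows "norm (grad_policy x \<xi> \<pi> z - grad_policy x \<xi> (follower x \<xi>) z)
    \<le> (2 * grad_q_slope + real CARD('a) * grad_q_bound + 2 * grad_q_bound) / \<kappa> * norm (\<pi> - follower x \<xi>)"
proof -
  let ?\<pi> = "follower x \<xi>"
  let ?D = "grad_q x \<xi> \<pi>" and ?D' = "grad_q x \<xi> ?\<pi>"
  let ?n = "norm (\<pi> - ?\<pi>)"
  let ?X = "?D z - policy_avg \<pi> ?D (fst z)" and ?X' = "?D' z - policy_avg ?\<pi> ?D' (fst z)"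
  note \<pi>' = is_policy_soft_policy[of \<gamma> \<kappa> "M x \<xi>"]
  have "norm (?X - ?X') =
      norm ((?D z - ?D' z) - policy_avg \<pi> (\<lambda>z. ?D z - ?D' z) (fst z)
      - (policy_avg \<pi> ?D' (fst z) - policy_avg ?\<pi> ?D' (fst z)))"
    by (intro arg_cong[where f = norm]) (simp add: policy_avg_diff)
  also have "\<dots> \<le> (grad_q_slope * ?n + grad_q_slope * ?n) + real CARD('a) * (grad_q_bound * ?n)"
    by (intro order_trans[OF norm_triangle_ineq4] add_mono norm_policy_avg_le
        grad_q_Lipschitz_at_follower norm_policy_avg_policy_diff_le norm_grad_q_follower_le \<xi> \<pi>)
  finally have 1: "norm (?X - ?X') \<le> (2 * grad_q_slope + real CARD('a) * grad_q_bound) * ?n"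
    by (simp add: algebra_simps)
  have 2: "norm ?X' \<le> 2 * grad_q_bound"
    using order_trans[OF norm_triangle_ineq4 add_mono[OF norm_grad_q_follower_le[OF \<xi>]
          norm_policy_avg_le[OF \<pi>' norm_grad_q_follower_le[OF \<xi>]]]] by simp
  have "norm (grad_policy x \<xi> \<pi> z - grad_policy x \<xi> ?\<pi> z) =
      norm ((1 / \<kappa>) *\<^sub>R (\<pi> $ z *\<^sub>R (?X - ?X') + (\<pi> - ?\<pi>) $ z *\<^sub>R ?X'))"
    by (intro arg_cong[where f = norm]) (simp add: grad_policy_def algebra_simps)
  also have "\<dots> \<le> 1 / \<kappa> * (1 * ((2 * grad_q_slope + real CARD('a) * grad_q_bound) * ?n) + ?n * (2 * grad_q_bound))"
    using \<kappa>_pos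
  proof (simp only: norm_scaleR, intro mult_mono order_trans[OF norm_triangle_ineq] add_mono)
    show "norm (\<pi> $ z *\<^sub>R (?X - ?X')) \<le> 1 * ((2 * grad_q_slope + real CARD('a) * grad_q_bound) * ?n)"
      unfolding norm_scaleR using policy_nth_bounds[OF \<pi>, of z] by (intro mult_mono 1) auto
    show "norm ((\<pi> - ?\<pi>) $ z *\<^sub>R ?X') \<le> ?n * (2 * grad_q_bound)"
      unfolding norm_scaleR by (intro mult_mono 2 component_le_norm_cart) auto
  qed auto
  also have "\<dots> = (2 * grad_q_slope + real CARD('a) * grad_q_bound + 2 * grad_q_bound) / \<kappa> * ?n"
    using \<kappa>_pos by (simp add: field_simps)
  finally show ?thesis .
qed

text \<open>One of the two policies is the follower's because the entropy has a Lipschitz bound only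
  relative to it.\<close>

lemma hypergradient_Lipschitz_at_follower:
  "\<exists>B\<ge>0. \<forall>\<xi>\<in>space \<Xi>. \<forall>x \<pi>. is_policy \<pi> \<longrightarrow>
     norm (hypergradient x \<xi> \<pi> - hypergradient x \<xi> (follower x \<xi>)) \<le> B * norm (\<pi> - follower x \<xi>)"
proof -
  define G where "G = (2 * grad_q_slope + real CARD('a) * grad_q_bound + 2 * grad_q_bound) / \<kappa>"
  define B where "B = loss_smoothness + real CARD('s \<times> 'a) * (\<bar>L\<bar> * G + loss_smoothness * (2 * grad_q_bound / \<kappa>))"
  have "norm (hypergradient x \<xi> \<pi> - hypergradient x \<xi> (follower x \<xi>)) \<le> B * norm (\<pi> - follower x \<xi>)"
    if \<xi>: "\<xi> \<in> space \<Xi>" and \<pi>: "is_policy \<pi>" for \<xi> x \<pi>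
  proof -
    let ?\<pi> = "follower x \<xi>"
    let ?n = "norm (\<pi> - ?\<pi>)"
    let ?g = "gradient (\<lambda>p. f x p \<xi>) \<pi>" and ?g' = "gradient (\<lambda>p. f x p \<xi>) ?\<pi>"
    note \<pi>' = is_policy_soft_policy[of \<gamma> \<kappa> "M x \<xi>"]
    have 1: "norm (gradient (\<lambda>y. f y \<pi> \<xi>) x - gradient (\<lambda>y. f y ?\<pi> \<xi>) x) \<le> loss_smoothness * ?n"
      using loss_gradients_Lipschitz(1)[OF \<xi> \<pi> \<pi>', of x x] by simp
    have 2: "norm (?g $ z *\<^sub>R grad_policy x \<xi> \<pi> z - ?g' $ z *\<^sub>R grad_policy x \<xi> ?\<pi> z)
        \<le> (\<bar>L\<bar> * G + loss_smoothness * (2 * grad_q_bound / \<kappa>)) * ?n" for z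
    proof -
      have "\<bar>?g $ z\<bar> \<le> \<bar>L\<bar>"
        using component_le_norm_cart[of ?g z] loss_gradients_bounded(2)[OF \<xi> \<pi>, of x] by linarith
      then have a: "norm (?g $ z *\<^sub>R (grad_policy x \<xi> \<pi> z - grad_policy x \<xi> ?\<pi> z)) \<le> \<bar>L\<bar> * (G * ?n)"
        unfolding norm_scaleR G_def by (intro mult_mono grad_policy_Lipschitz_at_follower \<xi> \<pi>) auto
      have "\<bar>(?g - ?g') $ z\<bar> \<le> loss_smoothness * ?n"
        using component_le_norm_cart[of "?g - ?g'" z] loss_gradients_Lipschitz(2)[OF \<xi> \<pi> \<pi>', of x x] by simp
      then have b: "norm ((?g - ?g') $ z *\<^sub>R grad_policy x \<xi> ?\<pi> z) \<le> (loss_smoothness * ?n) * (2 * grad_q_bound / \<kappa>)"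
        unfolding norm_scaleR using loss_smoothness_nonneg
        by (intro mult_mono norm_grad_policy_follower_le \<xi>) auto
      have "norm (?g $ z *\<^sub>R grad_policy x \<xi> \<pi> z - ?g' $ z *\<^sub>R grad_policy x \<xi> ?\<pi> z) =
      norm (?g $ z *\<^sub>R (grad_policy x \<xi> \<pi> z - grad_policy x \<xi> ?\<pi> z) + (?g - ?g') $ z *\<^sub>R grad_policy x \<xi> ?\<pi> z)"
        by (intro arg_cong[where f = norm]) (simp add: algebra_simps)
      also have "\<dots> \<le> \<bar>L\<bar> * (G * ?n) + (loss_smoothness * ?n) * (2 * grad_q_bound / \<kappa>)"
        by (intro order_trans[OF norm_triangle_ineq] add_mono a b)
      finally show ?thesis by (simp add: algebra_simps)
    qed
    have "norm (hypergradient x \<xi> \<pi> - hypergradient x \<xi> ?\<pi>) =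
      norm ((gradient (\<lambda>y. f y \<pi> \<xi>) x - gradient (\<lambda>y. f y ?\<pi> \<xi>) x)
        + (\<Sum>z\<in>UNIV. ?g $ z *\<^sub>R grad_policy x \<xi> \<pi> z - ?g' $ z *\<^sub>R grad_policy x \<xi> ?\<pi> z))"
      by (intro arg_cong[where f = norm]) (simp add: hypergradient_def sum_subtractf)
    also have "\<dots> \<le> loss_smoothness * ?n
        + (\<Sum>z\<in>(UNIV::('s \<times> 'a) set). (\<bar>L\<bar> * G + loss_smoothness * (2 * grad_q_bound / \<kappa>)) * ?n)"
      by (intro order_trans[OF norm_triangle_ineq] add_mono sum_norm_le 1 2)
    also have "\<dots> = B * ?n"
      by (simp add: B_def distrib_right)
    finally show ?thesis .
  qed
  then have "\<forall>\<xi>\<in>space \<Xi>. \<forall>x \<pi>. is_policy \<pi> \<longrightarrow>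
     norm (hypergradient x \<xi> \<pi> - hypergradient x \<xi> (follower x \<xi>)) \<le> max 0 B * norm (\<pi> - follower x \<xi>)"
    by (meson max.cobounded2 mult_right_mono norm_ge_zero order_trans)
  then show ?thesis
    by (intro exI[of _ "max 0 B"]) simp
qed

lemma hypergradient_follower_bounded:
  "\<exists>B\<ge>0. \<forall>\<xi>\<in>space \<Xi>. \<forall>x. norm (hypergradient x \<xi> (follower x \<xi>)) \<le> B"
proof (intro exI conjI ballI allI)
  let ?B = "\<bar>L\<bar> + (\<Sum>z\<in>(UNIV::('s \<times> 'a) set). \<bar>L\<bar> * (2 * grad_q_bound / \<kappa>))"
  show "0 \<le> ?B"
    using grad_q_bound_nonneg \<kappa>_pos by (intro add_nonneg_nonneg sum_nonneg) auto
  fix \<xi> x assume \<xi>: "\<xi> \<in> space \<Xi>"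
  let ?\<pi> = "follower x \<xi>"
  let ?g = "gradient (\<lambda>p. f x p \<xi>) ?\<pi>"
  note \<pi> = is_policy_soft_policy[of \<gamma> \<kappa> "M x \<xi>"]
  have "norm (?g $ z *\<^sub>R grad_policy x \<xi> ?\<pi> z) \<le> \<bar>L\<bar> * (2 * grad_q_bound / \<kappa>)" for z
  proof -
    have "\<bar>?g $ z\<bar> \<le> \<bar>L\<bar>"
      using component_le_norm_cart[of ?g z] loss_gradients_bounded(2)[OF \<xi> \<pi>, of x] by linarith
    then show ?thesis
      unfolding norm_scaleR by (intro mult_mono norm_grad_policy_follower_le \<xi>) auto
  qed
  then show "norm (hypergradient x \<xi> ?\<pi>) \<le> ?B"
    unfolding hypergradient_def
    by (intro order_trans[OF norm_triangle_ineq] add_mono loss_gradients_bounded(1) \<xi> \<pi> sum_norm_le)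
qed

end

section \<open>The gradient estimator\<close>

lemma nn_integral_pmf_le:
  assumes "\<And>x. x \<in> set_pmf p \<Longrightarrow> h x \<le> c"
  shows "(\<integral>\<^sup>+x. h x \<partial>measure_pmf p) \<le> c"
proof -
  have "(\<integral>\<^sup>+x. h x \<partial>measure_pmf p) \<le> (\<integral>\<^sup>+x. c \<partial>measure_pmf p)"
    by (intro nn_integral_mono_AE) (use assms in \<open>auto simp: AE_measure_pmf_iff\<close>)
  then show ?thesis by simp
qed

lemma integrable_inner_of_second_moment:
  fixes p :: "('v::euclidean_space) pmf"
  assumes "(\<integral>\<^sup>+g. ennreal ((norm g)\<^sup>2) \<partial>measure_pmf p) \<le> ennreal G"
  shows "integrable (measure_pmf p) (\<lambda>g. inner v g)"
proof (rule integrableI_bounded)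
  have "\<bar>inner v g\<bar> \<le> norm v * (1 + (norm g)\<^sup>2)" for g
  proof -
    have "norm g \<le> 1 + (norm g)\<^sup>2"
      using zero_le_power2[of "norm g - 1/2"] by (simp add: power2_eq_square algebra_simps)
    then show ?thesis
      by (intro order_trans[OF Cauchy_Schwarz_ineq2] mult_left_mono) auto
  qed
  then have "(\<integral>\<^sup>+g. ennreal (norm (inner v g)) \<partial>measure_pmf p)
      \<le> (\<integral>\<^sup>+g. ennreal (norm v) * (1 + ennreal ((norm g)\<^sup>2)) \<partial>measure_pmf p)"
    by (intro nn_integral_mono)
       (simp add: ennreal_mult[symmetric] ennreal_1[symmetric] ennreal_plus[symmetric] ennreal_leI
          del: ennreal_1 ennreal_plus)
  also have "\<dots> = ennreal (norm v) * (1 + (\<integral>\<^sup>+g. ennreal ((norm g)\<^sup>2) \<partial>measure_pmf p))"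
    by (simp add: nn_integral_cmult nn_integral_add)
  also have "\<dots> < \<infinity>"
    using le_less_trans[OF assms ennreal_less_top] by (simp add: ennreal_mult_less_top)
  finally show "(\<integral>\<^sup>+g. ennreal (norm (inner v g)) \<partial>measure_pmf p) < \<infinity>" .
qed simp

lemma expectation_affine_finite:
  fixes g :: "'b \<Rightarrow> real"
  assumes "finite (set_pmf p)"
  shows "measure_pmf.expectation p (\<lambda>\<tau>. a + c * g \<tau>) = a + c * measure_pmf.expectation p g"
  using integrable_measure_pmf_finite[OF assms, of g] by simp

lemma integral_trans_policy_avg:
  fixes h :: "'n \<Rightarrow> 's::finite \<times> 'a::finite \<Rightarrow> real"
  assumes "\<And>z. integrable N (\<lambda>n. h n z)"
  shows "(\<integral>n. trans_avg m (policy_avg \<pi> (h n)) z \<partial>N) = trans_avg m (policy_avg \<pi> (\<lambda>z. \<integral>n. h n z \<partial>N)) z"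
    and "integrable N (\<lambda>n. trans_avg m (policy_avg \<pi> (h n)) z)"
  using assms by (simp_all add: trans_avg_def policy_avg_def)

text \<open>The series is dominated by the second formal derivative of the geometric series.\<close>

lemma integrable_geometric_square:
  assumes "0 < p" "p < 1"
  shows "integrable (geometric_pmf p) (\<lambda>n. (real n + 1)\<^sup>2)"
proof -
  let ?q = "1 - p"
  have q: "0 \<le> ?q" "?q < 1" using assms by auto
  define K where "K = (1 + ?q) / 2"
  have K: "?q < K" "K < 1" using q by (auto simp: K_def)
  have 1: "summable (\<lambda>n. diffs (\<lambda>_. 1) n * x ^ n)" if "norm x < 1" for x :: real
    using that by (intro termdiff_converges[of x 1]) (auto intro: summable_geometric)
  have 2: "summable (\<lambda>n. diffs (diffs (\<lambda>_. 1)) n * ?q ^ n)"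
    using q by (intro termdiff_converges[of ?q 1] 1) auto
  have "summable (\<lambda>n. (real n + 1)\<^sup>2 * ?q ^ n)"
  proof (rule summable_comparison_test'[OF 2])
    fix n
    have "(real n + 1)\<^sup>2 * ?q ^ n \<le> (real n + 1) * (real n + 2) * ?q ^ n"
      using q by (intro mult_right_mono) (auto simp: power2_eq_square algebra_simps)
    then show "norm ((real n + 1)\<^sup>2 * ?q ^ n) \<le> diffs (diffs (\<lambda>_. 1)) n * ?q ^ n"
      using q by (simp add: diffs_def mult_ac add_ac)
  qed
  then have "summable (\<lambda>n. (real n + 1)\<^sup>2 * ?q ^ n * p)"
    by (rule summable_mult2)
  then have "summable (\<lambda>n. pmf (geometric_pmf p) n * (real n + 1)\<^sup>2)"
    using assms by (simp add: mult_ac)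
  then have "integrable (count_space UNIV) (\<lambda>n. pmf (geometric_pmf p) n * (real n + 1)\<^sup>2)"
    by (simp add: integrable_count_space_nat_iff abs_mult)
  then show ?thesis
    unfolding measure_pmf_eq_density by (subst integrable_density) auto
qed

lemma finite_set_trajectory_pmf: "finite (set_pmf (trajectory_pmf m \<pi> n z))"
  by (induction n arbitrary: z) auto

lemma trajectory_head: "\<tau> \<in> set_pmf (trajectory_pmf m \<pi> n z) \<Longrightarrow> \<tau> ! 0 = z"
  by (cases n) auto

text \<open>A sampled path uses transitions of positive probability only, and there the logarithmic gradients are
  bounded.\<close>

lemma trajectory_transition_pos:
  assumes "\<tau> \<in> set_pmf (trajectory_pmf m \<pi> n z)" "t < n"
  shows "0 < pmf (trans m (fst (\<tau> ! t)) (snd (\<tau> ! t))) (fst (\<tau> ! (t + 1)))"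
  using assms
proof (induction n arbitrary: z \<tau> t)
  case (Suc n)
  then obtain z' \<tau>' where z': "z' \<in> set_pmf (step_pmf m \<pi> z)"
    and \<tau>': "\<tau>' \<in> set_pmf (trajectory_pmf m \<pi> n z')" and \<tau>: "\<tau> = z # \<tau>'"
    by auto
  show ?case
  proof (cases t)
    case 0
    have "fst z' \<in> set_pmf (trans m (fst z) (snd z))"
      using z' by (auto simp: step_pmf_def start_pmf_def)
    then show ?thesis
      using trajectory_head[OF \<tau>'] by (simp add: \<tau> 0 pmf_positive)
  next
    case (Suc t')
    then show ?thesis
      using Suc.IH[OF \<tau>', of t'] Suc.prems(2) by (simp add: \<tau>)
  qed
qed simp

lemma expectation_trajectory_Suc:
  fixes h :: "('s::finite \<times> 'a::finite) list \<Rightarrow> real"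
  assumes "is_policy \<pi>"
  shows "measure_pmf.expectation (trajectory_pmf m \<pi> (Suc n) z) h =
    trans_avg m (policy_avg \<pi> (\<lambda>z'. measure_pmf.expectation (trajectory_pmf m \<pi> n z') (\<lambda>\<tau>. h (z # \<tau>)))) z"
proof -
  have "measure_pmf.expectation (trajectory_pmf m \<pi> (Suc n) z) h =
      (\<Sum>z'\<in>UNIV. pmf (step_pmf m \<pi> z) z' *\<^sub>R
        measure_pmf.expectation (map_pmf (Cons z) (trajectory_pmf m \<pi> n z')) h)"
    by (simp only: trajectory_pmf.simps)
       (rule pmf_expectation_bind, auto simp: finite_set_trajectory_pmf)
  also have "\<dots> = measure_pmf.expectation (step_pmf m \<pi> z)
      (\<lambda>z'. measure_pmf.expectation (trajectory_pmf m \<pi> n z') (\<lambda>\<tau>. h (z # \<tau>)))"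
    by (simp add: expectation_finite_type[of "step_pmf m \<pi> z"])
  finally show ?thesis
    by (simp add: expectation_step_pmf[OF assms])
qed

context bilevel_problem
begin

text \<open>The probability with which the inner horizon continues, and at the same time the ratio of the explicit
  weights of the sampled rewards.\<close>

definition root_\<gamma> :: real where "root_\<gamma> = \<gamma> powr (1 / 2)"

lemma root_\<gamma>: "0 < root_\<gamma>" "root_\<gamma> < 1" "root_\<gamma> * root_\<gamma> = \<gamma>"
proof -
  show "0 < root_\<gamma>" using \<gamma>_pos by (simp add: root_\<gamma>_def)
  show "root_\<gamma> * root_\<gamma> = \<gamma>"
    using \<gamma>_pos by (simp add: root_\<gamma>_def powr_add[symmetric])
  have "\<gamma> powr (1 / 2) < 1 powr (1 / 2)"
    using \<gamma>_pos \<gamma>_less by (intro powr_less_mono2) auto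
  then show "root_\<gamma> < 1" by (simp add: root_\<gamma>_def)
qed

lemma root_\<gamma>_power: "\<gamma> powr (real j / 2) = root_\<gamma> ^ j"
proof -
  have "root_\<gamma> ^ j = root_\<gamma> powr real j"
    using root_\<gamma> by (simp add: powr_realpow)
  then show ?thesis by (simp add: root_\<gamma>_def powr_powr)
qed

definition reward_bound :: real where
  "reward_bound = \<bar>R\<bar> + \<kappa> * ln (real CARD('a))"

lemma reg_reward_bounded:
  assumes "\<xi> \<in> space \<Xi>" "is_policy \<pi>"
  shows "\<bar>reg_reward \<kappa> (M x \<xi>) \<pi> z\<bar> \<le> reward_bound"
proof -
  have "\<bar>\<kappa> * policy_entropy \<pi> (fst z)\<bar> \<le> \<kappa> * ln (real CARD('a))"
    using policy_entropy_bounds[OF assms(2), of "fst z"] \<kappa>_pos by (simp add: abs_mult mult_left_mono)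
  then show ?thesis
    using abs_reward_le[OF assms(1), of x "fst z" "snd z"]
    unfolding reg_reward_def reward_bound_def by linarith
qed

text \<open>The second sum of the estimator, which starts at position \<open>k = T + 1\<close>. The variable offset allows
  recursion along the path.\<close>

definition discounted_rewards ::
  "real ^ 'd \<Rightarrow> 'c \<Rightarrow> ('s, 'a) policy \<Rightarrow> nat \<Rightarrow> nat \<Rightarrow> ('s \<times> 'a) list \<Rightarrow> real" where
  "discounted_rewards x \<xi> \<pi> n k \<tau> = (\<Sum>j=0..n. root_\<gamma> ^ j * reg_reward \<kappa> (M x \<xi>) \<pi> (\<tau> ! (k + j)))"

lemma discounted_rewards_Suc_Cons:
  "discounted_rewards x \<xi> \<pi> (Suc n) 0 (z # \<tau>) =
     reg_reward \<kappa> (M x \<xi>) \<pi> z + root_\<gamma> * discounted_rewards x \<xi> \<pi> n 0 \<tau>"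
  unfolding discounted_rewards_def
  by (subst sum.atLeast0_atMost_Suc_shift) (simp add: sum_distrib_left mult_ac)

lemma discounted_rewards_Cons:
  "discounted_rewards x \<xi> \<pi> n (Suc k) (z # \<tau>) = discounted_rewards x \<xi> \<pi> n k \<tau>"
  by (simp add: discounted_rewards_def)

lemma discounted_rewards_bounded:
  assumes "\<xi> \<in> space \<Xi>" "is_policy \<pi>"
  shows "\<bar>discounted_rewards x \<xi> \<pi> n k \<tau>\<bar> \<le> reward_bound / (1 - root_\<gamma>)"
proof -
  have rb: "0 \<le> reward_bound"
    using ln_card_nonneg by (simp add: reward_bound_def)
  have "\<bar>discounted_rewards x \<xi> \<pi> n k \<tau>\<bar> \<le> (\<Sum>j=0..n. root_\<gamma> ^ j * reward_bound)"
    unfolding discounted_rewards_def using root_\<gamma>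
    by (intro order_trans[OF sum_abs] sum_mono) (simp add: abs_mult mult_left_mono reg_reward_bounded[OF assms])
  also have "\<dots> = (\<Sum>j<Suc n. root_\<gamma> ^ j) * reward_bound"
    by (simp add: sum_distrib_right atLeast0AtMost lessThan_Suc_atMost)
  also have "\<dots> = (1 - root_\<gamma> ^ Suc n) / (1 - root_\<gamma>) * reward_bound"
    using root_\<gamma> by (subst sum_gp_strict) auto
  also have "\<dots> \<le> 1 / (1 - root_\<gamma>) * reward_bound"
    using root_\<gamma> rb by (intro mult_right_mono divide_right_mono) auto
  finally show ?thesis by simp
qed

definition truncated_value :: "real ^ 'd \<Rightarrow> 'c \<Rightarrow> ('s, 'a) policy \<Rightarrow> nat \<Rightarrow> 's \<times> 'a \<Rightarrow> real" where
  "truncated_value x \<xi> \<pi> n z =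
     measure_pmf.expectation (trajectory_pmf (M x \<xi>) \<pi> n z) (discounted_rewards x \<xi> \<pi> n 0)"

lemma truncated_value_0: "truncated_value x \<xi> \<pi> 0 z = reg_reward \<kappa> (M x \<xi>) \<pi> z"
  by (simp add: truncated_value_def discounted_rewards_def)

lemma truncated_value_Suc:
  assumes \<pi>: "is_policy \<pi>"
  shows "truncated_value x \<xi> \<pi> (Suc n) z = reg_reward \<kappa> (M x \<xi>) \<pi> z
    + root_\<gamma> * trans_avg (M x \<xi>) (policy_avg \<pi> (truncated_value x \<xi> \<pi> n)) z"
  unfolding truncated_value_def expectation_trajectory_Suc[OF \<pi>] discounted_rewards_Suc_Cons
    expectation_affine_finite[OF finite_set_trajectory_pmf]
  by (simp add: policy_avg_add[abs_def] policy_avg_mult[abs_def] policy_avg_const[OF \<pi>] trans_avg_add trans_avg_const)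
     (simp add: trans_avg_def sum_distrib_left mult_ac)

lemma truncated_value_integrable:
  assumes "\<xi> \<in> space \<Xi>" "is_policy \<pi>"
  shows "integrable (measure_pmf p) (\<lambda>n. truncated_value x \<xi> \<pi> n z)"
proof (rule measure_pmf.integrable_const_bound)
  have "\<bar>truncated_value x \<xi> \<pi> n z\<bar> \<le> reward_bound / (1 - root_\<gamma>)" for n
  proof -
    have "\<bar>truncated_value x \<xi> \<pi> n z\<bar> \<le> measure_pmf.expectation (trajectory_pmf (M x \<xi>) \<pi> n z) (\<lambda>\<tau>. \<bar>discounted_rewards x \<xi> \<pi> n 0 \<tau>\<bar>)"
      unfolding truncated_value_def by (rule integral_abs_bound)
    also have "\<dots> \<le> reward_bound / (1 - root_\<gamma>)"
      by (intro measure_pmf.integral_le_const integrable_measure_pmf_finite finite_set_trajectory_pmf AE_I2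
          discounted_rewards_bounded assms)
    finally show ?thesis .
  qed
  then show "AE n in measure_pmf p. norm (truncated_value x \<xi> \<pi> n z) \<le> reward_bound / (1 - root_\<gamma>)"
    by simp
qed simp

text \<open>A random horizon reaching step \<open>n\<close> with probability \<open>root_\<gamma> ^ n\<close> and the weight \<open>root_\<gamma> ^ n\<close>
  combine to the discount \<open>\<gamma> ^ n\<close>: by memorylessness the mean over the horizon solves the
  Bellman equation.\<close>

lemma policy_avg_mean_truncated_value:
  assumes \<xi>: "\<xi> \<in> space \<Xi>" and \<pi>: "is_policy \<pi>"
  shows "policy_avg \<pi> (\<lambda>z. \<integral>n. truncated_value x \<xi> \<pi> n z \<partial>geometric_pmf (1 - root_\<gamma>)) s
    = value_fn \<gamma> \<kappa> (M x \<xi>) \<pi> s"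
proof -
  let ?m = "M x \<xi>" and ?W = "\<lambda>z. \<integral>n. truncated_value x \<xi> \<pi> n z \<partial>geometric_pmf (1 - root_\<gamma>)"
  let ?V = "value_fn \<gamma> \<kappa> ?m \<pi>"
  note int = truncated_value_integrable[OF \<xi> \<pi>]
  have W: "?W z = reg_reward \<kappa> ?m \<pi> z + \<gamma> * trans_avg ?m (policy_avg \<pi> ?W) z" for z
  proof -
    have "?W z = (1 - root_\<gamma>) * reg_reward \<kappa> ?m \<pi> z
        + root_\<gamma> * (\<integral>n. reg_reward \<kappa> ?m \<pi> z + root_\<gamma> * trans_avg ?m (policy_avg \<pi> (truncated_value x \<xi> \<pi> n)) z \<partial>geometric_pmf (1 - root_\<gamma>))"
      using root_\<gamma>
      by (subst geometric_pmf_integral_Suc[OF _ _ int]) (simp_all add: truncated_value_0 truncated_value_Suc[OF \<pi>])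
    also have "(\<integral>n. reg_reward \<kappa> ?m \<pi> z + root_\<gamma> * trans_avg ?m (policy_avg \<pi> (truncated_value x \<xi> \<pi> n)) z \<partial>geometric_pmf (1 - root_\<gamma>))
        = reg_reward \<kappa> ?m \<pi> z + root_\<gamma> * trans_avg ?m (policy_avg \<pi> ?W) z"
      using integral_trans_policy_avg[of "geometric_pmf (1 - root_\<gamma>)" "truncated_value x \<xi> \<pi>" ?m \<pi> z, OF int] by simp
    finally show ?thesis
      using root_\<gamma>(3) by (simp add: algebra_simps)
  qed
  have "\<bar>policy_avg \<pi> ?W s - ?V s\<bar> \<le> 0 / (1 - \<gamma>)"
  proof (rule sup_self_bound[where e = "\<lambda>s. \<bar>policy_avg \<pi> ?W s - ?V s\<bar>", OF \<gamma>_less])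
    fix c s assume c: "\<And>s. \<bar>policy_avg \<pi> ?W s - ?V s\<bar> \<le> c"
    have "policy_avg \<pi> ?W s = policy_avg \<pi> (\<lambda>z. reg_reward \<kappa> ?m \<pi> z + \<gamma> * trans_avg ?m (policy_avg \<pi> ?W) z) s"
      by (subst (1) W[abs_def]) (rule refl)
    moreover have "policy_avg \<pi> (trans_avg ?m (\<lambda>s. policy_avg \<pi> ?W s - ?V s)) s
        = policy_avg \<pi> (trans_avg ?m (policy_avg \<pi> ?W)) s - policy_avg \<pi> (trans_avg ?m ?V) s"
      by (subst trans_avg_diff[abs_def]) (rule policy_avg_diff)
    ultimately have "policy_avg \<pi> ?W s - ?V s = \<gamma> * policy_avg \<pi> (trans_avg ?m (\<lambda>s. policy_avg \<pi> ?W s - ?V s)) s"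
      by (subst value_fn_Bellman[OF \<gamma>_nonneg \<gamma>_less \<pi>])
         (simp add: policy_avg_add policy_avg_mult right_diff_distrib)
    moreover have "norm (policy_avg \<pi> (\<lambda>z. trans_avg ?m (\<lambda>s. policy_avg \<pi> ?W s - ?V s) z) s) \<le> c"
      by (intro norm_policy_avg_le norm_trans_avg_le \<pi>) (use c in simp)
    ultimately show "\<bar>policy_avg \<pi> ?W s - ?V s\<bar> \<le> 0 + \<gamma> * c"
      using \<gamma>_nonneg by (simp add: abs_mult mult_left_mono)
  qed
  then show ?thesis by simp
qed

definition path_gradient ::
  "real ^ 'd \<Rightarrow> 'c \<Rightarrow> ('s, 'a) policy \<Rightarrow> nat \<Rightarrow> nat \<Rightarrow> ('s \<times> 'a) list \<Rightarrow> real ^ 'd" where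
  "path_gradient x \<xi> \<pi> T T' \<tau> =
     (\<Sum>t=0..T. grad_reward M x \<xi> (fst (\<tau> ! t)) (snd (\<tau> ! t)))
     + (\<gamma> / (1 - \<gamma>) * discounted_rewards x \<xi> \<pi> T' (T + 1) \<tau>)
       *\<^sub>R grad_log_trans M x \<xi> (fst (\<tau> ! T)) (snd (\<tau> ! T)) (fst (\<tau> ! (T + 1)))"

text \<open>The starting pair is drawn first here, which allows conditioning on it.\<close>

lemma return_gradient_estimator_eq:
  "return_gradient_estimator \<gamma> \<kappa> M x \<xi> \<pi> start =
     bind_pmf start (\<lambda>z. bind_pmf (geometric_pmf (1 - \<gamma>)) (\<lambda>T. bind_pmf (geometric_pmf (1 - root_\<gamma>))
       (\<lambda>T'. map_pmf (path_gradient x \<xi> \<pi> T T') (trajectory_pmf (M x \<xi>) \<pi> (T + T' + 1) z))))"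
proof -
  have shift: "(\<Sum>t = T + 1..T + T' + 1. \<gamma> powr (real (t - T - 1) / 2) * h (\<tau> ! t)) =
      (\<Sum>j = 0..T'. root_\<gamma> ^ j * h (\<tau> ! (T + 1 + j)))" for T T' \<tau> and h :: "'s \<times> 'a \<Rightarrow> real"
    unfolding root_\<gamma>_power
    by (rule sum.reindex_bij_witness[where i = "\<lambda>j. T + 1 + j" and j = "\<lambda>t. t - T - 1"]) auto
  have "return_gradient_estimator \<gamma> \<kappa> M x \<xi> \<pi> start =
      bind_pmf (geometric_pmf (1 - \<gamma>)) (\<lambda>T. bind_pmf (geometric_pmf (1 - root_\<gamma>))
       (\<lambda>T'. bind_pmf start (\<lambda>z. map_pmf (path_gradient x \<xi> \<pi> T T') (trajectory_pmf (M x \<xi>) \<pi> (T + T' + 1) z))))"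
    unfolding return_gradient_estimator_def map_pmf_def root_\<gamma>_def[symmetric]
      path_gradient_def discounted_rewards_def reg_reward_def
      shift[where h = "\<lambda>z. reward (M x \<xi>) (fst z) (snd z) + \<kappa> * policy_entropy \<pi> (fst z)"] ..
  also have "\<dots> = bind_pmf (geometric_pmf (1 - \<gamma>)) (\<lambda>T. bind_pmf start (\<lambda>z. bind_pmf (geometric_pmf (1 - root_\<gamma>))
       (\<lambda>T'. map_pmf (path_gradient x \<xi> \<pi> T T') (trajectory_pmf (M x \<xi>) \<pi> (T + T' + 1) z))))"
    by (subst bind_commute_pmf) (rule refl)
  also have "\<dots> = bind_pmf start (\<lambda>z. bind_pmf (geometric_pmf (1 - \<gamma>)) (\<lambda>T. bind_pmf (geometric_pmf (1 - root_\<gamma>))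
       (\<lambda>T'. map_pmf (path_gradient x \<xi> \<pi> T T') (trajectory_pmf (M x \<xi>) \<pi> (T + T' + 1) z))))"
    by (rule bind_commute_pmf)
  finally show ?thesis .
qed

subsection \<open>Second moments\<close>

definition path_slope :: real where
  "path_slope = reward_slope + \<gamma> / (1 - \<gamma>) * (reward_bound / (1 - root_\<gamma>)) * log_trans_slope"

lemma norm_path_gradient_le:
  assumes \<xi>: "\<xi> \<in> space \<Xi>" and \<pi>: "is_policy \<pi>"
    and \<tau>: "\<tau> \<in> set_pmf (trajectory_pmf (M x \<xi>) \<pi> (T + T' + 1) z)"
  shows "norm (path_gradient x \<xi> \<pi> T T' \<tau>) \<le> path_slope * (real T + 1)"
proof -
  have rb: "0 \<le> reward_bound"
    using ln_card_nonneg by (simp add: reward_bound_def)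
  let ?c = "\<gamma> / (1 - \<gamma>) * (reward_bound / (1 - root_\<gamma>)) * log_trans_slope"
  have c: "0 \<le> ?c"
    using \<gamma>_nonneg \<gamma>_less rb root_\<gamma> slopes_nonneg by (intro mult_nonneg_nonneg divide_nonneg_nonneg) auto
  have "norm (\<Sum>t=0..T. grad_reward M x \<xi> (fst (\<tau> ! t)) (snd (\<tau> ! t))) \<le> (\<Sum>t=0..T. reward_slope)"
    by (intro sum_norm_le norm_grad_reward_le \<xi>)
  then have 1: "norm (\<Sum>t=0..T. grad_reward M x \<xi> (fst (\<tau> ! t)) (snd (\<tau> ! t))) \<le> (real T + 1) * reward_slope"
    by (simp add: add.commute)
  have 2: "norm ((\<gamma> / (1 - \<gamma>) * discounted_rewards x \<xi> \<pi> T' (T + 1) \<tau>)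
       *\<^sub>R grad_log_trans M x \<xi> (fst (\<tau> ! T)) (snd (\<tau> ! T)) (fst (\<tau> ! (T + 1)))) \<le> ?c"
    unfolding norm_scaleR abs_mult
  proof (intro mult_mono discounted_rewards_bounded \<xi> \<pi> norm_grad_log_trans_le)
    show "0 < pmf (trans (M x \<xi>) (fst (\<tau> ! T)) (snd (\<tau> ! T))) (fst (\<tau> ! (T + 1)))"
      by (rule trajectory_transition_pos[OF \<tau>]) simp
  qed (use \<gamma>_nonneg \<gamma>_less rb root_\<gamma> in \<open>auto simp: abs_divide\<close>)
  have "norm (path_gradient x \<xi> \<pi> T T' \<tau>) \<le> (real T + 1) * reward_slope + ?c"
    unfolding path_gradient_def by (rule order_trans[OF norm_triangle_ineq add_mono[OF 1 2]])
  also have "?c \<le> ?c * (real T + 1)"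
    by (rule order_trans[OF eq_refl[OF mult_1_right[symmetric]] mult_left_mono[OF _ c]]) simp
  finally show ?thesis by (simp add: path_slope_def algebra_simps)
qed

definition return_moment :: real where
  "return_moment = path_slope\<^sup>2 * (\<integral>T. (real T + 1)\<^sup>2 \<partial>geometric_pmf (1 - \<gamma>))"

lemma return_moment_nonneg: "0 \<le> return_moment"
  by (simp add: return_moment_def)

lemma return_gradient_second_moment:
  assumes \<xi>: "\<xi> \<in> space \<Xi>" and \<pi>: "is_policy \<pi>"
  shows "(\<integral>\<^sup>+g. ennreal ((norm g)\<^sup>2) \<partial>return_gradient_estimator \<gamma> \<kappa> M x \<xi> \<pi> start) \<le> ennreal return_moment"
proof -
  have le: "(\<integral>\<^sup>+T'. \<integral>\<^sup>+\<tau>. ennreal ((norm (path_gradient x \<xi> \<pi> T T' \<tau>))\<^sup>2)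
        \<partial>trajectory_pmf (M x \<xi>) \<pi> (T + T' + 1) z \<partial>geometric_pmf (1 - root_\<gamma>))
      \<le> ennreal (path_slope\<^sup>2 * (real T + 1)\<^sup>2)" for T z
  proof (intro nn_integral_pmf_le ennreal_leI)
    fix T' \<tau> assume "\<tau> \<in> set_pmf (trajectory_pmf (M x \<xi>) \<pi> (T + T' + 1) z)"
    from power_mono[OF norm_path_gradient_le[OF \<xi> \<pi> this] norm_ge_zero, of 2]
    show "(norm (path_gradient x \<xi> \<pi> T T' \<tau>))\<^sup>2 \<le> path_slope\<^sup>2 * (real T + 1)\<^sup>2"
      by (simp add: power_mult_distrib)
  qed
  have int: "integrable (geometric_pmf (1 - \<gamma>)) (\<lambda>T. path_slope\<^sup>2 * (real T + 1)\<^sup>2)"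
    using \<gamma>_pos \<gamma>_less by (intro integrable_mult_right integrable_geometric_square) auto
  have "(\<integral>\<^sup>+g. ennreal ((norm g)\<^sup>2) \<partial>return_gradient_estimator \<gamma> \<kappa> M x \<xi> \<pi> start) =
      (\<integral>\<^sup>+z. \<integral>\<^sup>+T. \<integral>\<^sup>+T'. \<integral>\<^sup>+\<tau>. ennreal ((norm (path_gradient x \<xi> \<pi> T T' \<tau>))\<^sup>2)
        \<partial>trajectory_pmf (M x \<xi>) \<pi> (T + T' + 1) z \<partial>geometric_pmf (1 - root_\<gamma>) \<partial>geometric_pmf (1 - \<gamma>) \<partial>start)"
    unfolding return_gradient_estimator_eq nn_integral_bind_pmf nn_integral_map_pmf ..
  also have "\<dots> \<le> (\<integral>\<^sup>+z. \<integral>\<^sup>+T. ennreal (path_slope\<^sup>2 * (real T + 1)\<^sup>2) \<partial>geometric_pmf (1 - \<gamma>) \<partial>start)"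
    by (intro nn_integral_mono le)
  also have "\<dots> = ennreal return_moment"
    using int by (simp add: nn_integral_eq_integral return_moment_def)
  finally show ?thesis .
qed

subsection \<open>Means\<close>

text \<open>The means for fixed horizons satisfy recursions in the outer horizon \<open>T\<close>: splitting off the first
  step lowers \<open>T\<close> by one, and \<open>T = 0\<close> leaves the logarithmic gradient times a truncated value.
  Averaging over \<open>T\<close> by memorylessness turns these into the equation for \<open>grad_q\<close>, whose solution is
  unique.\<close>

lemma return_gradient_mean:
  assumes \<xi>: "\<xi> \<in> space \<Xi>" and \<pi>: "is_policy \<pi>"
  shows "(\<integral>g. inner v g \<partial>return_gradient_estimator \<gamma> \<kappa> M x \<xi> \<pi> (return_pmf z)) = inner v (grad_q x \<xi> \<pi> z)"
proof -
  let ?m = "M x \<xi>" and ?W = "\<lambda>z. \<integral>n. truncated_value x \<xi> \<pi> n z \<partial>geometric_pmf (1 - root_\<gamma>)"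
  let ?est = "\<lambda>z. return_gradient_estimator \<gamma> \<kappa> M x \<xi> \<pi> (return_pmf z)"
  let ?\<rho> = "\<lambda>z. inner v (grad_reward M x \<xi> (fst z) (snd z))"
  let ?l = "\<lambda>z s. inner v (grad_log_trans M x \<xi> (fst z) (snd z) s)"
  define inner_est where "inner_est T z = bind_pmf (geometric_pmf (1 - root_\<gamma>))
       (\<lambda>T'. map_pmf (path_gradient x \<xi> \<pi> T T') (trajectory_pmf ?m \<pi> (T + T' + 1) z))" for T z
  define E where "E T T' z = measure_pmf.expectation (trajectory_pmf ?m \<pi> (T + T' + 1) z)
      (\<lambda>\<tau>. inner v (path_gradient x \<xi> \<pi> T T' \<tau>))" for T T' z
  define mean where "mean z = (\<integral>g. inner v g \<partial>?est z)" for z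
  have est: "?est z = bind_pmf (geometric_pmf (1 - \<gamma>)) (\<lambda>T. inner_est T z)" for z
    unfolding return_gradient_estimator_eq inner_est_def by (simp add: bind_return_pmf)
  have int_est: "integrable (bind_pmf (geometric_pmf (1 - \<gamma>)) (\<lambda>T. inner_est T z)) (inner v)" for z
    unfolding est[symmetric]
    by (rule integrable_inner_of_second_moment[OF return_gradient_second_moment[OF \<xi> \<pi>]])
  have geo: "set_pmf (geometric_pmf (1 - \<gamma>)) = UNIV"
    using \<gamma>_pos \<gamma>_less by (intro set_pmf_geometric) auto
  have int_inner: "integrable (inner_est T z) (inner v)" for T z
    using bind_pmf_integrable(1)[OF int_est] geo by blast
  have int_E: "integrable (geometric_pmf (1 - root_\<gamma>)) (\<lambda>T'. E T T' z)" for T z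
    using bind_pmf_integrable(2)[OF int_inner[unfolded inner_est_def]] by (simp add: E_def)
  have inner_mean: "(\<integral>g. inner v g \<partial>inner_est T z) = (\<integral>T'. E T T' z \<partial>geometric_pmf (1 - root_\<gamma>))" for T z
    using bind_pmf_integrable(3)[OF int_inner[unfolded inner_est_def]]
    by (simp add: E_def inner_est_def)
  define Ebar where "Ebar T z = (\<integral>T'. E T T' z \<partial>geometric_pmf (1 - root_\<gamma>))" for T z
  have int_Ebar: "integrable (geometric_pmf (1 - \<gamma>)) (\<lambda>T. Ebar T z)" for z
    using bind_pmf_integrable(2)[OF int_est] by (simp add: inner_mean Ebar_def)
  have mean: "mean z = (\<integral>T. Ebar T z \<partial>geometric_pmf (1 - \<gamma>))" for z
    unfolding mean_def est using bind_pmf_integrable(3)[OF int_est] by (simp add: inner_mean Ebar_def)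
  have E_Suc: "E (Suc T) T' z = ?\<rho> z + trans_avg ?m (policy_avg \<pi> (E T T')) z" for T T' z
  proof -
    have step: "inner v (path_gradient x \<xi> \<pi> (Suc T) T' (z # \<tau>)) = ?\<rho> z + 1 * inner v (path_gradient x \<xi> \<pi> T T' \<tau>)" for \<tau>
      unfolding path_gradient_def
      by (subst sum.atLeast0_atMost_Suc_shift) (simp add: discounted_rewards_Cons inner_add_right)
    have "E (Suc T) T' z = measure_pmf.expectation (trajectory_pmf ?m \<pi> (Suc (T + T' + 1)) z)
        (\<lambda>\<tau>. inner v (path_gradient x \<xi> \<pi> (Suc T) T' \<tau>))"
      by (simp add: E_def)
    also have "\<dots> = trans_avg ?m (policy_avg \<pi> (\<lambda>z'. ?\<rho> z + 1 * E T T' z')) z"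
      unfolding expectation_trajectory_Suc[OF \<pi>] step expectation_affine_finite[OF finite_set_trajectory_pmf] E_def ..
    finally show ?thesis
      by (simp add: policy_avg_add[abs_def] policy_avg_const[OF \<pi>] trans_avg_add trans_avg_const)
  qed
  \<comment> \<open>The pair after \<open>z\<close> is the head of the remaining path, so the logarithmic gradient is constant under
    the inner expectation.\<close>
  have E_0: "E 0 T' z = ?\<rho> z + \<gamma> / (1 - \<gamma>) * trans_avg ?m (\<lambda>s. ?l z s * policy_avg \<pi> (truncated_value x \<xi> \<pi> T') s) z" for T' z
  proof -
    have step: "inner v (path_gradient x \<xi> \<pi> 0 T' (z # \<tau>)) =
        ?\<rho> z + (\<gamma> / (1 - \<gamma>) * ?l z (fst (\<tau> ! 0))) * discounted_rewards x \<xi> \<pi> T' 0 \<tau>" for \<tau>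
      using discounted_rewards_Cons[of x \<xi> \<pi> T' 0 z \<tau>]
      by (simp add: path_gradient_def inner_add_right)
    have "E 0 T' z = measure_pmf.expectation (trajectory_pmf ?m \<pi> (Suc T') z)
        (\<lambda>\<tau>. inner v (path_gradient x \<xi> \<pi> 0 T' \<tau>))"
      by (simp add: E_def)
    also have "\<dots> = trans_avg ?m (policy_avg \<pi> (\<lambda>z'. ?\<rho> z + (\<gamma> / (1 - \<gamma>) * ?l z (fst z')) * truncated_value x \<xi> \<pi> T' z')) z"
    proof -
      have "measure_pmf.expectation (trajectory_pmf ?m \<pi> T' z') (\<lambda>\<tau>. inner v (path_gradient x \<xi> \<pi> 0 T' (z # \<tau>)))
          = ?\<rho> z + (\<gamma> / (1 - \<gamma>) * ?l z (fst z')) * truncated_value x \<xi> \<pi> T' z'" for z'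
      proof -
        have "measure_pmf.expectation (trajectory_pmf ?m \<pi> T' z') (\<lambda>\<tau>. inner v (path_gradient x \<xi> \<pi> 0 T' (z # \<tau>)))
          = measure_pmf.expectation (trajectory_pmf ?m \<pi> T' z')
              (\<lambda>\<tau>. ?\<rho> z + (\<gamma> / (1 - \<gamma>) * ?l z (fst z')) * discounted_rewards x \<xi> \<pi> T' 0 \<tau>)"
          unfolding step by (intro integral_cong_AE) (auto simp: AE_measure_pmf_iff trajectory_head)
        then show ?thesis
          unfolding expectation_affine_finite[OF finite_set_trajectory_pmf] truncated_value_def .
      qed
      then show ?thesis
        unfolding expectation_trajectory_Suc[OF \<pi>] by simp
    qed
    also have "policy_avg \<pi> (\<lambda>z'. ?\<rho> z + (\<gamma> / (1 - \<gamma>) * ?l z (fst z')) * truncated_value x \<xi> \<pi> T' z') =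
        (\<lambda>s. ?\<rho> z + \<gamma> / (1 - \<gamma>) * (?l z s * policy_avg \<pi> (truncated_value x \<xi> \<pi> T') s))"
      by (rule ext, simp add: policy_avg_add policy_avg_const[OF \<pi>])
         (simp add: policy_avg_def sum_distrib_left sum_divide_distrib mult_ac)
    finally show ?thesis
      by (simp add: trans_avg_add trans_avg_const)
         (simp add: trans_avg_def sum_distrib_left sum_divide_distrib mult_ac)
  qed
  have Ebar_Suc: "Ebar (Suc T) z = ?\<rho> z + trans_avg ?m (policy_avg \<pi> (Ebar T)) z" for T z
    unfolding Ebar_def E_Suc
    using integral_trans_policy_avg[of "geometric_pmf (1 - root_\<gamma>)" "E T" ?m \<pi> z, OF int_E] by simp
  have Ebar_0: "Ebar 0 z = ?\<rho> z + \<gamma> / (1 - \<gamma>) * trans_avg ?m (\<lambda>s. ?l z s * value_fn \<gamma> \<kappa> ?m \<pi> s) z" for z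
  proof -
    note int = truncated_value_integrable[OF \<xi> \<pi>]
    have int_avg: "integrable (measure_pmf p) (\<lambda>n. policy_avg \<pi> (truncated_value x \<xi> \<pi> n) s)"
      and avg: "(\<integral>n. policy_avg \<pi> (truncated_value x \<xi> \<pi> n) s \<partial>geometric_pmf (1 - root_\<gamma>)) = policy_avg \<pi> ?W s"
      for p s
      using int by (simp_all add: policy_avg_def)
    have int_tr: "integrable (geometric_pmf (1 - root_\<gamma>)) (\<lambda>n. trans_avg ?m (\<lambda>s. ?l z s * policy_avg \<pi> (truncated_value x \<xi> \<pi> n) s) z)"
      and tr: "(\<integral>n. trans_avg ?m (\<lambda>s. ?l z s * policy_avg \<pi> (truncated_value x \<xi> \<pi> n) s) z \<partial>geometric_pmf (1 - root_\<gamma>))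
        = trans_avg ?m (\<lambda>s. ?l z s * policy_avg \<pi> ?W s) z"
      using int_avg by (simp_all add: trans_avg_def avg)
    show ?thesis
      unfolding Ebar_def E_0 using int_tr by (simp add: tr policy_avg_mean_truncated_value[OF \<xi> \<pi>])
  qed
  \<comment> \<open>The factor \<open>1 / (1 - \<gamma>)\<close> of the estimator cancels the probability \<open>1 - \<gamma>\<close> of \<open>T = 0\<close>.\<close>
  have mean_fixpoint: "mean z = ?\<rho> z + \<gamma> * (trans_avg ?m (\<lambda>s. ?l z s * value_fn \<gamma> \<kappa> ?m \<pi> s) z + trans_avg ?m (policy_avg \<pi> mean) z)" for z
  proof -
    have "mean z = (1 - \<gamma>) * Ebar 0 z + \<gamma> * (\<integral>T. Ebar (Suc T) z \<partial>geometric_pmf (1 - \<gamma>))"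
      unfolding mean using \<gamma>_pos \<gamma>_less by (subst geometric_pmf_integral_Suc[OF _ _ int_Ebar]) auto
    also have "(\<integral>T. Ebar (Suc T) z \<partial>geometric_pmf (1 - \<gamma>)) = ?\<rho> z + trans_avg ?m (policy_avg \<pi> mean) z"
      unfolding Ebar_Suc mean[abs_def]
      using integral_trans_policy_avg[of "geometric_pmf (1 - \<gamma>)" Ebar ?m \<pi> z, OF int_Ebar] by simp
    also have "(1 - \<gamma>) * Ebar 0 z = (1 - \<gamma>) * ?\<rho> z + \<gamma> * trans_avg ?m (\<lambda>s. ?l z s * value_fn \<gamma> \<kappa> ?m \<pi> s) z"
      unfolding Ebar_0 using \<gamma>_less by (simp add: distrib_left)
    finally show ?thesis by (simp add: algebra_simps)
  qed
  let ?D = "\<lambda>z. inner v (grad_q x \<xi> \<pi> z)"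
  have "\<bar>mean z - ?D z\<bar> \<le> 0 / (1 - \<gamma>)"
  proof (rule sup_self_bound[where e = "\<lambda>z. \<bar>mean z - ?D z\<bar>", OF \<gamma>_less])
    fix c z assume c: "\<And>z. \<bar>mean z - ?D z\<bar> \<le> c"
    have "(\<Sum>s\<in>UNIV. inner v (grad_trans x \<xi> (fst z) (snd z) s) * value_fn \<gamma> \<kappa> ?m \<pi> s) =
        trans_avg ?m (\<lambda>s. ?l z s * value_fn \<gamma> \<kappa> ?m \<pi> s) z"
      by (simp add: grad_trans_def trans_avg_def mult_ac)
    then have "mean z - ?D z = \<gamma> * (trans_avg ?m (policy_avg \<pi> mean) z - trans_avg ?m (policy_avg \<pi> ?D) z)"
      unfolding inner_grad_q_fixpoint[OF \<pi>, of v x \<xi> z] mean_fixpoint[of z] by (simp add: algebra_simps)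
    also have "trans_avg ?m (policy_avg \<pi> mean) z - trans_avg ?m (policy_avg \<pi> ?D) z
        = trans_avg ?m (policy_avg \<pi> (\<lambda>z. mean z - ?D z)) z"
      by (simp add: policy_avg_diff[abs_def] trans_avg_diff)
    finally have "\<bar>mean z - ?D z\<bar> = \<gamma> * norm (trans_avg ?m (policy_avg \<pi> (\<lambda>z. mean z - ?D z)) z)"
      using \<gamma>_nonneg by (simp add: abs_mult)
    also have "\<dots> \<le> \<gamma> * c"
      by (intro mult_left_mono \<gamma>_nonneg norm_trans_avg_le norm_policy_avg_le \<pi>) (use c in simp)
    finally show "\<bar>mean z - ?D z\<bar> \<le> 0 + \<gamma> * c" by simp
  qed
  then show ?thesis by (simp add: mean_def)
qed

lemma return_gradient_mean_start:
  assumes \<xi>: "\<xi> \<in> space \<Xi>" and \<pi>: "is_policy \<pi>"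
  shows "(\<integral>g. inner v g \<partial>return_gradient_estimator \<gamma> \<kappa> M x \<xi> \<pi> (start_pmf \<pi> s))
    = policy_avg \<pi> (\<lambda>z. inner v (grad_q x \<xi> \<pi> z)) s"
proof -
  have eq: "return_gradient_estimator \<gamma> \<kappa> M x \<xi> \<pi> (start_pmf \<pi> s) =
      bind_pmf (start_pmf \<pi> s) (\<lambda>z. return_gradient_estimator \<gamma> \<kappa> M x \<xi> \<pi> (return_pmf z))"
    unfolding return_gradient_estimator_eq by (simp add: bind_return_pmf)
  have "integrable (return_gradient_estimator \<gamma> \<kappa> M x \<xi> \<pi> (start_pmf \<pi> s)) (inner v)"
    by (rule integrable_inner_of_second_moment[OF return_gradient_second_moment[OF \<xi> \<pi>]])
  from bind_pmf_integrable(3)[OF this[unfolded eq]] show ?thesis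
    unfolding eq by (simp add: return_gradient_mean[OF \<xi> \<pi>] expectation_start_pmf[OF \<pi>])
qed

lemma norm_diff_square_le: "(norm (a - b))\<^sup>2 \<le> 2 * (norm a)\<^sup>2 + 2 * (norm (b::'v::real_normed_vector))\<^sup>2"
proof -
  have "(norm (a - b))\<^sup>2 \<le> (norm a + norm b)\<^sup>2"
    by (intro power_mono norm_triangle_ineq4) simp
  also have "\<dots> \<le> 2 * (norm a)\<^sup>2 + 2 * (norm b)\<^sup>2"
    using zero_le_power2[of "norm a - norm b"] by (simp add: power2_eq_square algebra_simps)
  finally show ?thesis .
qed

lemma gradient_estimator_second_moment:
  assumes \<xi>: "\<xi> \<in> space \<Xi>" and \<pi>: "is_policy \<pi>"
  shows "(\<integral>\<^sup>+g. ennreal ((norm g)\<^sup>2) \<partial>gradient_estimator \<gamma> \<kappa> M x \<xi> \<pi> s a) \<le> ennreal (4 * return_moment)"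
proof -
  let ?Q = "return_gradient_estimator \<gamma> \<kappa> M x \<xi> \<pi> (return_pmf (s, a))"
  let ?V = "return_gradient_estimator \<gamma> \<kappa> M x \<xi> \<pi> (start_pmf \<pi> s)"
  let ?G = "ennreal return_moment"
  have "(\<integral>\<^sup>+g. ennreal ((norm g)\<^sup>2) \<partial>gradient_estimator \<gamma> \<kappa> M x \<xi> \<pi> s a) =
      (\<integral>\<^sup>+gQ. \<integral>\<^sup>+gV. ennreal ((norm (gQ - gV))\<^sup>2) \<partial>?V \<partial>?Q)"
    by (simp add: gradient_estimator_def)
  also have "\<dots> \<le> (\<integral>\<^sup>+gQ. \<integral>\<^sup>+gV. 2 * ennreal ((norm gQ)\<^sup>2) + 2 * ennreal ((norm gV)\<^sup>2) \<partial>?V \<partial>?Q)"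
  proof (intro nn_integral_mono)
    fix gQ gV :: "real ^ 'd"
    have "ennreal ((norm (gQ - gV))\<^sup>2) \<le> ennreal (2 * (norm gQ)\<^sup>2 + 2 * (norm gV)\<^sup>2)"
      by (intro ennreal_leI norm_diff_square_le)
    then show "ennreal ((norm (gQ - gV))\<^sup>2) \<le> 2 * ennreal ((norm gQ)\<^sup>2) + 2 * ennreal ((norm gV)\<^sup>2)"
      by (simp add: ennreal_plus ennreal_mult)
  qed
  also have "\<dots> = 2 * (\<integral>\<^sup>+g. ennreal ((norm g)\<^sup>2) \<partial>?Q) + 2 * (\<integral>\<^sup>+g. ennreal ((norm g)\<^sup>2) \<partial>?V)"
    by (simp add: nn_integral_add nn_integral_cmult)
  also have "\<dots> \<le> 2 * ?G + 2 * ?G"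
    by (intro add_mono mult_left_mono return_gradient_second_moment \<xi> \<pi>) auto
  also have "\<dots> = ennreal (4 * return_moment)"
    using return_moment_nonneg
    by (simp add: ennreal_mult distrib_right[symmetric] del: distrib_right_numeral)
  finally show ?thesis .
qed

lemma gradient_estimator_mean:
  assumes \<xi>: "\<xi> \<in> space \<Xi>" and \<pi>: "is_policy \<pi>"
  shows "(\<integral>g. inner v g \<partial>gradient_estimator \<gamma> \<kappa> M x \<xi> \<pi> s a)
    = inner v (grad_q x \<xi> \<pi> (s, a) - policy_avg \<pi> (grad_q x \<xi> \<pi>) s)"
proof -
  let ?Q = "return_gradient_estimator \<gamma> \<kappa> M x \<xi> \<pi> (return_pmf (s, a))"
  let ?V = "return_gradient_estimator \<gamma> \<kappa> M x \<xi> \<pi> (start_pmf \<pi> s)"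
  have int_Q: "integrable ?Q (inner v)" and int_V: "integrable ?V (inner v)"
    by (rule integrable_inner_of_second_moment[OF return_gradient_second_moment[OF \<xi> \<pi>]])+
  have int: "integrable (gradient_estimator \<gamma> \<kappa> M x \<xi> \<pi> s a) (inner v)"
    by (rule integrable_inner_of_second_moment[OF gradient_estimator_second_moment[OF \<xi> \<pi>]])
  have V: "(\<integral>g. inner v g \<partial>bind_pmf ?V (\<lambda>gV. return_pmf (gQ - gV)))
      = inner v gQ - policy_avg \<pi> (\<lambda>z. inner v (grad_q x \<xi> \<pi> z)) s" for gQ
  proof -
    have "(\<integral>g. inner v g \<partial>bind_pmf ?V (\<lambda>gV. return_pmf (gQ - gV))) = (\<integral>gV. inner v (gQ - gV) \<partial>?V)"
      by (simp add: map_pmf_def[symmetric])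
    also have "\<dots> = inner v gQ - (\<integral>gV. inner v gV \<partial>?V)"
      using int_V by (simp add: inner_diff_right)
    finally show ?thesis by (simp add: return_gradient_mean_start[OF \<xi> \<pi>])
  qed
  have "(\<integral>g. inner v g \<partial>gradient_estimator \<gamma> \<kappa> M x \<xi> \<pi> s a) =
      (\<integral>gQ. inner v gQ - policy_avg \<pi> (\<lambda>z. inner v (grad_q x \<xi> \<pi> z)) s \<partial>?Q)"
    unfolding gradient_estimator_def V[symmetric]
    by (rule bind_pmf_integrable(3)[OF int[unfolded gradient_estimator_def]])
  also have "\<dots> = inner v (grad_q x \<xi> \<pi> (s, a)) - policy_avg \<pi> (\<lambda>z. inner v (grad_q x \<xi> \<pi> z)) s"
    using int_Q by (simp add: return_gradient_mean[OF \<xi> \<pi>])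
  finally show ?thesis
    by (simp add: inner_diff_right inner_policy_avg)
qed

lemma hypergradient_estimator_second_moment:
  fixes \<nu> :: "'s pmf"
  assumes \<nu>: "set_pmf \<nu> = UNIV"
  shows "\<exists>G\<ge>0. \<forall>\<xi>\<in>space \<Xi>. \<forall>x \<pi>. is_policy \<pi> \<longrightarrow>
    (\<integral>\<^sup>+g. ennreal ((norm g)\<^sup>2) \<partial>hypergradient_estimator \<gamma> \<kappa> M f \<nu> x \<xi> \<pi>) \<le> ennreal G"
proof -
  define \<nu>0 where "\<nu>0 = Min (range (pmf \<nu>))"
  have "\<nu>0 \<in> range (pmf \<nu>)" unfolding \<nu>0_def by (intro Min_in) auto
  then have \<nu>0: "0 < \<nu>0" using \<nu> by (auto simp: pmf_positive)
  have \<nu>0_le: "\<nu>0 \<le> pmf \<nu> s" for s unfolding \<nu>0_def by (intro Min_le) auto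
  let ?c = "\<bar>L\<bar> / (\<kappa> * \<nu>0)"
  let ?G = "2 * L\<^sup>2 + 2 * ?c\<^sup>2 * (4 * return_moment)"
  show ?thesis
  proof (rule exI[of _ ?G], intro conjI ballI allI impI)
  show "0 \<le> ?G" using return_moment_nonneg by simp
  fix \<xi> x and \<pi> :: "('s, 'a) policy"
  assume \<xi>: "\<xi> \<in> space \<Xi>" and \<pi>: "is_policy \<pi>"
  let ?d = "gradient (\<lambda>y. f y \<pi> \<xi>) x"
  let ?w = "\<lambda>s a. 1 / (\<kappa> * pmf \<nu> s) * gradient (\<lambda>p. f x p \<xi>) \<pi> $ (s, a)"
  have "(\<integral>\<^sup>+g. ennreal ((norm g)\<^sup>2) \<partial>hypergradient_estimator \<gamma> \<kappa> M f \<nu> x \<xi> \<pi>) =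
      (\<integral>\<^sup>+s. \<integral>\<^sup>+a. \<integral>\<^sup>+g. ennreal ((norm (?d + ?w s a *\<^sub>R g))\<^sup>2) \<partial>gradient_estimator \<gamma> \<kappa> M x \<xi> \<pi> s a \<partial>action_pmf \<pi> s \<partial>\<nu>)"
    by (simp add: hypergradient_estimator_def)
  also have "\<dots> \<le> ennreal ?G"
  proof (rule nn_integral_pmf_le, rule nn_integral_pmf_le)
    fix s a
    have w: "\<bar>?w s a\<bar> \<le> ?c"
    proof -
      have "\<bar>gradient (\<lambda>p. f x p \<xi>) \<pi> $ (s, a)\<bar> \<le> \<bar>L\<bar>"
        using component_le_norm_cart[of "gradient (\<lambda>p. f x p \<xi>) \<pi>" "(s, a)"] loss_gradients_bounded(2)[OF \<xi> \<pi>, of x]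
        by linarith
      moreover have "1 / (\<kappa> * pmf \<nu> s) \<le> 1 / (\<kappa> * \<nu>0)"
        using \<nu>0 \<nu>0_le[of s] \<kappa>_pos by (intro divide_left_mono mult_left_mono mult_pos_pos) auto
      ultimately have "1 / (\<kappa> * pmf \<nu> s) * \<bar>gradient (\<lambda>p. f x p \<xi>) \<pi> $ (s, a)\<bar> \<le> 1 / (\<kappa> * \<nu>0) * \<bar>L\<bar>"
        using \<kappa>_pos \<nu>0 by (intro mult_mono) auto
      then show ?thesis using \<kappa>_pos by (simp add: abs_mult)
    qed
    have "(norm (?d + ?w s a *\<^sub>R g))\<^sup>2 \<le> 2 * L\<^sup>2 + 2 * ?c\<^sup>2 * (norm g)\<^sup>2" for g
    proof -
      have "(norm ?d)\<^sup>2 \<le> \<bar>L\<bar>\<^sup>2"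
        by (intro power_mono loss_gradients_bounded(1) \<xi> \<pi>) simp
      moreover have "(norm (?w s a *\<^sub>R g))\<^sup>2 \<le> ?c\<^sup>2 * (norm g)\<^sup>2"
        unfolding norm_scaleR power_mult_distrib by (intro mult_right_mono power_mono w) auto
      moreover have "(norm (?d + ?w s a *\<^sub>R g))\<^sup>2 \<le> 2 * (norm ?d)\<^sup>2 + 2 * (norm (?w s a *\<^sub>R g))\<^sup>2"
        using norm_diff_square_le[of ?d "- (?w s a *\<^sub>R g)"] by (simp only: diff_minus_eq_add norm_minus_cancel)
      ultimately show ?thesis
        unfolding power2_abs by linarith
    qed
    then have "(\<integral>\<^sup>+g. ennreal ((norm (?d + ?w s a *\<^sub>R g))\<^sup>2) \<partial>gradient_estimator \<gamma> \<kappa> M x \<xi> \<pi> s a)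
        \<le> (\<integral>\<^sup>+g. ennreal (2 * L\<^sup>2) + ennreal (2 * ?c\<^sup>2) * ennreal ((norm g)\<^sup>2) \<partial>gradient_estimator \<gamma> \<kappa> M x \<xi> \<pi> s a)"
      by (intro nn_integral_mono) (simp add: ennreal_mult[symmetric] ennreal_plus[symmetric] ennreal_leI del: ennreal_plus)
    also have "\<dots> = ennreal (2 * L\<^sup>2) + ennreal (2 * ?c\<^sup>2) * (\<integral>\<^sup>+g. ennreal ((norm g)\<^sup>2) \<partial>gradient_estimator \<gamma> \<kappa> M x \<xi> \<pi> s a)"
      by (simp add: nn_integral_add nn_integral_cmult)
    also have "\<dots> \<le> ennreal (2 * L\<^sup>2) + ennreal (2 * ?c\<^sup>2) * ennreal (4 * return_moment)"
      by (intro add_mono mult_left_mono gradient_estimator_second_moment \<xi> \<pi>) auto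
    also have "\<dots> = ennreal ?G"
      using return_moment_nonneg by (simp add: ennreal_mult[symmetric] ennreal_plus[symmetric] del: ennreal_plus)
    finally show "(\<integral>\<^sup>+g. ennreal ((norm (?d + ?w s a *\<^sub>R g))\<^sup>2) \<partial>gradient_estimator \<gamma> \<kappa> M x \<xi> \<pi> s a) \<le> ennreal ?G" .
  qed
  finally show "(\<integral>\<^sup>+g. ennreal ((norm g)\<^sup>2) \<partial>hypergradient_estimator \<gamma> \<kappa> M f \<nu> x \<xi> \<pi>) \<le> ennreal ?G" .
  qed
qed

lemma hypergradient_estimator_integrable:
  assumes \<nu>: "set_pmf \<nu> = UNIV" and \<xi>: "\<xi> \<in> space \<Xi>" and \<pi>: "is_policy \<pi>"
  shows "integrable (hypergradient_estimator \<gamma> \<kappa> M f \<nu> x \<xi> \<pi>) (inner v)"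
  using hypergradient_estimator_second_moment[OF \<nu>] \<xi> \<pi>
  by (blast intro: integrable_inner_of_second_moment)

text \<open>The weight \<open>1 / pmf \<nu> s\<close> cancels the sampling of \<open>s\<close>. The sampling of \<open>a\<close> contributes
  the factor \<open>\<pi> $ (s, a)\<close> of the derivative of softmax.\<close>

lemma hypergradient_estimator_mean:
  assumes \<nu>: "set_pmf \<nu> = UNIV" and \<xi>: "\<xi> \<in> space \<Xi>" and \<pi>: "is_policy \<pi>"
  shows "(\<integral>g. inner v g \<partial>hypergradient_estimator \<gamma> \<kappa> M f \<nu> x \<xi> \<pi>) = inner v (hypergradient x \<xi> \<pi>)"
proof -
  let ?d = "gradient (\<lambda>y. f y \<pi> \<xi>) x" and ?g = "gradient (\<lambda>p. f x p \<xi>) \<pi>"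
  let ?w = "\<lambda>s a. 1 / (\<kappa> * pmf \<nu> s) * ?g $ (s, a)"
  let ?A = "\<lambda>s a. inner v (grad_q x \<xi> \<pi> (s, a) - policy_avg \<pi> (grad_q x \<xi> \<pi>) s)"
  define est_a where "est_a s a = bind_pmf (gradient_estimator \<gamma> \<kappa> M x \<xi> \<pi> s a) (\<lambda>g. return_pmf (?d + ?w s a *\<^sub>R g))" for s a
  have eq: "hypergradient_estimator \<gamma> \<kappa> M f \<nu> x \<xi> \<pi> = bind_pmf \<nu> (\<lambda>s. bind_pmf (action_pmf \<pi> s) (est_a s))"
    by (simp add: hypergradient_estimator_def est_a_def[abs_def])
  note int = hypergradient_estimator_integrable[OF assms, of x v, unfolded eq]
  have est_a: "(\<integral>g. inner v g \<partial>est_a s a) = inner v ?d + ?w s a * ?A s a" for s a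
  proof -
    have int_A: "integrable (gradient_estimator \<gamma> \<kappa> M x \<xi> \<pi> s a) (inner v)"
      by (rule integrable_inner_of_second_moment[OF gradient_estimator_second_moment[OF \<xi> \<pi>]])
    have "(\<integral>g. inner v g \<partial>est_a s a) = (\<integral>g. inner v ?d + ?w s a * inner v g \<partial>gradient_estimator \<gamma> \<kappa> M x \<xi> \<pi> s a)"
      by (simp add: est_a_def map_pmf_def[symmetric] inner_add_right)
    also have "\<dots> = inner v ?d + ?w s a * (\<integral>g. inner v g \<partial>gradient_estimator \<gamma> \<kappa> M x \<xi> \<pi> s a)"
      using int_A by simp
    finally show ?thesis by (simp only: gradient_estimator_mean[OF \<xi> \<pi>])
  qed
  have "(\<integral>g. inner v g \<partial>hypergradient_estimator \<gamma> \<kappa> M f \<nu> x \<xi> \<pi>) =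
      (\<integral>s. (\<integral>a. inner v ?d + ?w s a * ?A s a \<partial>action_pmf \<pi> s) \<partial>\<nu>)"
  proof -
    have "(\<integral>g. inner v g \<partial>hypergradient_estimator \<gamma> \<kappa> M f \<nu> x \<xi> \<pi>) =
        (\<integral>s. (\<integral>g. inner v g \<partial>bind_pmf (action_pmf \<pi> s) (est_a s)) \<partial>\<nu>)"
      unfolding eq by (rule bind_pmf_integrable(3)[OF int])
    also have "\<dots> = (\<integral>s. (\<integral>a. (\<integral>g. inner v g \<partial>est_a s a) \<partial>action_pmf \<pi> s) \<partial>\<nu>)"
      using \<nu> by (intro integral_cong_AE)
        (auto simp: AE_measure_pmf_iff intro!: bind_pmf_integrable(3)[OF bind_pmf_integrable(1)[OF int]])
    finally show ?thesis by (simp only: est_a)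
  qed
  also have "\<dots> = inner v ?d + (\<Sum>s\<in>UNIV. \<Sum>a\<in>UNIV. pmf \<nu> s * (\<pi> $ (s, a) * (?w s a * ?A s a)))"
  proof -
    have affine: "(\<integral>y. c + h y \<partial>measure_pmf p) = c + (\<Sum>y\<in>UNIV. pmf p y * h y)"
      for p :: "('y::finite) pmf" and c :: real and h
      using integrable_measure_pmf_finite[of p h] by (simp add: expectation_finite_type[of p h])
    show ?thesis
      unfolding affine pmf_action_pmf[OF \<pi>] sum_distrib_left ..
  qed
  also have "(\<Sum>s\<in>UNIV. \<Sum>a\<in>UNIV. pmf \<nu> s * (\<pi> $ (s, a) * (?w s a * ?A s a))) =
      (\<Sum>s\<in>UNIV. \<Sum>a\<in>UNIV. ?g $ (s, a) * inner v (grad_policy x \<xi> \<pi> (s, a)))"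
  proof (intro sum.cong refl)
    fix s a
    have "0 < pmf \<nu> s" using \<nu> by (simp add: pmf_positive)
    then show "pmf \<nu> s * (\<pi> $ (s, a) * (?w s a * ?A s a)) = ?g $ (s, a) * inner v (grad_policy x \<xi> \<pi> (s, a))"
      using \<kappa>_pos by (simp add: grad_policy_def)
  qed
  also have "\<dots> = (\<Sum>z\<in>UNIV. ?g $ z * inner v (grad_policy x \<xi> \<pi> z))"
    by (simp add: sum.cartesian_product)
  finally show ?thesis
    by (simp add: hypergradient_def inner_add_right inner_sum_right)
qed

end

section \<open>Measurability of the algorithm\<close>

lemma Caratheodory_compose:
  fixes f :: "'b::euclidean_space \<Rightarrow> 'w \<Rightarrow> 'v::euclidean_space"
  assumes cont: "\<And>w. w \<in> space N \<Longrightarrow> continuous_on S (\<lambda>x. f x w)"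
    and meas: "\<And>x. x \<in> S \<Longrightarrow> f x \<in> borel_measurable N"
    and X: "X \<in> borel_measurable N'" and XS: "\<And>\<omega>. \<omega> \<in> space N' \<Longrightarrow> X \<omega> \<in> S"
    and Y: "Y \<in> measurable N' N"
  shows "(\<lambda>\<omega>. f (X \<omega>) (Y \<omega>)) \<in> borel_measurable N'"
proof (rule borel_measurable_euclidean_space[THEN iffD2], rule ballI)
  fix b :: 'v assume "b \<in> Basis"
  have "(\<lambda>(x, w). inner (f x w) b) \<in> borel_measurable (restrict_space borel S \<Otimes>\<^sub>M N)"
    using cont meas by (intro borel_measurable_Caratheodory) (auto intro!: continuous_intros)
  moreover have "(\<lambda>\<omega>. (X \<omega>, Y \<omega>)) \<in> measurable N' (restrict_space borel S \<Otimes>\<^sub>M N)"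
    using X XS Y by (intro measurable_Pair measurable_restrict_space2) auto
  ultimately have "(\<lambda>\<omega>. (\<lambda>(x, w). inner (f x w) b) (X \<omega>, Y \<omega>)) \<in> borel_measurable N'"
    by (rule measurable_compose[rotated])
  then show "(\<lambda>\<omega>. inner (f (X \<omega>) (Y \<omega>)) b) \<in> borel_measurable N'" by simp
qed

text \<open>The gradient is a limit of difference quotients along the coordinate directions.\<close>

lemma borel_measurable_gradient_parameter:
  fixes g :: "'v::euclidean_space \<Rightarrow> 'w \<Rightarrow> real"
  assumes U: "open U" "x \<in> U" and meas: "\<And>y. y \<in> U \<Longrightarrow> g y \<in> borel_measurable N"
    and deriv: "\<And>w. w \<in> space N \<Longrightarrow> GDERIV (\<lambda>y. g y w) x :> G w"
  shows "G \<in> borel_measurable N"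
proof (rule borel_measurable_euclidean_space[THEN iffD2], rule ballI)
  fix b :: 'v assume "b \<in> Basis"
  have "(\<lambda>n. x + (1 / real (Suc n)) *\<^sub>R b) \<longlonglongrightarrow> x + 0 *\<^sub>R b"
    by (intro tendsto_intros) (use LIMSEQ_inverse_real_of_nat in \<open>simp add: divide_inverse\<close>)
  then have "(\<lambda>n. x + (1 / real (Suc n)) *\<^sub>R b) \<longlonglongrightarrow> x"
    by simp
  then have "\<forall>\<^sub>F n in sequentially. x + (1 / real (Suc n)) *\<^sub>R b \<in> U"
    using U by (rule topological_tendstoD)
  then obtain n0 where n0: "\<And>n. n \<ge> n0 \<Longrightarrow> x + (1 / real (Suc n)) *\<^sub>R b \<in> U"
    by (auto simp: eventually_sequentially)
  let ?u = "\<lambda>n w. real (Suc n) * (g (x + (1 / real (Suc n)) *\<^sub>R b) w - g x w)"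
  show "(\<lambda>w. inner (G w) b) \<in> borel_measurable N"
  proof (rule borel_measurable_LIMSEQ_real[where u = "\<lambda>n. ?u (n + n0)"])
    show "?u (n + n0) \<in> borel_measurable N" for n
      using meas[OF n0[of "n + n0"]] meas[OF U(2)] by (intro borel_measurable_times borel_measurable_diff) auto
    show "(\<lambda>n. ?u (n + n0) w) \<longlonglongrightarrow> inner (G w) b" if "w \<in> space N" for w
      using LIMSEQ_ignore_initial_segment[OF GDERIV_quotient_LIMSEQ[OF deriv[OF that], of b], of n0]
      by (simp only: inner_commute[of "G w" b])
  qed
qed

text \<open>Both the atoms of the estimator and their weights vary with the parameter, so measurability is
  required of the mass of each fixed Borel set.\<close>

definition pmf_kernel :: "'w measure \<Rightarrow> ('w \<Rightarrow> 'v::topological_space pmf) \<Rightarrow> bool" where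
  "pmf_kernel N K \<longleftrightarrow> (\<forall>A\<in>sets borel. (\<lambda>\<omega>. emeasure (measure_pmf (K \<omega>)) A) \<in> borel_measurable N)"

lemma pmf_kernel_return:
  fixes g :: "'w \<Rightarrow> 'b::topological_space"
  assumes "g \<in> borel_measurable N"
  shows "pmf_kernel N (\<lambda>\<omega>. return_pmf (g \<omega>))"
  unfolding pmf_kernel_def
proof
  fix A :: "'b set" assume [measurable]: "A \<in> sets borel"
  note assms[measurable]
  have "(\<lambda>\<omega>. indicator A (g \<omega>) :: ennreal) \<in> borel_measurable N" by measurable
  then show "(\<lambda>\<omega>. emeasure (measure_pmf (return_pmf (g \<omega>))) A) \<in> borel_measurable N" by simp
qed

lemma pmf_kernel_bind:
  fixes p :: "'w \<Rightarrow> 'k::countable pmf" and K :: "'k \<Rightarrow> 'w \<Rightarrow> 'v::topological_space pmf"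
  assumes p: "\<And>k. (\<lambda>\<omega>. pmf (p \<omega>) k) \<in> borel_measurable N"
    and K: "\<And>k. pmf_kernel N (K k)"
  shows "pmf_kernel N (\<lambda>\<omega>. bind_pmf (p \<omega>) (\<lambda>k. K k \<omega>))"
  unfolding pmf_kernel_def
proof
  fix A :: "'v set" assume A: "A \<in> sets borel"
  interpret sigma_finite_measure "count_space (UNIV :: 'k set)"
    by (rule sigma_finite_measure_count_space)
  have Km: "(\<lambda>\<omega>. emeasure (measure_pmf (K k \<omega>)) A) \<in> borel_measurable N" for k
    using K[of k] A by (simp add: pmf_kernel_def)
  have "(\<lambda>\<omega>. \<integral>\<^sup>+k. ennreal (pmf (p \<omega>) k) * emeasure (measure_pmf (K k \<omega>)) A \<partial>count_space UNIV) \<in> borel_measurable N"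
  proof (rule borel_measurable_nn_integral)
    show "(\<lambda>(\<omega>, k). ennreal (pmf (p \<omega>) k) * emeasure (measure_pmf (K k \<omega>)) A) \<in> borel_measurable (N \<Otimes>\<^sub>M count_space UNIV)"
      unfolding split_beta'
    proof (rule measurable_compose_countable[where g = snd and
          f = "\<lambda>k z. ennreal (pmf (p (fst z)) k) * emeasure (measure_pmf (K k (fst z))) A"])
      show "(\<lambda>z. ennreal (pmf (p (fst z)) k) * emeasure (measure_pmf (K k (fst z))) A) \<in> borel_measurable (N \<Otimes>\<^sub>M count_space UNIV)" for k
        by (intro borel_measurable_times_ennreal measurable_compose[OF measurable_fst Km]
            measurable_compose[OF measurable_compose[OF measurable_fst p] measurable_ennreal])
    qed measurable
  qed
  then show "(\<lambda>\<omega>. emeasure (measure_pmf (bind_pmf (p \<omega>) (\<lambda>k. K k \<omega>))) A) \<in> borel_measurable N"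
    by (simp add: nn_integral_measure_pmf)
qed

context bilevel_problem
begin

text \<open>The data that an iteration uses before it samples: decision, context and the oracle's policy.\<close>

abbreviation situation_algebra :: "(((real ^ 'd) \<times> 'c) \<times> ('s, 'a) policy) measure" where
  "situation_algebra \<equiv> (borel \<Otimes>\<^sub>M \<Xi>) \<Otimes>\<^sub>M policy_algebra"

lemma space_situation:
  "\<omega> \<in> space situation_algebra \<longleftrightarrow> snd (fst \<omega>) \<in> space \<Xi> \<and> is_policy (snd \<omega>)"
  by (auto simp: space_pair_measure policy_algebra_def space_restrict_space mem_Times_iff)

lemma measurable_situation_components:
  "(\<lambda>\<omega>. fst (fst \<omega>)) \<in> borel_measurable situation_algebra"
  "(\<lambda>\<omega>. snd (fst \<omega>)) \<in> measurable situation_algebra \<Xi>"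
  "snd \<in> borel_measurable situation_algebra"
proof -
  have "(\<lambda>\<pi>. \<pi>) \<in> borel_measurable (policy_algebra :: ('s, 'a) policy measure)"
    unfolding policy_algebra_def by (intro measurable_restrict_space1) simp
  then show "snd \<in> borel_measurable situation_algebra"
    by (rule measurable_compose[OF measurable_snd])
qed (intro measurable_compose[OF measurable_fst] measurable_fst measurable_snd)+

lemma reward_measurable: "(\<lambda>\<omega>. reward (M (fst (fst \<omega>)) (snd (fst \<omega>))) s a) \<in> borel_measurable situation_algebra"
proof (rule Caratheodory_compose[where S = UNIV and N = \<Xi> and f = "\<lambda>x \<xi>. reward (M x \<xi>) s a"])
  show "continuous_on UNIV (\<lambda>x. reward (M x \<xi>) s a)" if "\<xi> \<in> space \<Xi>" for \<xi>
    using GDERIV_continuous[OF GDERIV_reward[OF that]] by (simp add: continuous_on_eq_continuous_at)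
qed (use mdps in \<open>auto simp: regular_mdps_def intro: measurable_situation_components\<close>)

lemma trans_measurable: "(\<lambda>\<omega>. pmf (trans (M (fst (fst \<omega>)) (snd (fst \<omega>))) s a) s') \<in> borel_measurable situation_algebra"
proof (rule Caratheodory_compose[where S = UNIV and N = \<Xi> and f = "\<lambda>x \<xi>. pmf (trans (M x \<xi>) s a) s'"])
  show "continuous_on UNIV (\<lambda>x. pmf (trans (M x \<xi>) s a) s')" if "\<xi> \<in> space \<Xi>" for \<xi>
    using GDERIV_continuous[OF GDERIV_trans[OF that]] by (simp add: continuous_on_eq_continuous_at)
qed (use mdps in \<open>auto simp: regular_mdps_def intro: measurable_situation_components\<close>)

lemma Lipschitz_imp_continuous_on:
  fixes g :: "'u::real_normed_vector \<Rightarrow> 'v::real_normed_vector"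
  assumes "\<And>x y. x \<in> A \<Longrightarrow> y \<in> A \<Longrightarrow> norm (g x - g y) \<le> C * norm (x - y)" "0 \<le> C"
  shows "continuous_on A g"
proof -
  have "C-lipschitz_on A g"
    using assms by (intro lipschitz_onI) (auto simp: dist_norm)
  then show ?thesis by (rule lipschitz_on_continuous_on)
qed

lemma grad_reward_measurable:
  "(\<lambda>\<omega>. grad_reward M (fst (fst \<omega>)) (snd (fst \<omega>)) s a) \<in> borel_measurable situation_algebra"
proof (rule Caratheodory_compose[where S = UNIV and N = \<Xi> and f = "\<lambda>x \<xi>. grad_reward M x \<xi> s a"])
  show "continuous_on UNIV (\<lambda>x. grad_reward M x \<xi> s a)" if "\<xi> \<in> space \<Xi>" for \<xi>
    by (rule Lipschitz_imp_continuous_on[OF grad_reward_Lipschitz[OF that] slopes_nonneg(3)])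
  show "(\<lambda>\<xi>. grad_reward M x \<xi> s a) \<in> borel_measurable \<Xi>" for x
    by (rule borel_measurable_gradient_parameter[OF open_UNIV UNIV_I _ GDERIV_reward])
       (use mdps in \<open>auto simp: regular_mdps_def\<close>)
qed (auto intro: measurable_situation_components)

lemma GDERIV_log_trans:
  assumes \<xi>: "\<xi> \<in> space \<Xi>"
  shows "GDERIV (\<lambda>y. ln (pmf (trans (M y \<xi>) s a) s')) x :> grad_log_trans M x \<xi> s a s'"
proof (cases "pmf (trans (M x \<xi>) s a) s' = 0")
  case True
  then have "pmf (trans (M y \<xi>) s a) s' = 0" for y
    using trans_support_constant[OF \<xi>, of y s a s' x] by (metis less_irrefl pmf_pos)
  then show ?thesis
    by (simp add: grad_log_trans_def gradient_eqI[OF GDERIV_const] GDERIV_const)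
next
  case False
  then have "0 < pmf (trans (M x \<xi>) s a) s'" by (simp add: pmf_pos)
  then have "GDERIV (\<lambda>y. ln (pmf (trans (M y \<xi>) s a) s')) x :> (1 / pmf (trans (M x \<xi>) s a) s') *\<^sub>R grad_trans x \<xi> s a s'"
    by (intro GDERIV_DERIV_compose GDERIV_trans \<xi>) (auto intro!: derivative_eq_intros)
  then show ?thesis
    unfolding grad_log_trans_def by (simp add: gradient_eqI)
qed

text \<open>A transition that is impossible for one decision is impossible for all; its logarithm is then the
  constant \<open>ln 0 = 0\<close>, with gradient zero.\<close>

lemma grad_log_trans_measurable:
  "(\<lambda>\<omega>. grad_log_trans M (fst (fst \<omega>)) (snd (fst \<omega>)) s a s') \<in> borel_measurable situation_algebra"
proof (rule Caratheodory_compose[where S = UNIV and N = \<Xi> and f = "\<lambda>x \<xi>. grad_log_trans M x \<xi> s a s'"])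
  show "continuous_on UNIV (\<lambda>x. grad_log_trans M x \<xi> s a s')" if \<xi>: "\<xi> \<in> space \<Xi>" for \<xi>
  proof (rule Lipschitz_imp_continuous_on[OF _ slopes_nonneg(3)])
    fix y x
    show "norm (grad_log_trans M y \<xi> s a s' - grad_log_trans M x \<xi> s a s') \<le> smoothness * norm (y - x)"
    proof (cases "0 < pmf (trans (M x \<xi>) s a) s'")
      case True
      then show ?thesis by (rule grad_log_trans_Lipschitz[OF \<xi>])
    next
      case False
      then have "pmf (trans (M u \<xi>) s a) s' = 0" for u
        using trans_support_constant[OF \<xi>, of u s a s' x] by (metis less_irrefl pmf_pos)
      then show ?thesis
        by (simp add: grad_log_trans_def gradient_eqI[OF GDERIV_const] slopes_nonneg)
    qed
  qed
  show "(\<lambda>\<xi>. grad_log_trans M x \<xi> s a s') \<in> borel_measurable \<Xi>" for x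
  proof (rule borel_measurable_gradient_parameter[OF open_UNIV UNIV_I _ GDERIV_log_trans])
    show "(\<lambda>\<xi>. ln (pmf (trans (M y \<xi>) s a) s')) \<in> borel_measurable \<Xi>" for y
      using mdps by (intro borel_measurable_ln) (simp add: regular_mdps_def)
  qed
qed (auto intro: measurable_situation_components)

lemma measurable_situation_loss_argument:
  "(\<lambda>\<omega>. (fst (fst \<omega>), snd \<omega>)) \<in> borel_measurable situation_algebra"
  unfolding borel_prod[symmetric] by (intro measurable_Pair measurable_situation_components)

lemma loss_derivative_measurable:
  fixes G :: "real ^ 'd \<Rightarrow> ('s, 'a) policy \<Rightarrow> 'c \<Rightarrow> 'v::euclidean_space"
  assumes lip: "\<And>\<xi> x1 x2 \<pi>1 \<pi>2. \<xi> \<in> space \<Xi> \<Longrightarrow> is_policy \<pi>1 \<Longrightarrow> is_policy \<pi>2 \<Longrightarrow>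
      norm (G x1 \<pi>1 \<xi> - G x2 \<pi>2 \<xi>) \<le> loss_smoothness * (norm (x1 - x2) + norm (\<pi>1 - \<pi>2))"
    and meas: "\<And>x \<pi>. is_policy \<pi> \<Longrightarrow> G x \<pi> \<in> borel_measurable \<Xi>"
  shows "(\<lambda>\<omega>. G (fst (fst \<omega>)) (snd \<omega>) (snd (fst \<omega>))) \<in> borel_measurable situation_algebra"
proof -
  let ?S = "(UNIV :: (real ^ 'd) set) \<times> {\<pi> :: ('s, 'a) policy. is_policy \<pi>}"
  have "(\<lambda>\<omega>. (\<lambda>z. G (fst z) (snd z)) (fst (fst \<omega>), snd \<omega>) (snd (fst \<omega>))) \<in> borel_measurable situation_algebra"
  proof (rule Caratheodory_compose[where S = ?S and N = \<Xi>])
    show "continuous_on ?S (\<lambda>z. G (fst z) (snd z) \<xi>)" if \<xi>: "\<xi> \<in> space \<Xi>" for \<xi>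
    proof (rule Lipschitz_imp_continuous_on[where C = "2 * loss_smoothness"])
      fix u w assume "u \<in> ?S" "w \<in> ?S"
      then have "norm (G (fst u) (snd u) \<xi> - G (fst w) (snd w) \<xi>)
          \<le> loss_smoothness * (norm (fst u - fst w) + norm (snd u - snd w))"
        by (intro lip \<xi>) auto
      also have "\<dots> \<le> loss_smoothness * (2 * norm (u - w))"
        using norm_fst_le[of "fst u - fst w" "snd u - snd w"] norm_snd_le[of "snd u - snd w" "fst u - fst w"]
        by (intro mult_left_mono loss_smoothness_nonneg) (simp add: minus_prod_def)
      finally show "norm (G (fst u) (snd u) \<xi> - G (fst w) (snd w) \<xi>) \<le> 2 * loss_smoothness * norm (u - w)"
        by simp
    qed (use loss_smoothness_nonneg in simp)
    show "G (fst z) (snd z) \<in> borel_measurable \<Xi>" if "z \<in> ?S" for z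
      using that by (auto intro: meas)
  qed (use space_situation in \<open>auto intro: measurable_situation_loss_argument measurable_situation_components\<close>)
  then show ?thesis by simp
qed

lemma grad_loss_decision_measurable:
  "(\<lambda>\<omega>. gradient (\<lambda>y. f y (snd \<omega>) (snd (fst \<omega>))) (fst (fst \<omega>))) \<in> borel_measurable situation_algebra"
proof (rule loss_derivative_measurable[where G = "\<lambda>x \<pi> \<xi>. gradient (\<lambda>y. f y \<pi> \<xi>) x", OF loss_gradients_Lipschitz(1)])
  fix x :: "real ^ 'd" and \<pi> :: "('s, 'a) policy"
  assume \<pi>: "is_policy \<pi>"
  show "(\<lambda>\<xi>. gradient (\<lambda>y. f y \<pi> \<xi>) x) \<in> borel_measurable \<Xi>"
  proof (rule borel_measurable_gradient_parameter[OF open_UNIV UNIV_I _ GDERIV_loss(2)[OF _ \<pi>]])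
    show "f y \<pi> \<in> borel_measurable \<Xi>" for y
      using loss_domain \<pi> by (metis mem_Collect_eq subsetD)
  qed
qed

lemma grad_loss_policy_measurable:
  "(\<lambda>\<omega>. gradient (\<lambda>p. f (fst (fst \<omega>)) p (snd (fst \<omega>))) (snd \<omega>)) \<in> borel_measurable situation_algebra"
proof (rule loss_derivative_measurable[where G = "\<lambda>x \<pi> \<xi>. gradient (\<lambda>p. f x p \<xi>) \<pi>", OF loss_gradients_Lipschitz(2)])
  fix x :: "real ^ 'd" and \<pi> :: "('s, 'a) policy"
  assume \<pi>: "is_policy \<pi>"
  obtain U where U: "open U" "{\<pi>. is_policy \<pi>} \<subseteq> U" "\<And>x \<pi>. \<pi> \<in> U \<Longrightarrow> f x \<pi> \<in> borel_measurable \<Xi>"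
    using loss_domain by metis
  then have "\<pi> \<in> U" using \<pi> by auto
  then show "(\<lambda>\<xi>. gradient (\<lambda>p. f x p \<xi>) \<pi>) \<in> borel_measurable \<Xi>"
    by (rule borel_measurable_gradient_parameter[OF U(1) _ U(3) GDERIV_loss(3)[OF _ \<pi>]])
qed

lemma policy_nth_measurable: "(\<lambda>\<omega>. snd \<omega> $ z) \<in> borel_measurable situation_algebra"
  by (rule measurable_compose[OF measurable_situation_components(3)])
     (intro borel_measurable_continuous_onI continuous_intros)

lemma reg_reward_measurable:
  "(\<lambda>\<omega>. reg_reward \<kappa> (M (fst (fst \<omega>)) (snd (fst \<omega>))) (snd \<omega>) z) \<in> borel_measurable situation_algebra"
  unfolding reg_reward_def policy_entropy_def
  by (intro borel_measurable_add borel_measurable_times borel_measurable_uminus borel_measurable_sum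
      borel_measurable_ln borel_measurable_const reward_measurable policy_nth_measurable)

lemma path_gradient_measurable:
  "(\<lambda>\<omega>. path_gradient (fst (fst \<omega>)) (snd (fst \<omega>)) (snd \<omega>) T T' \<tau>) \<in> borel_measurable situation_algebra"
  unfolding path_gradient_def discounted_rewards_def
  by (intro borel_measurable_add borel_measurable_scaleR borel_measurable_times borel_measurable_sum
      borel_measurable_const grad_reward_measurable reg_reward_measurable grad_log_trans_measurable)

lemma action_weight_measurable: "(\<lambda>\<omega>. pmf (action_pmf (snd \<omega>) s) a) \<in> borel_measurable situation_algebra"
proof -
  have "(\<lambda>\<omega>. pmf (action_pmf (snd \<omega>) s) a) \<in> borel_measurable situation_algebra
      \<longleftrightarrow> (\<lambda>\<omega>. snd \<omega> $ (s, a)) \<in> borel_measurable situation_algebra"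
    by (rule measurable_cong) (simp add: space_situation pmf_action_pmf)
  then show ?thesis using policy_nth_measurable by simp
qed

lemma start_weight_measurable: "(\<lambda>\<omega>. pmf (start_pmf (snd \<omega>) s) z) \<in> borel_measurable situation_algebra"
proof (cases "fst z = s")
  case True
  then have eq: "pmf (start_pmf (snd \<omega>) s) z = pmf (action_pmf (snd \<omega>) s) (snd z)" for \<omega> :: "((real ^ 'd) \<times> 'c) \<times> ('s, 'a) policy"
    unfolding start_pmf_def using pmf_map_inj'[of "Pair s" "action_pmf (snd \<omega>) s" "snd z"]
    by (auto simp: inj_on_def)
  show ?thesis unfolding eq by (rule action_weight_measurable)
next
  case False
  then have "pmf (start_pmf (snd \<omega>) s) z = 0" for \<omega> :: "((real ^ 'd) \<times> 'c) \<times> ('s, 'a) policy"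
    unfolding start_pmf_def by (intro pmf_map_outside) auto
  then show ?thesis by simp
qed

lemma step_weight_measurable:
  "(\<lambda>\<omega>. pmf (step_pmf (M (fst (fst \<omega>)) (snd (fst \<omega>))) (snd \<omega>) z) z') \<in> borel_measurable situation_algebra"
  unfolding step_pmf_def pmf_bind expectation_finite_type real_scaleR_def
  by (intro borel_measurable_sum borel_measurable_times trans_measurable start_weight_measurable)

lemma trajectory_weight_measurable:
  "(\<lambda>\<omega>. pmf (trajectory_pmf (M (fst (fst \<omega>)) (snd (fst \<omega>))) (snd \<omega>) n z) \<tau>) \<in> borel_measurable situation_algebra"
proof (induction n arbitrary: z \<tau>)
  case 0
  then show ?case by simp
next
  case (Suc n)
  let ?m = "\<lambda>\<omega>. M (fst (fst \<omega>)) (snd (fst \<omega>))"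
  have "(\<lambda>\<omega>. pmf (map_pmf (Cons z) (trajectory_pmf (?m \<omega>) (snd \<omega>) n z')) \<tau>) \<in> borel_measurable situation_algebra" for z'
  proof (cases "\<exists>\<tau>'. \<tau> = z # \<tau>'")
    case True
    then obtain \<tau>' where \<tau>: "\<tau> = z # \<tau>'" by blast
    have "pmf (map_pmf (Cons z) (trajectory_pmf (?m \<omega>) (snd \<omega>) n z')) \<tau> = pmf (trajectory_pmf (?m \<omega>) (snd \<omega>) n z') \<tau>'" for \<omega>
      unfolding \<tau> by (rule pmf_map_inj') simp
    then show ?thesis using Suc by simp
  next
    case False
    then have "pmf (map_pmf (Cons z) (trajectory_pmf (?m \<omega>) (snd \<omega>) n z')) \<tau> = 0" for \<omega>
      by (intro pmf_map_outside) auto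
    then show ?thesis by simp
  qed
  then show ?case
    unfolding trajectory_pmf.simps pmf_bind expectation_finite_type real_scaleR_def
    by (intro borel_measurable_sum borel_measurable_times step_weight_measurable)
qed

text \<open>After the nested draws are flattened, each draw is from a countable set, and the last step returns a
  measurable function of the parameter.\<close>

lemma hypergradient_estimator_kernel:
  fixes \<nu> :: "'s pmf"
  shows "pmf_kernel situation_algebra
    (\<lambda>\<omega>. map_pmf (\<lambda>g. fst (fst \<omega>) - \<alpha> *\<^sub>R g) (hypergradient_estimator \<gamma> \<kappa> M f \<nu> (fst (fst \<omega>)) (snd (fst \<omega>)) (snd \<omega>)))"
  unfolding hypergradient_estimator_def gradient_estimator_def return_gradient_estimator_eq
    map_pmf_def bind_assoc_pmf bind_return_pmf
  by (intro pmf_kernel_bind pmf_kernel_return borel_measurable_const action_weight_measurable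
      start_weight_measurable trajectory_weight_measurable borel_measurable_diff borel_measurable_add
      borel_measurable_scaleR borel_measurable_times grad_loss_decision_measurable
      path_gradient_measurable measurable_situation_components(1)
      measurable_compose[OF grad_loss_policy_measurable]
      borel_measurable_continuous_onI continuous_intros)

definition step_law :: "'s pmf \<Rightarrow> real \<Rightarrow> real ^ 'd \<Rightarrow> 'c \<Rightarrow> ('s, 'a) policy \<Rightarrow> (real ^ 'd) measure" where
  "step_law \<nu> \<alpha> x \<xi> \<pi> = distr (measure_pmf (hypergradient_estimator \<gamma> \<kappa> M f \<nu> x \<xi> \<pi>)) borel (\<lambda>g. x - \<alpha> *\<^sub>R g)"

lemma step_law_measurable:
  "(\<lambda>\<omega>. step_law \<nu> \<alpha> (fst (fst \<omega>)) (snd (fst \<omega>)) (snd \<omega>)) \<in> measurable situation_algebra (subprob_algebra borel)"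
proof (rule measurable_subprob_algebra)
  fix \<omega>
  show "subprob_space (step_law \<nu> \<alpha> (fst (fst \<omega>)) (snd (fst \<omega>)) (snd \<omega>))"
    unfolding step_law_def
    by (intro prob_space_imp_subprob_space measure_pmf.prob_space_distr) simp
  show "sets (step_law \<nu> \<alpha> (fst (fst \<omega>)) (snd (fst \<omega>)) (snd \<omega>)) = sets borel"
    by (simp add: step_law_def)
next
  fix A :: "(real ^ 'd) set" assume A: "A \<in> sets borel"
  have "emeasure (step_law \<nu> \<alpha> x \<xi> \<pi>) A =
      emeasure (measure_pmf (map_pmf (\<lambda>g. x - \<alpha> *\<^sub>R g) (hypergradient_estimator \<gamma> \<kappa> M f \<nu> x \<xi> \<pi>))) A" for x \<xi> \<pi>
    using A by (simp add: step_law_def emeasure_distr)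
  then show "(\<lambda>\<omega>. emeasure (step_law \<nu> \<alpha> (fst (fst \<omega>)) (snd (fst \<omega>)) (snd \<omega>)) A) \<in> borel_measurable situation_algebra"
    using hypergradient_estimator_kernel[of \<alpha> \<nu>] A by (simp add: pmf_kernel_def)
qed

lemma hpgd_step_eq:
  "hpgd_step \<Xi> \<gamma> \<kappa> M f \<nu> orc \<alpha> x = \<Xi> \<bind> (\<lambda>\<xi>. orc x \<xi> \<bind> step_law \<nu> \<alpha> x \<xi>)"
  by (simp add: hpgd_step_def step_law_def[abs_def])

lemma oracle_step_measurable:
  assumes orc: "(\<lambda>(x, \<xi>). orc x \<xi>) \<in> measurable (borel \<Otimes>\<^sub>M \<Xi>) (prob_algebra policy_algebra)"
  shows "(\<lambda>z. orc (fst z) (snd z) \<bind> step_law \<nu> \<alpha> (fst z) (snd z))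
    \<in> measurable (borel \<Otimes>\<^sub>M \<Xi>) (subprob_algebra borel)"
proof (rule measurable_bind)
  show "(\<lambda>z. orc (fst z) (snd z)) \<in> measurable (borel \<Otimes>\<^sub>M \<Xi>) (subprob_algebra policy_algebra)"
    using measurable_prob_algebraD[OF orc] by (simp add: split_beta')
  show "(\<lambda>\<omega>. step_law \<nu> \<alpha> (fst (fst \<omega>)) (snd (fst \<omega>)) (snd \<omega>)) \<in> measurable situation_algebra (subprob_algebra borel)"
    by (rule step_law_measurable)
qed

lemma hpgd_step_measurable:
  assumes orc: "(\<lambda>(x, \<xi>). orc x \<xi>) \<in> measurable (borel \<Otimes>\<^sub>M \<Xi>) (prob_algebra policy_algebra)"
  shows "hpgd_step \<Xi> \<gamma> \<kappa> M f \<nu> orc \<alpha> \<in> measurable borel (subprob_algebra borel)"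
  unfolding hpgd_step_eq[abs_def]
proof (rule measurable_bind)
  show "(\<lambda>x. \<Xi>) \<in> measurable borel (subprob_algebra \<Xi>)"
    using prob_space_Xi by (intro measurable_const) (simp add: space_subprob_algebra prob_space_imp_subprob_space)
  show "(\<lambda>z. orc (fst z) (snd z) \<bind> step_law \<nu> \<alpha> (fst z) (snd z)) \<in> measurable (borel \<Otimes>\<^sub>M \<Xi>) (subprob_algebra borel)"
    by (rule oracle_step_measurable[OF orc])
qed

end

section \<open>The leader's objective\<close>

lemma GDERIV_of_quadratic_remainder:
  fixes g :: "'v::real_inner \<Rightarrow> real"
  assumes "\<And>y. \<bar>g y - g x - inner (y - x) D\<bar> \<le> C * (norm (y - x))\<^sup>2"
  shows "GDERIV g x :> D"
  unfolding gderiv_def has_derivative_iff_norm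
proof (intro conjI bounded_linear_inner_left)
  have "norm (norm (g y - g x - inner (y - x) D) / norm (y - x)) \<le> \<bar>C\<bar> * norm (y - x)" for y
  proof (cases "y = x")
    case False
    have "\<bar>g y - g x - inner (y - x) D\<bar> \<le> \<bar>C\<bar> * (norm (y - x))\<^sup>2"
      by (rule order_trans[OF assms]) (simp add: mult_right_mono)
    with False show ?thesis
      by (simp add: divide_le_eq power2_eq_square mult.assoc)
  qed simp
  then show "((\<lambda>y. norm (g y - g x - inner (y - x) D) / norm (y - x)) \<longlongrightarrow> 0) (at x)"
  proof (rule Lim_null_comparison[OF always_eventually[OF allI]])
    show "((\<lambda>y. \<bar>C\<bar> * norm (y - x)) \<longlongrightarrow> 0) (at x)"
      by (intro tendsto_mult_right_zero tendsto_norm_zero LIM_zero tendsto_ident_at)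
  qed
qed

locale leader_problem = bilevel_problem \<Xi> M f \<gamma> \<kappa> L S R K\<^sub>1 K\<^sub>2 K\<^sub>3
  for \<Xi> :: "'c measure"
    and M :: "real ^ 'd::finite \<Rightarrow> 'c \<Rightarrow> ('s::finite, 'a::finite) mdp"
    and f :: "real ^ 'd \<Rightarrow> ('s, 'a) policy \<Rightarrow> 'c \<Rightarrow> real"
    and \<gamma> \<kappa> L S R K\<^sub>1 K\<^sub>2 K\<^sub>3 :: real +
  fixes \<nu> :: "'s pmf" and xmin :: "real ^ 'd"
  assumes loss_integrable: "\<And>x. integrable \<Xi> (\<lambda>\<xi>. f x (follower_policy \<gamma> \<kappa> (M x \<xi>)) \<xi>)"
    and xmin: "\<And>x. leader_objective \<Xi> \<gamma> \<kappa> M f xmin \<le> leader_objective \<Xi> \<gamma> \<kappa> M f x"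
    and full_support: "set_pmf \<nu> = UNIV"
begin

sublocale context_space: prob_space \<Xi>
  by (rule prob_space_Xi)

abbreviation F :: "real ^ 'd \<Rightarrow> real" where
  "F \<equiv> leader_objective \<Xi> \<gamma> \<kappa> M f"

lemma F_eq: "F x = (\<integral>\<xi>. f x (follower x \<xi>) \<xi> \<partial>\<Xi>)"
  by (simp add: leader_objective_def follower_policy_eq_soft_policy[OF \<gamma>_nonneg \<gamma>_less \<kappa>_pos])

lemma composed_loss_integrable: "integrable \<Xi> (\<lambda>\<xi>. f x (follower x \<xi>) \<xi>)"
  using loss_integrable[of x] by (simp add: follower_policy_eq_soft_policy[OF \<gamma>_nonneg \<gamma>_less \<kappa>_pos])

definition F_gradient :: "real ^ 'd \<Rightarrow> real ^ 'd" where
  "F_gradient x = (\<integral>\<xi>. hypergradient x \<xi> (follower x \<xi>) \<partial>\<Xi>)"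

lemma hypergradient_integrable: "integrable \<Xi> (\<lambda>\<xi>. hypergradient x \<xi> (follower x \<xi>))"
proof -
  obtain C where C: "\<forall>\<xi>\<in>space \<Xi>. \<forall>x y. \<bar>f y (follower y \<xi>) \<xi> - f x (follower x \<xi>) \<xi>
      - inner (y - x) (hypergradient x \<xi> (follower x \<xi>))\<bar> \<le> C * (norm (y - x))\<^sup>2"
    using composed_loss_quadratic by blast
  obtain B where B: "\<forall>\<xi>\<in>space \<Xi>. \<forall>x. norm (hypergradient x \<xi> (follower x \<xi>)) \<le> B"
    using hypergradient_follower_bounded by blast
  show ?thesis
  proof (rule context_space.integrable_const_bound)
    show "AE \<xi> in \<Xi>. norm (hypergradient x \<xi> (follower x \<xi>)) \<le> B"
      using B by (intro AE_I2) auto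
    show "(\<lambda>\<xi>. hypergradient x \<xi> (follower x \<xi>)) \<in> borel_measurable \<Xi>"
    proof (rule borel_measurable_gradient_parameter[OF open_UNIV UNIV_I])
      show "(\<lambda>\<xi>. f y (follower y \<xi>) \<xi>) \<in> borel_measurable \<Xi>" for y
        using composed_loss_integrable by (rule borel_measurable_integrable)
      show "GDERIV (\<lambda>y. f y (follower y \<xi>) \<xi>) x :> hypergradient x \<xi> (follower x \<xi>)" if "\<xi> \<in> space \<Xi>" for \<xi>
        using C that by (intro GDERIV_of_quadratic_remainder) auto
    qed
  qed
qed

lemma inner_F_gradient: "inner v (F_gradient x) = (\<integral>\<xi>. inner v (hypergradient x \<xi> (follower x \<xi>)) \<partial>\<Xi>)"
  using hypergradient_integrable by (simp add: F_gradient_def)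

lemma F_quadratic: "\<exists>C\<ge>0. \<forall>x y. \<bar>F y - F x - inner (y - x) (F_gradient x)\<bar> \<le> C * (norm (y - x))\<^sup>2"
proof -
  obtain C where C: "0 \<le> C" "\<forall>\<xi>\<in>space \<Xi>. \<forall>x y. \<bar>f y (follower y \<xi>) \<xi> - f x (follower x \<xi>) \<xi>
      - inner (y - x) (hypergradient x \<xi> (follower x \<xi>))\<bar> \<le> C * (norm (y - x))\<^sup>2"
    using composed_loss_quadratic by blast
  have "\<bar>F y - F x - inner (y - x) (F_gradient x)\<bar> \<le> C * (norm (y - x))\<^sup>2" for x y
  proof -
    let ?e = "\<lambda>\<xi>. f y (follower y \<xi>) \<xi> - f x (follower x \<xi>) \<xi> - inner (y - x) (hypergradient x \<xi> (follower x \<xi>))"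
    have int: "integrable \<Xi> ?e"
      by (intro Bochner_Integration.integrable_diff composed_loss_integrable integrable_inner_right hypergradient_integrable)
    have eq: "F y - F x - inner (y - x) (F_gradient x) = (\<integral>\<xi>. ?e \<xi> \<partial>\<Xi>)"
      unfolding F_eq inner_F_gradient
      using composed_loss_integrable hypergradient_integrable by simp
    have "\<bar>F y - F x - inner (y - x) (F_gradient x)\<bar> \<le> (\<integral>\<xi>. \<bar>?e \<xi>\<bar> \<partial>\<Xi>)"
      unfolding eq by (rule integral_abs_bound)
    also have "\<dots> \<le> C * (norm (y - x))\<^sup>2"
      using int C(2)
      by (intro context_space.integral_le_const integrable_abs AE_I2) auto
    finally show ?thesis .
  qed
  with C(1) show ?thesis by blast
qed

lemma GDERIV_F: "GDERIV F x :> F_gradient x"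
  using F_quadratic by (auto intro: GDERIV_of_quadratic_remainder)

lemma gradient_F: "gradient F x = F_gradient x"
  by (rule gradient_eqI[OF GDERIV_F])

lemma F_differentiable: "F differentiable (at x)"
  using GDERIV_F[of x] unfolding gderiv_def differentiable_def by blast

lemma F_measurable: "F \<in> borel_measurable borel"
  using GDERIV_continuous[OF GDERIV_F]
  by (intro borel_measurable_continuous_onI) (simp add: continuous_on_eq_continuous_at)

text \<open>The gradient at \<open>w\<close> is the gradient at zero of \<open>F\<close> shifted by the parameter \<open>w\<close>.\<close>

lemma F_gradient_measurable: "F_gradient \<in> borel_measurable borel"
proof (rule borel_measurable_gradient_parameter[OF open_UNIV UNIV_I, where g = "\<lambda>y w. F (y + w)" and x = 0])
  show "(\<lambda>w. F (y + w)) \<in> borel_measurable borel" for y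
    by (rule measurable_compose[OF _ F_measurable]) simp
  show "GDERIV (\<lambda>y. F (y + w)) 0 :> F_gradient w" for w
  proof -
    obtain C where C: "\<forall>x y. \<bar>F y - F x - inner (y - x) (F_gradient x)\<bar> \<le> C * (norm (y - x))\<^sup>2"
      using F_quadratic by blast
    show ?thesis
      by (rule GDERIV_of_quadratic_remainder) (use C[rule_format, of "_ + w" w] in simp)
  qed
qed

lemma F_gradient_bounded: "\<exists>B\<ge>0. \<forall>x. norm (F_gradient x) \<le> B"
proof -
  obtain B where B: "0 \<le> B" "\<forall>\<xi>\<in>space \<Xi>. \<forall>x. norm (hypergradient x \<xi> (follower x \<xi>)) \<le> B"
    using hypergradient_follower_bounded by blast
  have "norm (F_gradient x) \<le> B" for x
  proof -
    have "norm (F_gradient x) \<le> (\<integral>\<xi>. norm (hypergradient x \<xi> (follower x \<xi>)) \<partial>\<Xi>)"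
      unfolding F_gradient_def by (rule integral_norm_bound)
    also have "\<dots> \<le> B"
      using B hypergradient_integrable
      by (intro context_space.integral_le_const integrable_norm AE_I2) auto
    finally show ?thesis .
  qed
  with B(1) show ?thesis by blast
qed

section \<open>Descent\<close>

lemma second_moment_real:
  fixes p :: "('v::euclidean_space) pmf"
  assumes "(\<integral>\<^sup>+g. ennreal ((norm g)\<^sup>2) \<partial>measure_pmf p) \<le> ennreal G" "0 \<le> G"
  shows "integrable (measure_pmf p) (\<lambda>g. (norm g)\<^sup>2)" and "(\<integral>g. (norm g)\<^sup>2 \<partial>measure_pmf p) \<le> G"
proof -
  show int: "integrable (measure_pmf p) (\<lambda>g. (norm g)\<^sup>2)"
    using le_less_trans[OF assms(1) ennreal_less_top] by (intro integrableI_bounded) auto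
  show "(\<integral>g. (norm g)\<^sup>2 \<partial>measure_pmf p) \<le> G"
    using assms int by (simp add: nn_integral_eq_integral)
qed

text \<open>The quadratic remainder of \<open>F\<close> at the random next iterate, averaged over the estimator for a fixed
  context and a fixed policy. The bound \<open>u\<close> exceeds the mean of a nonnegative function; its sign is
  recorded so that the outer integrals of \<open>ennreal u\<close> can be evaluated as integrals of reals.\<close>

lemma step_law_descent:
  "\<exists>b\<ge>0. \<exists>c\<ge>0. \<forall>\<xi>\<in>space \<Xi>. \<forall>x \<pi> \<alpha>. is_policy \<pi> \<longrightarrow> 0 < \<alpha> \<longrightarrow>
     (let u = F x - F xmin - \<alpha> * inner (F_gradient x) (hypergradient x \<xi> (follower x \<xi>))
            + \<alpha> * b * infnorm (follower x \<xi> - \<pi>) + \<alpha>\<^sup>2 * c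
      in 0 \<le> u \<and> (\<integral>\<^sup>+y. ennreal (F y - F xmin) \<partial>step_law \<nu> \<alpha> x \<xi> \<pi>) \<le> ennreal u)"
proof -
  obtain C where C: "0 \<le> C" "\<forall>x y. \<bar>F y - F x - inner (y - x) (F_gradient x)\<bar> \<le> C * (norm (y - x))\<^sup>2"
    using F_quadratic by blast
  obtain BF where BF: "0 \<le> BF" "\<forall>x. norm (F_gradient x) \<le> BF"
    using F_gradient_bounded by blast
  obtain B where B: "0 \<le> B" "\<forall>\<xi>\<in>space \<Xi>. \<forall>x \<pi>. is_policy \<pi> \<longrightarrow>
     norm (hypergradient x \<xi> \<pi> - hypergradient x \<xi> (follower x \<xi>)) \<le> B * norm (\<pi> - follower x \<xi>)"
    using hypergradient_Lipschitz_at_follower by blast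
  obtain G where G: "0 \<le> G" "\<forall>\<xi>\<in>space \<Xi>. \<forall>x \<pi>. is_policy \<pi> \<longrightarrow>
    (\<integral>\<^sup>+g. ennreal ((norm g)\<^sup>2) \<partial>hypergradient_estimator \<gamma> \<kappa> M f \<nu> x \<xi> \<pi>) \<le> ennreal G"
    using hypergradient_estimator_second_moment[OF full_support] by blast
  define b where "b = BF * (B * sqrt DIM(('s, 'a) policy))"
  define c where "c = C * G"
  have bc: "0 \<le> b" "0 \<le> c"
    using BF B C G by (simp_all add: b_def c_def)
  have main: "0 \<le> u \<and> (\<integral>\<^sup>+y. ennreal (F y - F xmin) \<partial>step_law \<nu> \<alpha> x \<xi> \<pi>) \<le> ennreal u"
    if \<xi>: "\<xi> \<in> space \<Xi>" and \<pi>: "is_policy \<pi>" and \<alpha>: "0 < \<alpha>"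
      and u: "u = F x - F xmin - \<alpha> * inner (F_gradient x) (hypergradient x \<xi> (follower x \<xi>))
            + \<alpha> * b * infnorm (follower x \<xi> - \<pi>) + \<alpha>\<^sup>2 * c" for \<xi> x \<pi> \<alpha> u
  proof -
    let ?p = "hypergradient_estimator \<gamma> \<kappa> M f \<nu> x \<xi> \<pi>"
    let ?D = "F_gradient x"
    let ?h = "\<lambda>g. F x - F xmin - \<alpha> * inner ?D g + C * \<alpha>\<^sup>2 * (norm g)\<^sup>2"
    have le: "F (x - \<alpha> *\<^sub>R g) - F xmin \<le> ?h g" for g
    proof -
      have "\<bar>F (x - \<alpha> *\<^sub>R g) - F x + \<alpha> * inner ?D g\<bar> \<le> C * (\<alpha>\<^sup>2 * (norm g)\<^sup>2)"
        using C(2)[rule_format, of "x - \<alpha> *\<^sub>R g" x] \<alpha> by (simp add: power_mult_distrib inner_commute)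
      then show ?thesis by (simp add: mult.assoc)
    qed
    have nn: "0 \<le> ?h g" for g
      using le[of g] xmin[of "x - \<alpha> *\<^sub>R g"] by linarith
    note G' = G(2)[rule_format, OF \<xi> \<pi>, of x]
    have int1: "integrable ?p (inner ?D)"
      by (rule hypergradient_estimator_integrable[OF full_support \<xi> \<pi>])
    have int2: "integrable ?p (\<lambda>g. (norm g)\<^sup>2)" and sq: "(\<integral>g. (norm g)\<^sup>2 \<partial>?p) \<le> G"
      using second_moment_real[OF G' G(1)] by auto
    have int: "integrable ?p ?h"
      using int1 int2 by simp
    have eq: "(\<integral>g. ?h g \<partial>?p) = F x - F xmin - \<alpha> * inner ?D (hypergradient x \<xi> \<pi>) + C * \<alpha>\<^sup>2 * (\<integral>g. (norm g)\<^sup>2 \<partial>?p)"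
      using int1 int2 by (simp add: hypergradient_estimator_mean[OF full_support \<xi> \<pi>])
    have bias: "- inner ?D (hypergradient x \<xi> \<pi>) \<le> - inner ?D (hypergradient x \<xi> (follower x \<xi>)) + b * infnorm (follower x \<xi> - \<pi>)"
    proof -
      have "norm (\<pi> - follower x \<xi>) \<le> sqrt DIM(('s, 'a) policy) * infnorm (follower x \<xi> - \<pi>)"
        using norm_le_infnorm[of "follower x \<xi> - \<pi>"] by (simp add: norm_minus_commute)
      then have "B * norm (\<pi> - follower x \<xi>) \<le> B * (sqrt DIM(('s, 'a) policy) * infnorm (follower x \<xi> - \<pi>))"
        by (rule mult_left_mono[OF _ B(1)])
      with B(2)[rule_format, OF \<xi> \<pi>, of x]
      have "norm (hypergradient x \<xi> (follower x \<xi>) - hypergradient x \<xi> \<pi>)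
          \<le> B * (sqrt DIM(('s, 'a) policy) * infnorm (follower x \<xi> - \<pi>))"
        by (simp add: norm_minus_commute)
      then have "norm ?D * norm (hypergradient x \<xi> (follower x \<xi>) - hypergradient x \<xi> \<pi>)
          \<le> BF * (B * (sqrt DIM(('s, 'a) policy) * infnorm (follower x \<xi> - \<pi>)))"
        using BF by (intro mult_mono) auto
      moreover have "inner ?D (hypergradient x \<xi> (follower x \<xi>) - hypergradient x \<xi> \<pi>)
          \<le> norm ?D * norm (hypergradient x \<xi> (follower x \<xi>) - hypergradient x \<xi> \<pi>)"
        by (rule norm_cauchy_schwarz)
      ultimately show ?thesis
        by (simp add: b_def inner_diff_right mult.assoc)
    qed
    have h_le: "(\<integral>g. ?h g \<partial>?p) \<le> u"
    proof -
      have "\<alpha> * (- inner ?D (hypergradient x \<xi> \<pi>)) \<le> \<alpha> * (- inner ?D (hypergradient x \<xi> (follower x \<xi>)) + b * infnorm (follower x \<xi> - \<pi>))"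
        using bias \<alpha> by (intro mult_left_mono) auto
      moreover have "C * \<alpha>\<^sup>2 * (\<integral>g. (norm g)\<^sup>2 \<partial>?p) \<le> C * \<alpha>\<^sup>2 * G"
        using sq C(1) by (intro mult_left_mono) auto
      ultimately show ?thesis
        unfolding eq u c_def by (simp add: algebra_simps)
    qed
    have h_nn: "0 \<le> (\<integral>g. ?h g \<partial>?p)"
      by (intro Bochner_Integration.integral_nonneg nn)
    have "(\<integral>\<^sup>+y. ennreal (F y - F xmin) \<partial>step_law \<nu> \<alpha> x \<xi> \<pi>) \<le> ennreal (\<integral>g. ?h g \<partial>?p)"
    proof -
      have "(\<integral>\<^sup>+y. ennreal (F y - F xmin) \<partial>step_law \<nu> \<alpha> x \<xi> \<pi>) = (\<integral>\<^sup>+g. ennreal (F (x - \<alpha> *\<^sub>R g) - F xmin) \<partial>?p)"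
        unfolding step_law_def by (rule nn_integral_distr) (use F_measurable in \<open>auto\<close>)
      also have "\<dots> \<le> (\<integral>\<^sup>+g. ennreal (?h g) \<partial>?p)"
        by (intro nn_integral_mono ennreal_leI le)
      also have "\<dots> = ennreal (\<integral>g. ?h g \<partial>?p)"
        using int nn by (intro nn_integral_eq_integral) auto
      finally show ?thesis .
    qed
    then have "(\<integral>\<^sup>+y. ennreal (F y - F xmin) \<partial>step_law \<nu> \<alpha> x \<xi> \<pi>) \<le> ennreal u"
      by (rule order_trans[OF _ ennreal_leI[OF h_le]])
    with order_trans[OF h_nn h_le] show ?thesis
      by (rule conjI)
  qed
  show ?thesis
    unfolding Let_def
  proof (rule exI[of _ b], rule conjI[OF bc(1)], rule exI[of _ c], rule conjI[OF bc(2)], intro ballI allI impI)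
    fix \<xi> x and \<alpha> :: real and \<pi> :: "('s, 'a) policy"
    assume "\<xi> \<in> space \<Xi>" "is_policy \<pi>" "0 < \<alpha>"
    then show "0 \<le> F x - F xmin - \<alpha> * inner (F_gradient x) (hypergradient x \<xi> (follower x \<xi>))
            + \<alpha> * b * infnorm (follower x \<xi> - \<pi>) + \<alpha>\<^sup>2 * c
      \<and> (\<integral>\<^sup>+y. ennreal (F y - F xmin) \<partial>step_law \<nu> \<alpha> x \<xi> \<pi>)
        \<le> ennreal (F x - F xmin - \<alpha> * inner (F_gradient x) (hypergradient x \<xi> (follower x \<xi>))
            + \<alpha> * b * infnorm (follower x \<xi> - \<pi>) + \<alpha>\<^sup>2 * c)"
      by (rule main) (rule refl)
  qed
qed

lemma infnorm_policy_diff_le: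
  fixes p q :: "('s, 'a) policy"
  assumes "is_policy p" "is_policy q"
  shows "infnorm (p - q) \<le> real CARD('s \<times> 'a)"
proof -
  have "\<bar>(p - q) $ z\<bar> \<le> 1" for z
    using policy_nth_bounds[OF assms(1), of z] policy_nth_bounds[OF assms(2), of z] by (simp add: abs_le_iff)
  then have "(\<Sum>z\<in>UNIV. \<bar>(p - q) $ z\<bar>) \<le> (\<Sum>z\<in>(UNIV::('s \<times> 'a) set). 1)"
    by (intro sum_mono)
  then show ?thesis
    using infnorm_le_norm[of "p - q"] norm_le_l1_cart[of "p - q"] by simp
qed

lemma infnorm_borel_measurable: "(infnorm :: 'v::euclidean_space \<Rightarrow> real) \<in> borel_measurable borel"
  by (intro borel_measurable_continuous_onI continuous_on_infnorm continuous_on_id)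

text \<open>The first moment of the error is bounded through the second, since the variance is nonnegative.\<close>

lemma oracle_error_mean:
  assumes orc: "delta_oracle \<Xi> \<gamma> \<kappa> M \<delta> orc" and \<xi>: "\<xi> \<in> space \<Xi>"
  shows "prob_space (orc x \<xi>)" and "sets (orc x \<xi>) = sets policy_algebra" and "space (orc x \<xi>) = {\<pi>. is_policy \<pi>}"
    and "integrable (orc x \<xi>) (\<lambda>\<pi>. infnorm (follower x \<xi> - \<pi>))"
    and "(\<integral>\<pi>. infnorm (follower x \<xi> - \<pi>) \<partial>orc x \<xi>) \<le> \<delta>"
proof -
  have "(\<lambda>(x, \<xi>). orc x \<xi>) \<in> measurable (borel \<Otimes>\<^sub>M \<Xi>) (prob_algebra policy_algebra)"
    using orc by (simp add: delta_oracle_def)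
  from measurable_space[OF this, of "(x, \<xi>)"] \<xi>
  have mem: "orc x \<xi> \<in> space (prob_algebra policy_algebra)"
    by (simp add: space_pair_measure)
  then have sets: "sets (orc x \<xi>) = sets policy_algebra" and prob: "prob_space (orc x \<xi>)"
    by (simp_all add: space_prob_algebra)
  show "prob_space (orc x \<xi>)" by (rule prob)
  show "sets (orc x \<xi>) = sets policy_algebra" by (rule sets)
  show space: "space (orc x \<xi>) = {\<pi>. is_policy \<pi>}"
    using sets_eq_imp_space_eq[OF sets] by (simp add: policy_algebra_def space_restrict_space)
  interpret O: prob_space "orc x \<xi>" by (rule prob)
  let ?e = "\<lambda>\<pi>. infnorm (follower x \<xi> - \<pi>)"
  have "?e \<in> borel_measurable policy_algebra"
    unfolding policy_algebra_def
    by (intro measurable_restrict_space1 measurable_compose[OF _ infnorm_borel_measurable]) simp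
  then have meas: "?e \<in> borel_measurable (orc x \<xi>)"
    by (simp add: measurable_cong_sets[OF sets refl])
  have bd: "\<bar>?e \<pi>\<bar> \<le> real CARD('s \<times> 'a)" if "\<pi> \<in> space (orc x \<xi>)" for \<pi>
    using infnorm_policy_diff_le[OF is_policy_soft_policy, of \<pi> \<gamma> \<kappa> "M x \<xi>"] that infnorm_pos_le[of "follower x \<xi> - \<pi>"]
    by (simp add: space)
  show int: "integrable (orc x \<xi>) ?e"
    by (rule O.integrable_const_bound[OF _ meas, of "real CARD('s \<times> 'a)"]) (use bd in \<open>auto intro!: AE_I2\<close>)
  have int2: "integrable (orc x \<xi>) (\<lambda>\<pi>. (?e \<pi>)\<^sup>2)"
  proof (rule O.integrable_const_bound[of _ "(real CARD('s \<times> 'a))\<^sup>2"])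
    show "AE \<pi> in orc x \<xi>. norm ((?e \<pi>)\<^sup>2) \<le> (real CARD('s \<times> 'a))\<^sup>2"
      using power_mono[OF bd abs_ge_zero, of _ 2] by (intro AE_I2) (simp del: of_nat_mult)
  qed (use meas in measurable)
  have "(\<integral>\<pi>. ?e \<pi> \<partial>orc x \<xi>)\<^sup>2 \<le> (\<integral>\<pi>. (?e \<pi>)\<^sup>2 \<partial>orc x \<xi>)"
    using O.variance_positive[of ?e] unfolding O.variance_eq[OF int int2] by simp
  also have "\<dots> \<le> \<delta>\<^sup>2"
    using orc \<xi> by (simp add: delta_oracle_def follower_policy_eq_soft_policy[OF \<gamma>_nonneg \<gamma>_less \<kappa>_pos])
  finally have sq: "(\<integral>\<pi>. ?e \<pi> \<partial>orc x \<xi>)\<^sup>2 \<le> \<delta>\<^sup>2" .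
  have "0 \<le> \<delta>"
    using orc unfolding delta_oracle_def by (rule conjunct1)
  with sq show "(\<integral>\<pi>. ?e \<pi> \<partial>orc x \<xi>) \<le> \<delta>"
    by (rule power2_le_imp_le)
qed

text \<open>Averaging over the oracle's policy turns the distance into \<open>\<delta>\<close>, and averaging over the context turns
  the hypergradient into the gradient of \<open>F\<close>.\<close>

lemma hpgd_step_descent:
  "\<exists>b\<ge>0. \<exists>c\<ge>0. \<forall>\<delta> (orc :: ('d, 'c, 's, 'a) oracle_kernel) \<alpha> x.
     delta_oracle \<Xi> \<gamma> \<kappa> M \<delta> orc \<longrightarrow> 0 < \<alpha> \<longrightarrow>
     (\<integral>\<^sup>+y. ennreal (F y - F xmin) \<partial>hpgd_step \<Xi> \<gamma> \<kappa> M f \<nu> orc \<alpha> x)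
       + ennreal (\<alpha> * (infnorm (gradient F x))\<^sup>2)
     \<le> ennreal (F x - F xmin + (\<alpha> * b * \<delta> + \<alpha>\<^sup>2 * c))"
proof -
  obtain b c where bc: "0 \<le> b" "0 \<le> c" and step: "\<forall>\<xi>\<in>space \<Xi>. \<forall>x \<pi> \<alpha>. is_policy \<pi> \<longrightarrow> 0 < \<alpha> \<longrightarrow>
     (let u = F x - F xmin - \<alpha> * inner (F_gradient x) (hypergradient x \<xi> (follower x \<xi>))
            + \<alpha> * b * infnorm (follower x \<xi> - \<pi>) + \<alpha>\<^sup>2 * c
      in 0 \<le> u \<and> (\<integral>\<^sup>+y. ennreal (F y - F xmin) \<partial>step_law \<nu> \<alpha> x \<xi> \<pi>) \<le> ennreal u)"
    using step_law_descent by blast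
  have "(\<integral>\<^sup>+y. ennreal (F y - F xmin) \<partial>hpgd_step \<Xi> \<gamma> \<kappa> M f \<nu> orc \<alpha> x)
       + ennreal (\<alpha> * (infnorm (gradient F x))\<^sup>2)
     \<le> ennreal (F x - F xmin + (\<alpha> * b * \<delta> + \<alpha>\<^sup>2 * c))"
    if orc: "delta_oracle \<Xi> \<gamma> \<kappa> M \<delta> orc" and \<alpha>: "0 < \<alpha>"
    for \<delta> and orc :: "('d, 'c, 's, 'a) oracle_kernel" and \<alpha> x
  proof -
    let ?D = "F_gradient x"
    let ?H = "\<lambda>\<xi>. hypergradient x \<xi> (follower x \<xi>)"
    let ?\<Phi> = "\<lambda>y. ennreal (F y - F xmin)"
    have \<Phi>_meas: "?\<Phi> \<in> borel_measurable borel"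
      using F_measurable by measurable
    have orc_meas: "(\<lambda>(x, \<xi>). orc x \<xi>) \<in> measurable (borel \<Otimes>\<^sub>M \<Xi>) (prob_algebra policy_algebra)"
      using orc by (simp add: delta_oracle_def)
    define w where "w = (\<lambda>\<xi>. F x - F xmin - \<alpha> * inner ?D (?H \<xi>) + \<alpha> * b * \<delta> + \<alpha>\<^sup>2 * c)"
    have w: "0 \<le> w \<xi>" "(\<integral>\<^sup>+y. ?\<Phi> y \<partial>(orc x \<xi> \<bind> step_law \<nu> \<alpha> x \<xi>)) \<le> ennreal (w \<xi>)" if \<xi>: "\<xi> \<in> space \<Xi>" for \<xi>
    proof -
      note O = oracle_error_mean[OF orc \<xi>, of x]
      interpret O: prob_space "orc x \<xi>" by (rule O(1))
      define u where "u = (\<lambda>\<pi>. F x - F xmin - \<alpha> * inner ?D (?H \<xi>)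
            + \<alpha> * b * infnorm (follower x \<xi> - \<pi>) + \<alpha>\<^sup>2 * c)"
      have u: "0 \<le> u \<pi>" "(\<integral>\<^sup>+y. ?\<Phi> y \<partial>step_law \<nu> \<alpha> x \<xi> \<pi>) \<le> ennreal (u \<pi>)" if "is_policy \<pi>" for \<pi>
        using step[rule_format, OF \<xi> that \<alpha>, of x] by (simp_all add: u_def Let_def)
      have int_u: "integrable (orc x \<xi>) u"
        unfolding u_def using O(4) by simp
      have "(\<integral>\<pi>. u \<pi> \<partial>orc x \<xi>) = F x - F xmin - \<alpha> * inner ?D (?H \<xi>)
          + \<alpha> * b * (\<integral>\<pi>. infnorm (follower x \<xi> - \<pi>) \<partial>orc x \<xi>) + \<alpha>\<^sup>2 * c"
        unfolding u_def using O(4) by (simp add: O.prob_space)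
      also have "\<dots> \<le> w \<xi>"
        unfolding w_def using O(5) \<alpha> bc by (simp add: mult_left_mono)
      finally have uw: "(\<integral>\<pi>. u \<pi> \<partial>orc x \<xi>) \<le> w \<xi>" .
      have "0 \<le> (\<integral>\<pi>. u \<pi> \<partial>orc x \<xi>)"
        using u(1) O(3) by (intro integral_nonneg_AE AE_I2) auto
      with uw show "0 \<le> w \<xi>" by linarith
      have "step_law \<nu> \<alpha> x \<xi> \<in> measurable policy_algebra (subprob_algebra borel)"
        using measurable_compose[OF measurable_Pair1'[of "(x, \<xi>)" "borel \<Otimes>\<^sub>M \<Xi>" policy_algebra] step_law_measurable[of \<nu> \<alpha>]] \<xi>
        by (simp add: space_pair_measure)
      then have kernel: "step_law \<nu> \<alpha> x \<xi> \<in> measurable (orc x \<xi>) (subprob_algebra borel)"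
        by (simp add: measurable_cong_sets[OF O(2) refl])
      have "(\<integral>\<^sup>+y. ?\<Phi> y \<partial>(orc x \<xi> \<bind> step_law \<nu> \<alpha> x \<xi>)) = (\<integral>\<^sup>+\<pi>. \<integral>\<^sup>+y. ?\<Phi> y \<partial>step_law \<nu> \<alpha> x \<xi> \<pi> \<partial>orc x \<xi>)"
        by (rule nn_integral_bind[OF \<Phi>_meas kernel])
      also have "\<dots> \<le> (\<integral>\<^sup>+\<pi>. ennreal (u \<pi>) \<partial>orc x \<xi>)"
        using u(2) O(3) by (intro nn_integral_mono) auto
      also have "\<dots> = ennreal (\<integral>\<pi>. u \<pi> \<partial>orc x \<xi>)"
        using u(1) O(3) int_u by (intro nn_integral_eq_integral AE_I2) auto
      also have "\<dots> \<le> ennreal (w \<xi>)"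
        by (rule ennreal_leI[OF uw])
      finally show "(\<integral>\<^sup>+y. ?\<Phi> y \<partial>(orc x \<xi> \<bind> step_law \<nu> \<alpha> x \<xi>)) \<le> ennreal (w \<xi>)" .
    qed
    have int_w: "integrable \<Xi> w"
      unfolding w_def using hypergradient_integrable[of x] by simp
    have int_w_eq: "(\<integral>\<xi>. w \<xi> \<partial>\<Xi>) = F x - F xmin - \<alpha> * inner ?D ?D + \<alpha> * b * \<delta> + \<alpha>\<^sup>2 * c"
      unfolding w_def using hypergradient_integrable[of x]
      by (simp add: context_space.prob_space inner_F_gradient[symmetric] del: integral_inner_right)
    have nn_w: "0 \<le> (\<integral>\<xi>. w \<xi> \<partial>\<Xi>)"
      using w(1) by (intro integral_nonneg_AE AE_I2) auto
    have "(\<lambda>\<xi>. orc x \<xi> \<bind> step_law \<nu> \<alpha> x \<xi>) \<in> measurable \<Xi> (subprob_algebra borel)"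
      using measurable_compose[OF measurable_Pair1'[of x borel \<Xi>] oracle_step_measurable[OF orc_meas, of \<nu> \<alpha>]]
      by simp
    then have "(\<integral>\<^sup>+y. ?\<Phi> y \<partial>hpgd_step \<Xi> \<gamma> \<kappa> M f \<nu> orc \<alpha> x) = (\<integral>\<^sup>+\<xi>. \<integral>\<^sup>+y. ?\<Phi> y \<partial>(orc x \<xi> \<bind> step_law \<nu> \<alpha> x \<xi>) \<partial>\<Xi>)"
      unfolding hpgd_step_eq by (rule nn_integral_bind[OF \<Phi>_meas])
    also have "\<dots> \<le> (\<integral>\<^sup>+\<xi>. ennreal (w \<xi>) \<partial>\<Xi>)"
      using w(2) by (intro nn_integral_mono) auto
    also have "\<dots> = ennreal (\<integral>\<xi>. w \<xi> \<partial>\<Xi>)"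
      using w(1) int_w by (intro nn_integral_eq_integral AE_I2) auto
    finally have "(\<integral>\<^sup>+y. ?\<Phi> y \<partial>hpgd_step \<Xi> \<gamma> \<kappa> M f \<nu> orc \<alpha> x) \<le> ennreal (\<integral>\<xi>. w \<xi> \<partial>\<Xi>)" .
    moreover have "ennreal (\<alpha> * (infnorm (gradient F x))\<^sup>2) \<le> ennreal (\<alpha> * inner ?D ?D)"
      unfolding gradient_F dot_square_norm using \<alpha>
      by (intro ennreal_leI mult_left_mono power_mono infnorm_le_norm infnorm_pos_le) auto
    ultimately have "(\<integral>\<^sup>+y. ?\<Phi> y \<partial>hpgd_step \<Xi> \<gamma> \<kappa> M f \<nu> orc \<alpha> x) + ennreal (\<alpha> * (infnorm (gradient F x))\<^sup>2)
        \<le> ennreal (\<integral>\<xi>. w \<xi> \<partial>\<Xi>) + ennreal (\<alpha> * inner ?D ?D)"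
      by (rule add_mono)
    also have "\<dots> = ennreal ((\<integral>\<xi>. w \<xi> \<partial>\<Xi>) + \<alpha> * inner ?D ?D)"
      using nn_w \<alpha> by (simp add: ennreal_plus)
    also have "(\<integral>\<xi>. w \<xi> \<partial>\<Xi>) + \<alpha> * inner ?D ?D = F x - F xmin + (\<alpha> * b * \<delta> + \<alpha>\<^sup>2 * c)"
      unfolding int_w_eq by simp
    finally show ?thesis .
  qed
  with bc show ?thesis by blast
qed

lemma hpgd_iterate_in_space:
  assumes orc: "delta_oracle \<Xi> \<gamma> \<kappa> M \<delta> orc"
  shows "hpgd_iterate \<Xi> \<gamma> \<kappa> M f \<nu> orc x0 \<alpha> t \<in> space (subprob_algebra borel)"
proof (induction t)
  case 0
  show ?case
    by (simp add: space_subprob_algebra prob_space_imp_subprob_space prob_space_return)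
next
  case (Suc t)
  let ?\<mu> = "hpgd_iterate \<Xi> \<gamma> \<kappa> M f \<nu> orc x0 \<alpha> t"
  interpret subprob_space ?\<mu>
    using Suc by (simp add: space_subprob_algebra)
  have sets: "sets ?\<mu> = sets borel"
    using Suc by (simp add: space_subprob_algebra)
  have "hpgd_step \<Xi> \<gamma> \<kappa> M f \<nu> orc \<alpha> \<in> measurable ?\<mu> (subprob_algebra borel)"
    using hpgd_step_measurable[of orc \<nu> \<alpha>] orc by (simp add: measurable_cong_sets[OF sets refl] delta_oracle_def)
  then show ?case
    by (simp add: bind_in_space)
qed

text \<open>Stated for the nonnegative function \<open>F - F xmin\<close>, so that all expectations exist as extended
  nonnegative numbers.\<close>

lemma hpgd_telescoping:
  assumes orc: "delta_oracle \<Xi> \<gamma> \<kappa> M \<delta> orc" and \<alpha>: "0 < \<alpha>" and "0 \<le> e"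
    and step: "\<And>x. (\<integral>\<^sup>+y. ennreal (F y - F xmin) \<partial>hpgd_step \<Xi> \<gamma> \<kappa> M f \<nu> orc \<alpha> x)
       + ennreal (\<alpha> * (infnorm (gradient F x))\<^sup>2) \<le> ennreal (F x - F xmin + e)"
  shows "(\<integral>\<^sup>+y. ennreal (F y - F xmin) \<partial>hpgd_iterate \<Xi> \<gamma> \<kappa> M f \<nu> orc x0 \<alpha> T)
      + (\<Sum>t<T. \<integral>\<^sup>+x. ennreal (\<alpha> * (infnorm (gradient F x))\<^sup>2) \<partial>hpgd_iterate \<Xi> \<gamma> \<kappa> M f \<nu> orc x0 \<alpha> t)
    \<le> ennreal (F x0 - F xmin + real T * e)"
proof (induction T)
  case 0
  show ?case
    using F_measurable by (simp add: nn_integral_return)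
next
  case (Suc T)
  let ?\<mu> = "hpgd_iterate \<Xi> \<gamma> \<kappa> M f \<nu> orc x0 \<alpha>"
  let ?\<Phi> = "\<lambda>y. ennreal (F y - F xmin)" and ?g = "\<lambda>x. ennreal (\<alpha> * (infnorm (gradient F x))\<^sup>2)"
  let ?step = "hpgd_step \<Xi> \<gamma> \<kappa> M f \<nu> orc \<alpha>"
  have sp: "subprob_space (?\<mu> T)" and sets: "sets (?\<mu> T) = sets borel"
    using hpgd_iterate_in_space[OF orc] by (simp_all add: space_subprob_algebra)
  have \<Phi>: "?\<Phi> \<in> borel_measurable borel"
    using F_measurable by measurable
  have grad: "?g \<in> borel_measurable borel"
    unfolding gradient_F using measurable_compose[OF F_gradient_measurable infnorm_borel_measurable] by measurable
  have kernel: "?step \<in> measurable borel (subprob_algebra borel)"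
    using hpgd_step_measurable[of orc \<nu> \<alpha>] orc by (simp add: delta_oracle_def)
  have kernel_\<mu>: "?step \<in> measurable (?\<mu> T) (subprob_algebra borel)"
    using kernel by (simp add: measurable_cong_sets[OF sets refl])
  have inner: "(\<lambda>x. \<integral>\<^sup>+y. ?\<Phi> y \<partial>?step x) \<in> borel_measurable borel"
    by (rule measurable_compose[OF kernel nn_integral_measurable_subprob_algebra[OF \<Phi>]])
  note borel_\<mu> = measurable_cong_sets[OF sets refl]
  have "(\<integral>\<^sup>+y. ?\<Phi> y \<partial>?\<mu> (Suc T)) + (\<integral>\<^sup>+x. ?g x \<partial>?\<mu> T) = (\<integral>\<^sup>+x. (\<integral>\<^sup>+y. ?\<Phi> y \<partial>?step x) + ?g x \<partial>?\<mu> T)"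
    using inner grad
    by (simp add: nn_integral_bind[OF \<Phi> kernel_\<mu>] nn_integral_add borel_\<mu>)
  also have "\<dots> \<le> (\<integral>\<^sup>+x. ?\<Phi> x + ennreal e \<partial>?\<mu> T)"
  proof (rule nn_integral_mono)
    fix x
    have "ennreal (F x - F xmin + e) = ?\<Phi> x + ennreal e"
      using xmin[of x] \<open>0 \<le> e\<close> by (simp add: ennreal_plus)
    with step[of x] show "(\<integral>\<^sup>+y. ?\<Phi> y \<partial>?step x) + ?g x \<le> ?\<Phi> x + ennreal e" by simp
  qed
  also have "\<dots> = (\<integral>\<^sup>+x. ?\<Phi> x \<partial>?\<mu> T) + ennreal e * emeasure (?\<mu> T) (space (?\<mu> T))"
    using \<Phi> by (simp add: nn_integral_add borel_\<mu>)
  also have "\<dots> \<le> (\<integral>\<^sup>+x. ?\<Phi> x \<partial>?\<mu> T) + ennreal e * 1"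
    by (intro add_mono mult_left_mono subprob_space.emeasure_space_le_1 sp) auto
  finally have "(\<integral>\<^sup>+y. ?\<Phi> y \<partial>?\<mu> (Suc T)) + (\<integral>\<^sup>+x. ?g x \<partial>?\<mu> T) \<le> (\<integral>\<^sup>+x. ?\<Phi> x \<partial>?\<mu> T) + ennreal e"
    by simp
  then have "(\<integral>\<^sup>+y. ?\<Phi> y \<partial>?\<mu> (Suc T)) + (\<Sum>t<Suc T. \<integral>\<^sup>+x. ?g x \<partial>?\<mu> t)
      \<le> ((\<integral>\<^sup>+x. ?\<Phi> x \<partial>?\<mu> T) + ennreal e) + (\<Sum>t<T. \<integral>\<^sup>+x. ?g x \<partial>?\<mu> t)"
    by (simp add: add.assoc add.commute[of "\<Sum>t<T. _ t"] add_right_mono del: hpgd_iterate.simps)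
  also have "\<dots> = ((\<integral>\<^sup>+x. ?\<Phi> x \<partial>?\<mu> T) + (\<Sum>t<T. \<integral>\<^sup>+x. ?g x \<partial>?\<mu> t)) + ennreal e"
    by (simp add: ac_simps)
  also have "\<dots> \<le> ennreal (F x0 - F xmin + real T * e) + ennreal e"
    by (intro add_right_mono Suc)
  also have "\<dots> = ennreal (F x0 - F xmin + real (Suc T) * e)"
  proof -
    have "0 \<le> F x0 - F xmin + real T * e"
      using xmin[of x0] \<open>0 \<le> e\<close> by simp
    from ennreal_plus[OF this \<open>0 \<le> e\<close>] show ?thesis
      by (simp only: of_nat_Suc distrib_right mult_1_left add_ac)
  qed
  finally show ?case .
qed

lemma hpgd_output_bound:
  "\<exists>C\<ge>0. \<forall>T \<alpha> \<delta> (orc :: ('d, 'c, 's, 'a) oracle_kernel). 1 \<le> T \<longrightarrow> 0 < \<alpha> \<longrightarrow> delta_oracle \<Xi> \<gamma> \<kappa> M \<delta> orc \<longrightarrow>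
     integrable (hpgd_output \<Xi> \<gamma> \<kappa> M f \<nu> orc x0 \<alpha> T) (\<lambda>x. (infnorm (gradient F x))\<^sup>2) \<and>
     (\<integral>x. (infnorm (gradient F x))\<^sup>2 \<partial>hpgd_output \<Xi> \<gamma> \<kappa> M f \<nu> orc x0 \<alpha> T)
       \<le> C * (1 / (\<alpha> * real T) + \<delta> + \<alpha>)"
proof -
  obtain b c where bc: "0 \<le> b" "0 \<le> c" and step: "\<forall>\<delta> (orc :: ('d, 'c, 's, 'a) oracle_kernel) \<alpha> x.
     delta_oracle \<Xi> \<gamma> \<kappa> M \<delta> orc \<longrightarrow> 0 < \<alpha> \<longrightarrow>
     (\<integral>\<^sup>+y. ennreal (F y - F xmin) \<partial>hpgd_step \<Xi> \<gamma> \<kappa> M f \<nu> orc \<alpha> x)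
       + ennreal (\<alpha> * (infnorm (gradient F x))\<^sup>2)
     \<le> ennreal (F x - F xmin + (\<alpha> * b * \<delta> + \<alpha>\<^sup>2 * c))"
    using hpgd_step_descent by blast
  define \<Delta> where "\<Delta> = F x0 - F xmin"
  have \<Delta>: "0 \<le> \<Delta>" using xmin[of x0] by (simp add: \<Delta>_def)
  let ?C = "max \<Delta> (max b c)"
  let ?g = "\<lambda>x. (infnorm (gradient F x))\<^sup>2"
  have "integrable (hpgd_output \<Xi> \<gamma> \<kappa> M f \<nu> orc x0 \<alpha> T) ?g \<and>
     (\<integral>x. ?g x \<partial>hpgd_output \<Xi> \<gamma> \<kappa> M f \<nu> orc x0 \<alpha> T) \<le> ?C * (1 / (\<alpha> * real T) + \<delta> + \<alpha>)"
    if T: "1 \<le> T" and \<alpha>: "0 < \<alpha>" and orc: "delta_oracle \<Xi> \<gamma> \<kappa> M \<delta> orc"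
    for T \<alpha> \<delta> and orc :: "('d, 'c, 's, 'a) oracle_kernel"
  proof -
    let ?\<mu> = "hpgd_iterate \<Xi> \<gamma> \<kappa> M f \<nu> orc x0 \<alpha>" and ?out = "hpgd_output \<Xi> \<gamma> \<kappa> M f \<nu> orc x0 \<alpha> T"
    define e where "e = \<alpha> * b * \<delta> + \<alpha>\<^sup>2 * c"
    have \<delta>: "0 \<le> \<delta>" using orc by (simp add: delta_oracle_def)
    have e: "0 \<le> e" using \<alpha> bc \<delta> by (simp add: e_def)
    have grad: "?g \<in> borel_measurable borel"
      unfolding gradient_F using measurable_compose[OF F_gradient_measurable infnorm_borel_measurable] by measurable
    have kernel: "?\<mu> \<in> measurable (measure_pmf (pmf_of_set {..<T})) (subprob_algebra borel)"
      using hpgd_iterate_in_space[OF orc] by (simp add: measurable_def)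
    have sets: "sets ?out = sets borel"
      unfolding hpgd_output_def using hpgd_iterate_in_space[OF orc]
      by (intro sets_bind) (simp_all add: space_subprob_algebra)
    have grad\<alpha>: "(\<lambda>x. ennreal (\<alpha> * ?g x)) \<in> borel_measurable borel"
      using grad by measurable
    have "(\<integral>\<^sup>+x. ennreal (\<alpha> * ?g x) \<partial>?out) = (\<integral>\<^sup>+t. \<integral>\<^sup>+x. ennreal (\<alpha> * ?g x) \<partial>?\<mu> t \<partial>pmf_of_set {..<T})"
      unfolding hpgd_output_def by (rule nn_integral_bind[OF grad\<alpha> kernel])
    also have "\<dots> = (\<Sum>t<T. \<integral>\<^sup>+x. ennreal (\<alpha> * ?g x) \<partial>?\<mu> t) / real T"
      using T by (subst nn_integral_pmf_of_set) (auto simp: lessThan_empty_iff ennreal_of_nat_eq_real_of_nat)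
    also have "\<dots> \<le> ennreal (\<Delta> + real T * e) / real T"
    proof (rule divide_right_mono_ennreal)
      have "(\<integral>\<^sup>+y. ennreal (F y - F xmin) \<partial>?\<mu> T) + (\<Sum>t<T. \<integral>\<^sup>+x. ennreal (\<alpha> * ?g x) \<partial>?\<mu> t) \<le> ennreal (\<Delta> + real T * e)"
        unfolding \<Delta>_def by (rule hpgd_telescoping[OF orc \<alpha> e]) (use step orc \<alpha> in \<open>simp add: e_def\<close>)
      then show "(\<Sum>t<T. \<integral>\<^sup>+x. ennreal (\<alpha> * ?g x) \<partial>?\<mu> t) \<le> ennreal (\<Delta> + real T * e)"
        by (rule order_trans[rotated]) simp
    qed
    also have "\<dots> = ennreal ((\<Delta> + real T * e) / real T)"
      using T \<Delta> e by (intro divide_ennreal) auto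
    finally have le: "(\<integral>\<^sup>+x. ennreal (\<alpha> * ?g x) \<partial>?out) \<le> ennreal ((\<Delta> + real T * e) / real T)" .
    have meas: "(\<lambda>x. \<alpha> * ?g x) \<in> borel_measurable ?out"
      unfolding measurable_cong_sets[OF sets refl] using grad by measurable
    have int: "integrable ?out (\<lambda>x. \<alpha> * ?g x)"
      using le_less_trans[OF le ennreal_less_top] \<alpha> by (intro integrableI_nonneg meas) (auto intro!: AE_I2)
    then have int_g: "integrable ?out ?g"
      using \<alpha> by simp
    have "ennreal (\<integral>x. \<alpha> * ?g x \<partial>?out) \<le> ennreal ((\<Delta> + real T * e) / real T)"
      using le int \<alpha> by (subst nn_integral_eq_integral[symmetric]) auto
    then have "\<alpha> * (\<integral>x. ?g x \<partial>?out) \<le> (\<Delta> + real T * e) / real T"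
      using \<Delta> e by (subst (asm) ennreal_le_iff) auto
    then have "(\<integral>x. ?g x \<partial>?out) \<le> (\<Delta> + real T * e) / real T / \<alpha>"
      by (subst pos_le_divide_eq[OF \<alpha>]) (simp only: mult.commute[of _ \<alpha>])
    also have "\<dots> = \<Delta> * (1 / (\<alpha> * real T)) + b * \<delta> + c * \<alpha>"
      using \<alpha> T by (simp add: e_def field_simps power2_eq_square)
    also have "\<dots> \<le> ?C * (1 / (\<alpha> * real T)) + ?C * \<delta> + ?C * \<alpha>"
      using \<alpha> \<delta> by (intro add_mono mult_right_mono) auto
    finally show ?thesis
      using int_g by (simp add: distrib_left)
  qed
  moreover have "0 \<le> ?C" using \<Delta> by simp
  ultimately show ?thesis by blast
qed

end

theorem theorem3:
  fixes \<Xi> :: "'c measure"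
    and M :: "real ^ 'd::finite \<Rightarrow> 'c \<Rightarrow> ('s::finite, 'a::finite) mdp"
    and f :: "real ^ 'd \<Rightarrow> ('s, 'a) policy \<Rightarrow> 'c \<Rightarrow> real"
    and \<nu> :: "'s pmf"
    and x0 :: "real ^ 'd"
    and \<gamma> \<kappa> L\<^sub>f S\<^sub>f R K\<^sub>1 K\<^sub>2 K\<^sub>3 :: real
  defines "F \<equiv> leader_objective \<Xi> \<gamma> \<kappa> M f"
  assumes "prob_space \<Xi>"
    and "0 < \<gamma>" and "\<gamma> < 1" and "0 < \<kappa>"
    and "regular_loss \<Xi> L\<^sub>f S\<^sub>f f"
    and "regular_mdps \<Xi> R K\<^sub>1 K\<^sub>2 M"
    and "smooth_mdps \<Xi> K\<^sub>3 M"
    and "\<And>x. integrable \<Xi> (\<lambda>\<xi>. f x (follower_policy \<gamma> \<kappa> (M x \<xi>)) \<xi>)"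
    and "\<exists>xmin. \<forall>x. F xmin \<le> F x"
    and "set_pmf \<nu> = UNIV"
  shows "(\<forall>x. F differentiable (at x)) \<and>
    (\<exists>C. \<forall>T \<alpha> \<delta> orc.
       1 \<le> T \<longrightarrow> 0 < \<alpha> \<longrightarrow> 2 * S\<^sub>f * \<alpha> \<le> 1 \<longrightarrow> delta_oracle \<Xi> \<gamma> \<kappa> M \<delta> orc \<longrightarrow>
       integrable (hpgd_output \<Xi> \<gamma> \<kappa> M f \<nu> orc x0 \<alpha> T) (\<lambda>x. (infnorm (gradient F x))\<^sup>2) \<and>
       (\<integral>x. (infnorm (gradient F x))\<^sup>2 \<partial>hpgd_output \<Xi> \<gamma> \<kappa> M f \<nu> orc x0 \<alpha> T)
         \<le> C * (1 / (\<alpha> * real T) + \<delta> + \<alpha>)) \<and>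
    (\<forall>\<alpha> \<delta> orc.
       (\<forall>\<^sub>F T in sequentially. 0 < \<alpha> T \<and> 2 * S\<^sub>f * \<alpha> T \<le> 1 \<and> delta_oracle \<Xi> \<gamma> \<kappa> M (\<delta> T) (orc T)) \<longrightarrow>
       \<alpha> \<in> \<Theta>(\<lambda>T. 1 / sqrt (real T)) \<longrightarrow>
       \<delta> \<in> O(\<lambda>T. 1 / sqrt (real T)) \<longrightarrow>
       (\<lambda>T. \<integral>x. (infnorm (gradient F x))\<^sup>2 \<partial>hpgd_output \<Xi> \<gamma> \<kappa> M f \<nu> (orc T) x0 (\<alpha> T) T)
         \<in> O(\<lambda>T. 1 / sqrt (real T)))"
proof -
  obtain xmin where xmin: "\<forall>x. F xmin \<le> F x" using assms(10) by blast
  interpret problem: leader_problem \<Xi> M f \<gamma> \<kappa> L\<^sub>f S\<^sub>f R K\<^sub>1 K\<^sub>2 K\<^sub>3 \<nu> xmin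
  proof (intro leader_problem.intro bilevel_problem.intro leader_problem_axioms.intro assms(2-9) assms(11))
    show "leader_objective \<Xi> \<gamma> \<kappa> M f xmin \<le> leader_objective \<Xi> \<gamma> \<kappa> M f x" for x
      using xmin by (simp add: F_def)
  qed
  obtain C where C: "0 \<le> C" and bound: "\<forall>T \<alpha> \<delta> (orc :: ('d, 'c, 's, 'a) oracle_kernel).
     1 \<le> T \<longrightarrow> 0 < \<alpha> \<longrightarrow> delta_oracle \<Xi> \<gamma> \<kappa> M \<delta> orc \<longrightarrow>
     integrable (hpgd_output \<Xi> \<gamma> \<kappa> M f \<nu> orc x0 \<alpha> T) (\<lambda>x. (infnorm (gradient F x))\<^sup>2) \<and>
     (\<integral>x. (infnorm (gradient F x))\<^sup>2 \<partial>hpgd_output \<Xi> \<gamma> \<kappa> M f \<nu> orc x0 \<alpha> T)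
       \<le> C * (1 / (\<alpha> * real T) + \<delta> + \<alpha>)"
    using problem.hpgd_output_bound[of x0] unfolding F_def by blast
  have rate: "(\<lambda>T. \<integral>x. (infnorm (gradient F x))\<^sup>2 \<partial>hpgd_output \<Xi> \<gamma> \<kappa> M f \<nu> (orc T) x0 (\<alpha> T) T)
      \<in> O(\<lambda>T. 1 / sqrt (real T))"
    if ev: "\<forall>\<^sub>F T in sequentially. 0 < \<alpha> T \<and> 2 * S\<^sub>f * \<alpha> T \<le> 1 \<and> delta_oracle \<Xi> \<gamma> \<kappa> M (\<delta> T) (orc T)"
      and \<alpha>\<Theta>: "\<alpha> \<in> \<Theta>(\<lambda>T. 1 / sqrt (real T))" and \<delta>O: "\<delta> \<in> O(\<lambda>T. 1 / sqrt (real T))"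
    for \<alpha> \<delta> and orc :: "nat \<Rightarrow> ('d, 'c, 's, 'a) oracle_kernel"
  proof -
    obtain a where a: "0 < a" "\<forall>\<^sub>F T in sequentially. norm (\<alpha> T) \<ge> a * norm (1 / sqrt (real T))"
      using bigthetaD2[OF \<alpha>\<Theta>] by (elim landau_omega.bigE)
    obtain A where A: "\<forall>\<^sub>F T in sequentially. norm (\<alpha> T) \<le> A * norm (1 / sqrt (real T))"
      using bigthetaD1[OF \<alpha>\<Theta>] by (elim landau_o.bigE)
    obtain D where D: "\<forall>\<^sub>F T in sequentially. norm (\<delta> T) \<le> D * norm (1 / sqrt (real T))"
      using \<delta>O by (elim landau_o.bigE)
    show ?thesis
    \<comment> \<open>The summand \<open>1\<close> makes the constant positive also when \<open>C = 0\<close>.\<close>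
    proof (rule landau_o.bigI[of "C * (1 / a + D + A) + 1"])
      have "0 \<le> A" "0 \<le> D"
      proof -
        show "0 \<le> A"
          using eventually_happens'[OF sequentially_bot eventually_conj[OF A eventually_gt_at_top[of 0]]]
          by (auto simp: zero_le_divide_iff dest: order_trans[OF abs_ge_zero])
        show "0 \<le> D"
          using eventually_happens'[OF sequentially_bot eventually_conj[OF D eventually_gt_at_top[of 0]]]
          by (auto simp: zero_le_divide_iff dest: order_trans[OF abs_ge_zero])
      qed
      then have "0 \<le> C * (1 / a + D + A)"
        using C a by (intro mult_nonneg_nonneg add_nonneg_nonneg) auto
      then show "0 < C * (1 / a + D + A) + 1" by linarith
      show "\<forall>\<^sub>F T in sequentially. norm (\<integral>x. (infnorm (gradient F x))\<^sup>2 \<partial>hpgd_output \<Xi> \<gamma> \<kappa> M f \<nu> (orc T) x0 (\<alpha> T) T)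
          \<le> (C * (1 / a + D + A) + 1) * norm (1 / sqrt (real T))"
        using ev a(2) A D eventually_gt_at_top[of 0]
      proof eventually_elim
        case (elim T)
        let ?r = "1 / sqrt (real T)"
        have T: "0 < sqrt (real T)" "sqrt (real T) * sqrt (real T) = real T" using elim by auto
        have "a * ?r \<le> \<alpha> T" using elim T by simp
        then have "a * ?r * real T \<le> \<alpha> T * real T"
          using elim by (intro mult_right_mono) auto
        moreover have "a * ?r * real T = a * sqrt (real T)"
          using T by (simp add: field_simps)
        ultimately have "1 / (\<alpha> T * real T) \<le> 1 / (a * sqrt (real T))"
          using a T by (intro divide_left_mono) (auto intro!: mult_pos_pos elim!: order.strict_trans2[rotated])
        then have 1: "1 / (\<alpha> T * real T) \<le> 1 / a * ?r" by simp
        have 2: "\<delta> T \<le> D * ?r" "\<alpha> T \<le> A * ?r" using elim T by auto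
        have nn: "0 \<le> (\<integral>x. (infnorm (gradient F x))\<^sup>2 \<partial>hpgd_output \<Xi> \<gamma> \<kappa> M f \<nu> (orc T) x0 (\<alpha> T) T)"
          by (intro Bochner_Integration.integral_nonneg) simp
        have "(\<integral>x. (infnorm (gradient F x))\<^sup>2 \<partial>hpgd_output \<Xi> \<gamma> \<kappa> M f \<nu> (orc T) x0 (\<alpha> T) T)
            \<le> C * (1 / (\<alpha> T * real T) + \<delta> T + \<alpha> T)"
          using bound elim by (simp add: Suc_le_eq)
        also have "\<dots> \<le> C * (1 / a * ?r + D * ?r + A * ?r)"
          using 1 2 by (intro mult_left_mono C add_mono) auto
        also have "\<dots> = C * (1 / a + D + A) * ?r"
          by (simp add: algebra_simps)
        also have "\<dots> \<le> (C * (1 / a + D + A) + 1) * ?r"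
          using T by (intro mult_right_mono) auto
        finally show ?case using nn T by simp
      qed
    qed
  qed
  show ?thesis
  proof (intro conjI allI impI)
    show "F differentiable (at x)" for x
      unfolding F_def by (rule problem.F_differentiable)
    show "\<exists>C. \<forall>T \<alpha> \<delta> orc.
       1 \<le> T \<longrightarrow> 0 < \<alpha> \<longrightarrow> 2 * S\<^sub>f * \<alpha> \<le> 1 \<longrightarrow> delta_oracle \<Xi> \<gamma> \<kappa> M \<delta> orc \<longrightarrow>
       integrable (hpgd_output \<Xi> \<gamma> \<kappa> M f \<nu> orc x0 \<alpha> T) (\<lambda>x. (infnorm (gradient F x))\<^sup>2) \<and>
       (\<integral>x. (infnorm (gradient F x))\<^sup>2 \<partial>hpgd_output \<Xi> \<gamma> \<kappa> M f \<nu> orc x0 \<alpha> T)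
         \<le> C * (1 / (\<alpha> * real T) + \<delta> + \<alpha>)"
      using bound by blast
  qed (rule rate)
qed

end
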